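(* Let $\Delta$ be a complete simplicial multi-fan in a lattice $L$ of rank $n$, $\mathcal V$ a set of edge vectors for $\Delta$, and $\xi\in H_T^2(\Delta,\mathcal V)\otimes\mathbb Q$. If $\xi=u$ in $H_T^2(\Delta,\mathcal V)\otimes\mathbb Q$ for some non-zero $u\in L_{\mathcal V}^*\otimes\mathbb Q$, then $\hat\varphi_{st}(\Delta,\mathcal V,\xi;\tau,\sigma)$ vanishes identically (as a function of $w\in L_{\mathbb C}$).
   Context: **Multi-fans.** Let $L$ be a lattice of rank $n$, $L_{\mathbb R}=L\otimes\mathbb R$, $L_{\mathbb C}=L\otimes\mathbb C$, $L^*$ the dual lattice. A simplicial multi-fan in $L$ is a triple $\Delta=(\Sigma,C,w^\pm)$: $\Sigma$ is a finite abstract simplicial complex including the empty simplex; $\Sigma^{(k)}$ is the set of simplices with $k$ vertices ($\Sigma^{(1)}$ is identified with the vertex set); $\Sigma=\coprod_{k=0}^n\Sigma^{(k)}$, $\Sigma^{(n)}\ne\emptyset$, and every simplex lies in some $I\in\Sigma^{(n)}$. $C$ assigns to $J\in\Sigma^{(k)}$ a $k$-dimensional strongly convex rational polyhedral cone $C(J)\subset L_{\mathbb R}$, with $C(\emptyset)=\{0\}$, such that for each $I\in\Sigma$ the map $J\mapsto C(J)$ is an isomorphism of ordered sets from the faces of $I$ onto the faces of $C(I)$. $w^\pm:\Sigma^{(n)}\to\mathbb Z_{\ge0}$ are maps and $w=w^+-w^-$. **Completeness.** For $K\in\Sigma$ put $L_K=L\cap\operatorname{span}_{\mathbb R}C(K)$,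 $L^K=L/L_K$. The projected multi-fan $\Delta_K$ in $L^K$ has as simplices the $J\in\Sigma$ with $J\supset K$ (with $K$ as minimum), cones $C_K(J)$ = image of $C(J)$ in $L^K\otimes\mathbb R$, and $w^\pm$ restricted to the $I\in\Sigma^{(n)}$ with $I\supset K$. A vector is generic if it lies in no linear subspace spanned by a cone of dimension less than $n$. $\Delta$ is pre-complete if $d_v=\sum_{I\in\Sigma^{(n)},\,v\in C(I)}w(I)$ is independent of the generic vector $v$, and complete if $\Delta_K$ is pre-complete for every $K\in\Sigma$. **Edge vectors and divisors.** $\mathcal V=\{v_i\}_{i\in\Sigma^{(1)}}$ with $0\ne v_i\in L\cap C(i)$ (not necessarily primitive). For $I\in\Sigma^{(n)}$, $L_{I,\mathcal V}\subset L$ is the sublattice generated by $\{v_i\}_{i\in I}$, $\{u_i^I\}_{i\in I}$ the basis of $L_{I,\mathcal V}^*$ dual to $\{v_i\}_{i\in I}$, $H_I=L/L_{I,\mathcal V}$; $L_{\mathcal V}=\bigcap_{I\in\Sigma^{(n)}}L_{I,\mathcal V}$. $H_T^*(\Delta,\mathcal V)=\mathbb Z[x_i:i\in\Sigma^{(1)}]/(\prod_{i\in J}x_i:J\notin\Sigma)$, $\deg x_i=2$. An element $u\in L_{\mathcal V}^*\otimes\mathbb Q=L^*\otimes\mathbb Q$ is regarded as the element $\sum_i\langle u,v_i\rangle x_i$ of $H_T^2(\Delta,\mathcal V)\otimes\mathbb Q$. **Orbifold elliptic genus.** Put $q=e^{2\pi\sqrt{-1}\tau}$ ($\Im\tau>0$),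 $\zeta=e^{2\pi\sqrt{-1}\sigma}$, $\zeta^a:=e^{2\pi\sqrt{-1}a\sigma}$, and with $t=e^{2\pi\sqrt{-1}z}$, $$\phi_{st}(z,\tau,\sigma)=\frac{1-\zeta t}{(1-\zeta)(1-t)}\prod_{k\ge1}\frac{(1-q^k)^2(1-\zeta tq^k)(1-\zeta^{-1}t^{-1}q^k)}{(1-\zeta q^k)(1-\zeta^{-1}q^k)(1-tq^k)(1-t^{-1}q^k)}.$$ For $\xi=\sum_id_ix_i$ and $w\in L_{\mathbb C}$, $$\hat\varphi_{st}(\Delta,\mathcal V,\xi;\tau,\sigma)(w)=\sum_{I\in\Sigma^{(n)}}\frac{w(I)}{|H_I|}\sum_{(h_1,h_2)\in H_I\times H_I}\prod_{i\in I}\zeta^{d_i\langle u_i^I,v(h_1)\rangle}\phi_{st}\bigl(\langle u_i^I,-w+\tau v(h_1)-v(h_2)\rangle,\tau,d_i\sigma\bigr),$$ where $v(h)\in L$ is any representative of $h\in H_I$ (the value does not depend on the choices). It is understood that $d_i\sigma\notin\mathbb Z+\mathbb Z\tau$ for all $i$, so that the expression is defined. *)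

theory Defs
  imports "HOL-Analysis.Analysis" "HOL-Library.Poly_Mapping"
begin

section \<open>Lattices\<close>

text \<open>
  A lattice \<open>L\<close> is a discrete subgroup of a Euclidean space, not necessarily of full rank.
  Then \<open>L\<^sub>\<real>\<close> is \<open>span L\<close> and the rank of \<open>L\<close> is \<open>dim L\<close>.
\<close>

definition int_span :: "'a::real_vector set \<Rightarrow> 'a set" where
  "int_span S = {\<Sum>b\<in>T. of_int (c b) *\<^sub>R b | T (c :: 'a \<Rightarrow> int). finite T \<and> T \<subseteq> S}"

definition is_lattice :: "'a::euclidean_space set \<Rightarrow> bool" where
  "is_lattice L \<longleftrightarrow> (\<exists>B. independent B \<and> L = int_span B)"

text \<open>
  The rational dual \<open>L\<^sup>* \<otimes> \<rat> = Hom(L, \<rat>)\<close>. An element is a function on the ambient space of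
  which only the values on \<open>L\<close> matter.
\<close>

definition dual_rat :: "'a::euclidean_space set \<Rightarrow> ('a \<Rightarrow> rat) set" where
  "dual_rat L = {u. \<forall>x\<in>L. \<forall>y\<in>L. u (x + y) = u x + u y}"

text \<open>
  The complexification of a real vector space consists of the pairs \<open>(a, b)\<close>, standing for
  \<open>a + \<i> b\<close>.
\<close>

definition lattice_complex :: "'a::euclidean_space set \<Rightarrow> ('a \<times> 'a) set" where
  "lattice_complex L = span L \<times> span L"

definition complexify :: "'a::real_vector \<Rightarrow> 'a \<times> 'a" where
  "complexify a = (a, 0)"

definition cscale :: "complex \<Rightarrow> 'a::real_vector \<times> 'a \<Rightarrow> 'a \<times> 'a" where
  "cscale c w = (Re c *\<^sub>R fst w - Im c *\<^sub>R snd w, Re c *\<^sub>R snd w + Im c *\<^sub>R fst w)"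

definition pairing_complex :: "('a \<Rightarrow> real) \<Rightarrow> 'a \<times> 'a \<Rightarrow> complex" where
  "pairing_complex u w = Complex (u (fst w)) (u (snd w))"


section \<open>Simplicial multi-fans\<close>

record ('i, 'a) multi_fan =
  simplices :: "'i set set"
  cone_of :: "'i set \<Rightarrow> 'a set"
  wplus :: "'i set \<Rightarrow> nat"
  wminus :: "'i set \<Rightarrow> nat"

definition vertices :: "('i, 'a) multi_fan \<Rightarrow> 'i set" where
  "vertices \<Delta> = {i. {i} \<in> simplices \<Delta>}"

definition top_simplices :: "'a::euclidean_space set \<Rightarrow> ('i, 'a) multi_fan \<Rightarrow> 'i set set" where
  "top_simplices L \<Delta> = {I \<in> simplices \<Delta>. card I = dim L}"

definition weight :: "('i, 'a) multi_fan \<Rightarrow> 'i set \<Rightarrow> int" where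
  "weight \<Delta> I = int (wplus \<Delta> I) - int (wminus \<Delta> I)"

definition rational_polyhedral_cone :: "'a::euclidean_space set \<Rightarrow> 'a set \<Rightarrow> bool" where
  "rational_polyhedral_cone L C \<longleftrightarrow> (\<exists>S. finite S \<and> S \<subseteq> L \<and> C = convex_cone hull S)"

definition strongly_convex :: "'a::real_vector set \<Rightarrow> bool" where
  "strongly_convex C \<longleftrightarrow> C \<inter> uminus ` C = {0}"

text \<open>\<open>face_of\<close> counts the empty set as a face, the usual notion of a face of a cone does not.\<close>

definition cone_faces :: "'a::real_vector set \<Rightarrow> 'a set set" where
  "cone_faces C = {F. F face_of C \<and> F \<noteq> {}}"

definition simplicial_multi_fan ::
    "'a::euclidean_space set \<Rightarrow> ('i, 'a) multi_fan \<Rightarrow> bool" where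
  "simplicial_multi_fan L \<Delta> \<longleftrightarrow>
     finite (simplices \<Delta>) \<and> {} \<in> simplices \<Delta> \<and>
     (\<forall>J\<in>simplices \<Delta>. finite J \<and> (\<forall>J'\<subseteq>J. J' \<in> simplices \<Delta>)) \<and>
     (\<forall>J\<in>simplices \<Delta>. card J \<le> dim L) \<and>
     top_simplices L \<Delta> \<noteq> {} \<and>
     (\<forall>J\<in>simplices \<Delta>. \<exists>I\<in>top_simplices L \<Delta>. J \<subseteq> I) \<and>
     (\<forall>J\<in>simplices \<Delta>. rational_polyhedral_cone L (cone_of \<Delta> J) \<and>
        strongly_convex (cone_of \<Delta> J) \<and> dim (cone_of \<Delta> J) = card J) \<and>
     cone_of \<Delta> {} = {0} \<and>
     (\<forall>I\<in>simplices \<Delta>. bij_betw (cone_of \<Delta>) (Pow I) (cone_faces (cone_of \<Delta> I)) \<and>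
        (\<forall>J\<subseteq>I. \<forall>J'\<subseteq>I. J \<subseteq> J' \<longleftrightarrow> cone_of \<Delta> J \<subseteq> cone_of \<Delta> J'))"


section \<open>Completeness\<close>

definition generic_vector ::
    "'a::euclidean_space set \<Rightarrow> ('i, 'a) multi_fan \<Rightarrow> 'a \<Rightarrow> bool" where
  "generic_vector L \<Delta> v \<longleftrightarrow> v \<in> span L \<and>
     (\<forall>J\<in>simplices \<Delta>. dim (cone_of \<Delta> J) < dim L \<longrightarrow> v \<notin> span (cone_of \<Delta> J))"

definition local_degree ::
    "'a::euclidean_space set \<Rightarrow> ('i, 'a) multi_fan \<Rightarrow> 'a \<Rightarrow> int" where
  "local_degree L \<Delta> v = (\<Sum>I | I \<in> top_simplices L \<Delta> \<and> v \<in> cone_of \<Delta> I. weight \<Delta> I)"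

definition pre_complete :: "'a::euclidean_space set \<Rightarrow> ('i, 'a) multi_fan \<Rightarrow> bool" where
  "pre_complete L \<Delta> \<longleftrightarrow>
     (\<forall>v v'. generic_vector L \<Delta> v \<and> generic_vector L \<Delta> v' \<longrightarrow>
        local_degree L \<Delta> v = local_degree L \<Delta> v')"

text \<open>
  For a simplex \<open>K\<close> put \<open>W = span (cone_of \<Delta> K)\<close>. The orthogonal projection along \<open>W\<close> has kernel
  \<open>W\<close>, hence kernel \<open>L\<^sub>K = L \<inter> W\<close> on \<open>L\<close>, and so its image on \<open>L\<close> is a model of the quotient lattice
  \<open>L\<^sup>K = L / L\<^sub>K\<close>, sitting in \<open>L\<^sub>\<real> / W\<close>. The choice of complement to \<open>W\<close> is immaterial.

  The simplices of the projected multi-fan are the \<open>J \<supseteq> K\<close>, with \<open>K\<close> as minimum; \<open>J\<close> is recorded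
  as \<open>J - K\<close> so that they form a simplicial complex with \<open>K\<close> as its empty simplex.
\<close>

definition orth_proj :: "'a::euclidean_space set \<Rightarrow> 'a \<Rightarrow> 'a" where
  "orth_proj W x = (THE y. y \<in> orthogonal_comp W \<and> x - y \<in> W)"

definition quotient_lattice ::
    "'a::euclidean_space set \<Rightarrow> ('i, 'a) multi_fan \<Rightarrow> 'i set \<Rightarrow> 'a set" where
  "quotient_lattice L \<Delta> K = orth_proj (span (cone_of \<Delta> K)) ` L"

definition projected_multi_fan ::
    "('i, 'a::euclidean_space) multi_fan \<Rightarrow> 'i set \<Rightarrow> ('i, 'a) multi_fan" where
  "projected_multi_fan \<Delta> K =
     \<lparr> simplices = (\<lambda>J. J - K) ` {J \<in> simplices \<Delta>. K \<subseteq> J},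
       cone_of = (\<lambda>J. orth_proj (span (cone_of \<Delta> K)) ` cone_of \<Delta> (J \<union> K)),
       wplus = (\<lambda>J. wplus \<Delta> (J \<union> K)),
       wminus = (\<lambda>J. wminus \<Delta> (J \<union> K)) \<rparr>"

definition complete_multi_fan :: "'a::euclidean_space set \<Rightarrow> ('i, 'a) multi_fan \<Rightarrow> bool" where
  "complete_multi_fan L \<Delta> \<longleftrightarrow>
     (\<forall>K\<in>simplices \<Delta>. pre_complete (quotient_lattice L \<Delta> K) (projected_multi_fan \<Delta> K))"


section \<open>Edge vectors\<close>

definition edge_vectors ::
    "'a::euclidean_space set \<Rightarrow> ('i, 'a) multi_fan \<Rightarrow> ('i \<Rightarrow> 'a) \<Rightarrow> bool" where
  "edge_vectors L \<Delta> \<V> \<longleftrightarrow> (\<forall>i\<in>vertices \<Delta>. \<V> i \<noteq> 0 \<and> \<V> i \<in> L \<inter> cone_of \<Delta> {i})"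

definition edge_lattice :: "('i \<Rightarrow> 'a::real_vector) \<Rightarrow> 'i set \<Rightarrow> 'a set" where
  "edge_lattice \<V> I = int_span (\<V> ` I)"

text \<open>
  For a simplex \<open>I\<close> of top dimension the edge vectors of \<open>I\<close> form a basis of \<open>L\<^sub>\<real>\<close>. The member
  \<open>u\<^sub>i\<^sup>I\<close> of the dual basis, extended linearly to \<open>L\<^sub>\<real>\<close>, sends \<open>x\<close> to the coefficient of \<open>\<V> i\<close> in \<open>x\<close>.
\<close>

definition dual_basis :: "('i \<Rightarrow> 'a::real_vector) \<Rightarrow> 'i set \<Rightarrow> 'i \<Rightarrow> 'a \<Rightarrow> real" where
  "dual_basis \<V> I i x = representation (\<V> ` I) x (\<V> i)"

definition H_group :: "'a::euclidean_space set \<Rightarrow> ('i \<Rightarrow> 'a) \<Rightarrow> 'i set \<Rightarrow> 'a set set" where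
  "H_group L \<V> I = L // {(x, y). x \<in> L \<and> y \<in> L \<and> x - y \<in> edge_lattice \<V> I}"

definition coset_rep :: "'a set \<Rightarrow> 'a" where
  "coset_rep h = (SOME v. v \<in> h)"


section \<open>The face ring\<close>

text \<open>
  Polynomials with rational coefficients in variables indexed by \<open>'i\<close>; \<open>H\<^sub>T\<^sup>*(\<Delta>,\<V>) \<otimes> \<rat>\<close> is the
  quotient of \<open>\<rat>[x\<^sub>i : i \<in> \<Sigma>\<^sup>(\<^sup>1\<^sup>)]\<close> by the ideal below.
\<close>

type_synonym 'i rat_mpoly = "('i \<Rightarrow>\<^sub>0 nat) \<Rightarrow>\<^sub>0 rat"

definition const_poly :: "rat \<Rightarrow> 'i rat_mpoly" where
  "const_poly c = Poly_Mapping.single 0 c"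

definition var_poly :: "'i \<Rightarrow> 'i rat_mpoly" where
  "var_poly i = Poly_Mapping.single (Poly_Mapping.single i 1) 1"

definition polys_in :: "'i set \<Rightarrow> 'i rat_mpoly set" where
  "polys_in V = {p. \<forall>m\<in>Poly_Mapping.keys p. Poly_Mapping.keys m \<subseteq> V}"

definition face_ideal :: "('i, 'a) multi_fan \<Rightarrow> 'i rat_mpoly set" where
  "face_ideal \<Delta> =
     {\<Sum>J | J \<subseteq> vertices \<Delta> \<and> J \<notin> simplices \<Delta>. p J * (\<Prod>i\<in>J. var_poly i) | p.
        \<forall>J. p J \<in> polys_in (vertices \<Delta>)}"

definition face_ring_eq ::
    "('i, 'a) multi_fan \<Rightarrow> 'i rat_mpoly \<Rightarrow> 'i rat_mpoly \<Rightarrow> bool" where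
  "face_ring_eq \<Delta> p p' \<longleftrightarrow> p - p' \<in> face_ideal \<Delta>"

definition linear_poly :: "('i, 'a) multi_fan \<Rightarrow> ('i \<Rightarrow> rat) \<Rightarrow> 'i rat_mpoly" where
  "linear_poly \<Delta> d = (\<Sum>i\<in>vertices \<Delta>. const_poly (d i) * var_poly i)"

definition dual_poly ::
    "('i, 'a) multi_fan \<Rightarrow> ('i \<Rightarrow> 'a) \<Rightarrow> ('a \<Rightarrow> rat) \<Rightarrow> 'i rat_mpoly" where
  "dual_poly \<Delta> \<V> u = linear_poly \<Delta> (\<lambda>i. u (\<V> i))"


section \<open>The orbifold elliptic genus\<close>

definition expi :: "complex \<Rightarrow> complex" where
  "expi z = exp (2 * of_real pi * \<i> * z)"

definition period_lattice :: "complex \<Rightarrow> complex set" where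
  "period_lattice \<tau> = {of_int a + of_int b * \<tau> | a b. True}"

definition phi_st :: "complex \<Rightarrow> complex \<Rightarrow> complex \<Rightarrow> complex" where
  "phi_st z \<tau> \<sigma> =
     (let t = expi z; q = expi \<tau>; \<zeta> = expi \<sigma> in
      (1 - \<zeta> * t) / ((1 - \<zeta>) * (1 - t)) *
      prodinf (\<lambda>k. let Q = q ^ Suc k in
         ((1 - Q)\<^sup>2 * (1 - \<zeta> * t * Q) * (1 - inverse \<zeta> * inverse t * Q)) /
         ((1 - \<zeta> * Q) * (1 - inverse \<zeta> * Q) * (1 - t * Q) * (1 - inverse t * Q))))"

text \<open>The point \<open>-w + \<tau> v\<^sub>1 - v\<^sub>2\<close> of \<open>L\<^sub>\<complex>\<close>.\<close>

definition shifted_point :: "complex \<Rightarrow> 'a::real_vector \<times> 'a \<Rightarrow> 'a \<Rightarrow> 'a \<Rightarrow> 'a \<times> 'a" where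
  "shifted_point \<tau> w v1 v2 = - w + cscale \<tau> (complexify v1) - complexify v2"

definition orb_elliptic_genus ::
    "'a::euclidean_space set \<Rightarrow> ('i, 'a) multi_fan \<Rightarrow> ('i \<Rightarrow> 'a) \<Rightarrow> ('i \<Rightarrow> rat) \<Rightarrow>
     complex \<Rightarrow> complex \<Rightarrow> 'a \<times> 'a \<Rightarrow> complex" where
  "orb_elliptic_genus L \<Delta> \<V> d \<tau> \<sigma> w =
     (\<Sum>I\<in>top_simplices L \<Delta>.
        of_int (weight \<Delta> I) / of_nat (card (H_group L \<V> I)) *
        (\<Sum>(h1, h2)\<in>H_group L \<V> I \<times> H_group L \<V> I.
           \<Prod>i\<in>I.
             expi (of_rat (d i) * of_real (dual_basis \<V> I i (coset_rep h1)) * \<sigma>) *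
             phi_st
               (pairing_complex (dual_basis \<V> I i)
                  (shifted_point \<tau> w (coset_rep h1) (coset_rep h2)))
               \<tau> (of_rat (d i) * \<sigma>)))"

text \<open>
  As a function of \<open>z\<close>, \<open>phi_st\<close> has its poles in \<open>\<int> + \<int>\<tau>\<close>. Since division by zero is total, the
  points \<open>w\<close> at which some term of the genus has a pole must be excluded explicitly; they lie on a
  locally finite union of complex affine hyperplanes, so that a meromorphic function vanishes
  identically iff it vanishes at all other points. As with the terms of the genus, the condition
  does not depend on the representatives, which are therefore taken to be arbitrary.
\<close>

definition regular_point ::
    "'a::euclidean_space set \<Rightarrow> ('i, 'a) multi_fan \<Rightarrow> ('i \<Rightarrow> 'a) \<Rightarrow> complex \<Rightarrow> 'a \<times> 'a \<Rightarrow> bool"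
  where
  "regular_point L \<Delta> \<V> \<tau> w \<longleftrightarrow>
     (\<forall>I\<in>top_simplices L \<Delta>. \<forall>i\<in>I. \<forall>v1\<in>L. \<forall>v2\<in>L.
        pairing_complex (dual_basis \<V> I i) (shifted_point \<tau> w v1 v2) \<notin> period_lattice \<tau>)"

end

theory Submission
  imports Defs
begin

text \<open>
  The relation \<open>\<xi> = u\<close> means \<open>d\<^sub>i = \<langle>u, v\<^sub>i\<rangle>\<close>, so the product of the factors \<open>\<zeta>\<close> in a summand equals
  \<open>\<zeta>\<close> to the power \<open>\<langle>u, v(h\<^sub>1)\<rangle>\<close>, independently of \<open>I\<close>. By Kronecker's formula
  \<open>\<phi>(z, \<tau>, \<sigma>) = \<Sum>\<^sub>m t\<^sup>m / (1 - \<zeta> q\<^sup>m)\<close> for \<open>\<bar>q\<bar> < \<bar>t\<bar> < 1\<close>. With \<open>y = Im w / Im \<tau>\<close> and the coset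
  representatives \<open>v(h\<^sub>1)\<close> taken in the fundamental box of the translated cone \<open>y + C(I)\<close>, all factors
  can be expanded; the average over \<open>h\<^sub>2\<close> leaves only the frequencies \<open>f\<close> in the dual lattice of \<open>L\<close>.
  The coefficient of \<open>exp (- 2 \<pi> \<i> f(w))\<close> is the sum over \<open>I\<close> of \<open>w(I)\<close> times the rational expression of
  the lattice point generating function of \<open>y + C(I)\<close>, evaluated at the character
  \<open>\<psi>(v) = exp (2 \<pi> \<i> (\<tau> f(v) + \<sigma> u(v)))\<close>. Pre-completeness says that these weighted cones add up
  to a constant function on \<open>L\<close>, which forces the coefficient to vanish because \<open>\<psi>(v\<^sub>i) \<noteq> 1\<close>.
  The argument needs \<open>y\<close> off the walls; the other regular points follow by continuity.
\<close>

section \<open>The theta quotient and Kronecker's expansion\<close>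

text \<open>The link between the analytic and the combinatorial side is that Kronecker's
  denominators are already those of a cone: for f = \<Sum> m_i u_i the factor 1 / (1 - \<zeta>^(d_i)
  q^(m_i)) equals 1 / (1 - \<psi>(v_i)), and the remaining exponentials combine into \<psi>(v) times
  a factor that depends only on f and w. The value of y is dictated by Im \<langle>u_i, -w + \<tau>
  v - v'\<rangle> = Im \<tau> u_i(v - y): a point of the box puts every argument into the strip 0 <
  Im z < Im \<tau>, provided that u_i(v - y) is never 1. The obstacle is that |\<psi>(v_i)| may lie
  on either side of 1, depending on i and f, so the generating functions of the cones need not
  converge together; the relation between the cones has to be used through finite differences
  instead. Positive rank enters there: at least one difference operator must act on the
  constant.\<close>

text \<open>The infinite q-Pochhammer symbol (a; q), from which the theta functions are
  built.\<close>

definition qpoch :: "complex \<Rightarrow> complex \<Rightarrow> complex" where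
  "qpoch q a = prodinf (\<lambda>k. 1 - a * q ^ k)"

lemma qpoch_convergent:
  fixes q a :: complex
  assumes "norm q < 1"
  shows "convergent_prod (\<lambda>k. 1 - a * q ^ k)"
proof (intro abs_convergent_prod_imp_convergent_prod summable_imp_abs_convergent_prod)
  have "summable (\<lambda>k. norm a * norm q ^ k)"
    using assms by (intro summable_mult summable_geometric) auto
  then show "summable (\<lambda>k. norm (1 - a * q ^ k - 1))"
    by (simp add: norm_mult norm_power)
qed

lemma qpoch_LIMSEQ:
  assumes "norm q < 1"
  shows "(\<lambda>n. \<Prod>k<n. 1 - a * q ^ k) \<longlonglongrightarrow> qpoch q a"
  unfolding qpoch_def LIMSEQ_lessThan_iff_atMost
  by (rule convergent_prod_LIMSEQ[OF qpoch_convergent[OF assms]])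

lemma qpoch_eq_0_iff:
  assumes "norm q < 1"
  shows "qpoch q a = 0 \<longleftrightarrow> (\<exists>k. a * q ^ k = 1)"
proof -
  have "qpoch q a = 0 \<longleftrightarrow> (\<lambda>n. \<Prod>k\<le>n. 1 - a * q ^ k) \<longlonglongrightarrow> 0"
    using convergent_prod_LIMSEQ[OF qpoch_convergent[OF assms, of a]] LIMSEQ_unique
    unfolding qpoch_def by metis
  also have "\<dots> \<longleftrightarrow> (\<exists>k. 1 - a * q ^ k = 0)"
    by (rule convergent_prod_to_zero_iff[OF qpoch_convergent[OF assms]])
  finally show ?thesis by (metis eq_iff_diff_eq_0)
qed

lemma qpoch_rec:
  assumes "norm q < 1"
  shows "qpoch q a = (1 - a) * qpoch q (a * q)"
proof (rule LIMSEQ_unique)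
  show "(\<lambda>n. \<Prod>k<Suc n. 1 - a * q ^ k) \<longlonglongrightarrow> qpoch q a"
    using qpoch_LIMSEQ[OF assms] by (rule LIMSEQ_Suc)
  have "(\<lambda>n. (1 - a) * (\<Prod>k<n. 1 - (a * q) * q ^ k)) \<longlonglongrightarrow> (1 - a) * qpoch q (a * q)"
    by (intro tendsto_mult tendsto_const qpoch_LIMSEQ[OF assms])
  then show "(\<lambda>n. \<Prod>k<Suc n. 1 - a * q ^ k) \<longlonglongrightarrow> (1 - a) * qpoch q (a * q)"
    by (simp add: prod.lessThan_Suc_shift mult.assoc del: prod.lessThan_Suc)
qed

text \<open>The partial products converge uniformly on discs by the Weierstrass test. Continuity is
  what later carries the vanishing of the genus to points on the walls.\<close>

lemma continuous_qpoch:
  assumes "norm q < 1"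
  shows "isCont (qpoch q) a"
proof -
  \<comment> \<open>The extra 1 makes \<open>a\<close> an interior point of the disc.\<close>
  define R where "R = norm a + 1"
  have "uniformly_convergent_on (cball 0 R) (\<lambda>N x. \<Prod>k<N. 1 - x * q ^ k)"
  proof (rule uniformly_convergent_on_prod')
    have "summable (\<lambda>k. R * norm q ^ k)"
      using assms by (intro summable_mult summable_geometric) auto
    then show "uniformly_convergent_on (cball 0 R) (\<lambda>N x. \<Sum>k<N. norm (1 - x * q ^ k - 1))"
      by (intro Weierstrass_m_test'[where M = "\<lambda>k. R * norm q ^ k"])
         (auto simp: norm_mult norm_power intro!: mult_right_mono)
  qed (auto intro!: continuous_intros)
  then obtain l where l: "uniform_limit (cball 0 R) (\<lambda>N x. \<Prod>k<N. 1 - x * q ^ k) l sequentially"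
    by (auto simp: uniformly_convergent_on_def)
  have "continuous_on (cball 0 R) l"
    by (rule uniform_limit_theorem[OF _ l]) (auto intro!: always_eventually continuous_intros)
  moreover have "l x = qpoch q x" if "x \<in> cball 0 R" for x
    using tendsto_uniform_limitI[OF l that] qpoch_LIMSEQ[OF assms] LIMSEQ_unique by blast
  ultimately have "continuous_on (cball 0 R) (qpoch q)"
    by (metis continuous_on_cong)
  then have "continuous_on (ball 0 R) (qpoch q)"
    by (rule continuous_on_subset) auto
  then show ?thesis
    by (simp add: continuous_on_eq_continuous_at R_def)
qed

section \<open>The normalised exponential and the product form of the function phi\<close>

lemma expi_add: "expi (x + y) = expi x * expi y"
  by (simp add: expi_def distrib_left exp_add)

lemma expi_0 [simp]: "expi 0 = 1"
  by (simp add: expi_def)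

lemma expi_neq_0 [simp]: "expi z \<noteq> 0"
  by (simp add: expi_def)

lemma expi_minus: "expi (- z) = inverse (expi z)"
  by (simp add: expi_def exp_minus)

lemma expi_diff: "expi (x - y) = expi x / expi y"
  by (simp add: expi_def right_diff_distrib exp_diff)

lemma expi_of_nat_mult: "expi (of_nat n * z) = expi z ^ n"
  by (simp add: expi_def mult_ac flip: exp_of_nat_mult)

lemma expi_of_int_mult: "expi (of_int n * z) = expi z powi n"
  by (cases n rule: int_cases2)
     (simp_all add: expi_of_nat_mult expi_minus power_int_minus)

lemma expi_sum: "expi (\<Sum>i\<in>A. f i) = (\<Prod>i\<in>A. expi (f i))"
  by (induction A rule: infinite_finite_induct) (simp_all add: expi_add)

lemma norm_expi: "norm (expi z) = exp (- 2 * pi * Im z)"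
  by (simp add: expi_def)

lemma expi_eq_1_iff: "expi z = 1 \<longleftrightarrow> z \<in> \<int>"
proof
  assume "expi z = 1"
  then obtain n :: int where "Im (2 * of_real pi * \<i> * z) = of_int (2 * n) * pi"
      and "Re (2 * of_real pi * \<i> * z) = 0"
    unfolding expi_def exp_eq_1 by blast
  then have "z = of_int n"
    by (simp add: complex_eq_iff)
  then show "z \<in> \<int>" by simp
next
  assume "z \<in> \<int>"
  then obtain n :: int where "z = of_int n" by (auto elim: Ints_cases)
  then show "expi z = 1"
    unfolding expi_def exp_eq_1 by (auto intro!: exI[of _ n])
qed

lemma continuous_expi [continuous_intros]:
  "continuous F f \<Longrightarrow> continuous F (\<lambda>x. expi (f x))"
  unfolding expi_def by (intro continuous_intros)

text \<open>The prefactor supplies the k = 0 factors for \<zeta> t, \<zeta> and t that the product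
  over k \<ge> 1 lacks, so that everything collects into full Pochhammer symbols.\<close>

lemma phi_st_qpoch:
  assumes q: "norm (expi \<tau>) < 1"
  defines "q \<equiv> expi \<tau>"
  shows "phi_st z \<tau> \<sigma> = (qpoch q q)\<^sup>2 * qpoch q (expi \<sigma> * expi z) * qpoch q (q / (expi \<sigma> * expi z)) /
    (qpoch q (expi \<sigma>) * qpoch q (q / expi \<sigma>) * qpoch q (expi z) * qpoch q (q / expi z))"
proof -
  have q': "norm q < 1" using q by (simp add: q_def)
  let ?\<zeta> = "expi \<sigma>" and ?t = "expi z"
  have cv: "convergent_prod (\<lambda>k. 1 - a * q ^ Suc k)" for a
    using qpoch_convergent[OF q', of "a * q"] by (simp add: mult.assoc)
  have pi: "prodinf (\<lambda>k. 1 - a * q ^ Suc k) = qpoch q (a * q)" for a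
    by (simp add: qpoch_def mult.assoc)
  have "prodinf (\<lambda>k. ((1 - q ^ Suc k)\<^sup>2 * (1 - ?\<zeta> * ?t * q ^ Suc k) * (1 - inverse ?\<zeta> * inverse ?t * q ^ Suc k)) /
         ((1 - ?\<zeta> * q ^ Suc k) * (1 - inverse ?\<zeta> * q ^ Suc k) * (1 - ?t * q ^ Suc k) * (1 - inverse ?t * q ^ Suc k)))
     = (qpoch q q)\<^sup>2 * qpoch q (?\<zeta> * ?t * q) * qpoch q (inverse ?\<zeta> * inverse ?t * q) /
     (qpoch q (?\<zeta> * q) * qpoch q (inverse ?\<zeta> * q) * qpoch q (?t * q) * qpoch q (inverse ?t * q))"
    using cv[of 1] cv pi[of 1]
    by (subst prodinf_divide[symmetric] | subst prodinf_mult[symmetric] | subst prodinf_power |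
        intro convergent_prod_mult convergent_prod_power cv | simp only: pi mult_1_left)+
  then show ?thesis
    unfolding phi_st_def Let_def q_def[symmetric]
    by (simp add: qpoch_rec[OF q', of "?\<zeta> * ?t"] qpoch_rec[OF q', of ?\<zeta>] qpoch_rec[OF q', of ?t]
       divide_inverse mult_ac)
qed

section \<open>Quasi-periodicity, zeros and continuity of the theta quotient\<close>

text \<open>The multiplicative theta function; for 0 < |q| < 1 its zeros at nonzero arguments are
  the integer powers of \<open>q\<close>.\<close>

definition qtheta :: "complex \<Rightarrow> complex \<Rightarrow> complex" where
  "qtheta q a = qpoch q a * qpoch q (q / a)"

text \<open>Passing from a to a q removes the factor 1 - a from one Pochhammer symbol and adds 1 -
  1/a to the other; (1 - 1/a) / (1 - a) = -1/a.\<close>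

lemma qtheta_shift:
  assumes "norm q < 1" "q \<noteq> 0" "a \<noteq> 0"
  shows "qtheta q (a * q) = - qtheta q a / a"
proof -
  have "qpoch q (a * q) * qpoch q (1 / a) = qpoch q (a * q) * ((1 - 1 / a) * qpoch q (q / a))"
    using qpoch_rec[OF assms(1), of "1 / a"] by simp
  also have "\<dots> = - ((1 - a) * qpoch q (a * q)) * qpoch q (q / a) / a"
    using assms by (simp add: field_simps)
  also have "\<dots> = - qpoch q a * qpoch q (q / a) / a"
    using qpoch_rec[OF assms(1), of a] by simp
  finally show ?thesis using assms by (simp add: qtheta_def)
qed

lemma continuous_qtheta:
  assumes "norm q < 1" "a \<noteq> 0"
  shows "isCont (qtheta q) a"
proof -
  have "isCont (\<lambda>a. qpoch q (q / a)) a"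
    by (rule isCont_o2[OF _ continuous_qpoch[OF assms(1)]]) (use assms in \<open>auto intro!: continuous_intros\<close>)
  then show ?thesis
    unfolding qtheta_def[abs_def] by (intro continuous_mult continuous_qpoch assms)
qed

lemma phi_st_qtheta:
  assumes "norm (expi \<tau>) < 1"
  shows "phi_st z \<tau> \<sigma> = (qpoch (expi \<tau>) (expi \<tau>))\<^sup>2 * qtheta (expi \<tau>) (expi \<sigma> * expi z) /
    (qtheta (expi \<tau>) (expi \<sigma>) * qtheta (expi \<tau>) (expi z))"
  unfolding phi_st_qpoch[OF assms] by (simp add: qtheta_def mult_ac)

lemma norm_expi_less_1: "Im \<tau> > 0 \<Longrightarrow> norm (expi \<tau>) < 1"
  by (simp add: norm_expi)

text \<open>The theta functions of \<zeta> t and of t acquire -1/(\<zeta> t) and -1/t; only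
  1/\<zeta> survives in the quotient.\<close>

lemma phi_st_shift:
  assumes "Im \<tau> > 0"
  shows "phi_st (z + \<tau>) \<tau> \<sigma> = phi_st z \<tau> \<sigma> / expi \<sigma>"
proof -
  note q = norm_expi_less_1[OF assms]
  show ?thesis
    using qtheta_shift[OF q, of "expi \<sigma> * expi z"] qtheta_shift[OF q, of "expi z"]
    unfolding phi_st_qtheta[OF q] by (simp add: expi_add mult.assoc)
qed

text \<open>This multiplier compensates the \<zeta>-power in the genus when v(h_1) changes by a
  vector of the edge lattice, which frees the choice of representatives.\<close>

lemma phi_st_shift_int:
  assumes "Im \<tau> > 0"
  shows "phi_st (z + of_int n * \<tau>) \<tau> \<sigma> = phi_st z \<tau> \<sigma> * expi (- of_int n * \<sigma>)"
proof (induction n rule: int_induct[where k = 0])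
  case (step1 i)
  have "phi_st (z + of_int (i + 1) * \<tau>) \<tau> \<sigma> = phi_st ((z + of_int i * \<tau>) + \<tau>) \<tau> \<sigma>"
    by (simp add: algebra_simps)
  also have "\<dots> = phi_st z \<tau> \<sigma> * expi (- of_int i * \<sigma>) / expi \<sigma>"
    by (simp only: phi_st_shift[OF assms] step1)
  also have "\<dots> = phi_st z \<tau> \<sigma> * expi (- of_int (i + 1) * \<sigma>)"
    by (simp add: field_simps expi_diff expi_minus expi_add)
  finally show ?case .
next
  case (step2 i)
  have "phi_st z \<tau> \<sigma> * expi (- of_int i * \<sigma>) = phi_st ((z + of_int (i - 1) * \<tau>) + \<tau>) \<tau> \<sigma>"
    unfolding step2(2)[symmetric] by (simp add: algebra_simps)
  also have "\<dots> = phi_st (z + of_int (i - 1) * \<tau>) \<tau> \<sigma> / expi \<sigma>"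
    by (rule phi_st_shift[OF assms])
  finally have "phi_st (z + of_int (i - 1) * \<tau>) \<tau> \<sigma> = phi_st z \<tau> \<sigma> * (expi (- of_int i * \<sigma>) * expi \<sigma>)"
    by (simp add: field_simps)
  also have "expi (- of_int i * \<sigma>) * expi \<sigma> = expi (- of_int (i - 1) * \<sigma>)"
    unfolding expi_add[symmetric] by (simp add: algebra_simps)
  finally show ?case .
qed simp

text \<open>Translates the exclusion of the period lattice into 1 - \<zeta> q^k \<noteq> 0. It
  serves the zeros of theta, the denominators in Kronecker's series and the condition \<psi>(v_i)
  \<noteq> 1.\<close>

lemma expi_mult_power_eq_1_imp:
  assumes "expi z * expi \<tau> powi k = 1"
  shows "z \<in> period_lattice \<tau>"
proof -
  have "z + of_int k * \<tau> \<in> \<int>"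
    using assms unfolding expi_eq_1_iff[symmetric] by (simp add: expi_add expi_of_int_mult)
  then obtain n where "z + of_int k * \<tau> = of_int n" by (auto elim: Ints_cases)
  then have "z = of_int n + of_int (- k) * \<tau>" by (simp add: algebra_simps)
  then show ?thesis unfolding period_lattice_def by blast
qed

lemma qtheta_expi_neq_0:
  assumes "Im \<tau> > 0" "z \<notin> period_lattice \<tau>"
  shows "qtheta (expi \<tau>) (expi z) \<noteq> 0"
proof
  assume "qtheta (expi \<tau>) (expi z) = 0"
  then consider k where "expi z * expi \<tau> ^ k = 1" | k where "expi \<tau> / expi z * expi \<tau> ^ k = 1"
    unfolding qtheta_def using qpoch_eq_0_iff[OF norm_expi_less_1[OF assms(1)]] by auto
  then show False
  proof cases
    case 1
    then have "expi z * expi \<tau> powi int k = 1" by simp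
    then show False using expi_mult_power_eq_1_imp assms by blast
  next
    case 2
    then have "expi z * expi \<tau> powi - int (Suc k) = 1"
      unfolding power_int_minus power_int_of_nat by (simp add: field_simps)
    then show False using expi_mult_power_eq_1_imp assms by blast
  qed
qed

lemma continuous_phi_st:
  assumes "Im \<tau> > 0" "z \<notin> period_lattice \<tau>" "\<sigma> \<notin> period_lattice \<tau>"
  shows "isCont (\<lambda>z. phi_st z \<tau> \<sigma>) z"
proof -
  note q = norm_expi_less_1[OF assms(1)]
  have 1: "isCont (\<lambda>z. qtheta (expi \<tau>) (c * expi z)) z" if "c \<noteq> 0" for c
    by (intro isCont_o2[OF _ continuous_qtheta[OF q]] continuous_intros) (use that in auto)
  show ?thesis
    unfolding phi_st_qtheta[OF q]
    using 1[of 1] qtheta_expi_neq_0[OF assms(1)] assms(2,3)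
    by (intro continuous_intros 1) auto
qed

section \<open>Partial fractions as a finite form of Kronecker's formula\<close>

text \<open>With y = 1/x and denominators cleared, both sides are polynomials in y of degree at most
  |K|, so agreement at the |K| + 1 points 0 and \<open>a k\<close> suffices. The point 0 accounts
  for the term t^|K|, the point \<open>a k\<close> for the coefficient of 1 / (1 - x a_k).\<close>

lemma prod_partial_fraction:
  fixes a :: "'k \<Rightarrow> complex"
  assumes K: "finite K" "inj_on a K" and a0: "\<And>k. k \<in> K \<Longrightarrow> a k \<noteq> 0"
    and x: "x \<noteq> 0" "\<And>k. k \<in> K \<Longrightarrow> x * a k \<noteq> 1"
  shows "(\<Prod>k\<in>K. (1 - x * t * a k) / (1 - x * a k)) = t ^ card K +
    (\<Sum>k\<in>K. (1 - t) * (\<Prod>j\<in>K-{k}. (1 - t * (a j / a k)) / (1 - a j / a k)) / (1 - x * a k))"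
proof -
  define c where "c k = (1 - t) * (\<Prod>j\<in>K-{k}. (1 - t * (a j / a k)) / (1 - a j / a k))" for k
  define p1 where "p1 = (\<Prod>k\<in>K. [:- t * a k, 1:])"
  \<comment> \<open>The factor \<open>[:0, 1:]\<close> stems from 1 / (1 - x a_k) = y / (y -
    a_k).\<close>
  define p2 where "p2 = smult (t ^ card K) (\<Prod>k\<in>K. [:- a k, 1:]) +
     (\<Sum>k\<in>K. smult (c k) ([:0, 1:] * (\<Prod>j\<in>K-{k}. [:- a j, 1:])))"
  have deg: "degree (\<Prod>k\<in>J. [:f k, 1:]) \<le> card J" if "finite J" for J and f :: "'k \<Rightarrow> complex"
    using degree_prod_sum_le[OF that, of "\<lambda>k. [:f k, 1:]"] by simp
  have "p1 = p2"
  proof (rule poly_eqI_degree[where A = "insert 0 (a ` K)"])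
    fix y assume "y \<in> insert 0 (a ` K)"
    then consider "y = 0" | k where "k \<in> K" "y = a k" by auto
    then show "poly p1 y = poly p2 y"
    proof cases
      case 1
      have "(\<Prod>k\<in>K. - t * a k) = (\<Prod>k\<in>K. t * - a k)" by simp
      also have "\<dots> = t ^ card K * (\<Prod>k\<in>K. - a k)"
        unfolding prod.distrib by simp
      finally show ?thesis
        using 1 by (simp add: p1_def p2_def poly_prod poly_sum)
    next
      case 2
      have "poly p2 y = (\<Sum>m\<in>K. if m = k then c k * (a k * (\<Prod>j\<in>K-{k}. a k - a j)) else 0)"
      proof -
        have "(\<Prod>j\<in>K-{m}. a k - a j) = 0" if "m \<noteq> k" for m
          using that 2 K by (intro prod_zero) auto
        moreover have "(\<Prod>j\<in>K. a k - a j) = 0"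
          using 2 K by (intro prod_zero) auto
        ultimately show ?thesis
          by (auto simp: p2_def poly_prod poly_sum 2 intro!: sum.cong)
      qed
      also have "\<dots> = c k * (a k * (\<Prod>j\<in>K-{k}. a k - a j))"
        using 2 K by simp
      also have "\<dots> = a k * (1 - t) * (\<Prod>j\<in>K-{k}. (1 - t * (a j / a k)) / (1 - a j / a k) * (a k - a j))"
        unfolding c_def prod.distrib by (simp add: mult_ac)
      also have "(\<Prod>j\<in>K-{k}. (1 - t * (a j / a k)) / (1 - a j / a k) * (a k - a j)) =
          (\<Prod>j\<in>K-{k}. a k - t * a j)"
      proof (rule prod.cong)
        fix j assume j: "j \<in> K - {k}"
        have k0: "a k \<noteq> 0" using 2 a0 by auto
        have "1 - a j / a k = (a k - a j) / a k" "1 - t * (a j / a k) = (a k - t * a j) / a k"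
          using k0 by (simp_all add: diff_divide_distrib)
        moreover have "a k - a j \<noteq> 0" using 2 K j by (auto simp: inj_on_def)
        ultimately show "(1 - t * (a j / a k)) / (1 - a j / a k) * (a k - a j) = a k - t * a j"
          using k0 by simp
      qed simp
      also have "a k * (1 - t) * \<dots> = (\<Prod>j\<in>K. a k - t * a j)"
        using 2 K by (subst prod.remove[of K k]) (auto simp: algebra_simps)
      finally show ?thesis
        by (simp add: p1_def poly_prod 2)
    qed
  next
    have card: "card (insert 0 (a ` K)) = Suc (card K)"
      using K a0 by (subst card_insert_disjoint) (auto simp: card_image)
    show "degree p1 < card (insert 0 (a ` K))"
      using deg[OF K(1), of "\<lambda>k. - t * a k"] by (simp add: p1_def card)
    have "degree p2 \<le> card K"
      unfolding p2_def
    proof (intro degree_add_le degree_sum_le K(1))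
      show "degree (smult (t ^ card K) (\<Prod>k\<in>K. [:- a k, 1:])) \<le> card K"
        by (rule order_trans[OF degree_smult_le deg[OF K(1)]])
      fix k assume k: "k \<in> K"
      have "degree ([:0, 1:] * (\<Prod>j\<in>K-{k}. [:- a j, 1:])) \<le> 1 + card (K - {k})"
        using degree_mult_le[of "[:0, 1:]" "\<Prod>j\<in>K-{k}. [:- a j, 1:]"] deg[of "K - {k}" "\<lambda>j. - a j"] K(1)
        by simp
      also have "\<dots> = card K"
        using k K(1) card_Suc_Diff1[of K k] by simp
      finally show "degree (smult (c k) ([:0, 1:] * (\<Prod>j\<in>K-{k}. [:- a j, 1:]))) \<le> card K"
        by (rule order_trans[OF degree_smult_le])
    qed
    then show "degree p2 < card (insert 0 (a ` K))" by (simp add: card)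
  qed
  then have "poly p1 (1 / x) = poly p2 (1 / x)" by simp
  moreover define P where "P = (\<Prod>k\<in>K. 1 / x - a k)"
  have nz: "1 / x - a k \<noteq> 0" if "k \<in> K" for k
    using x(1) x(2)[OF that] by (auto simp: field_simps)
  then have P: "P \<noteq> 0" using K by (auto simp: P_def)
  ultimately have eq: "(\<Prod>k\<in>K. 1 / x - t * a k) / P = t ^ card K +
      (\<Sum>k\<in>K. c k * (1 / x * (\<Prod>j\<in>K-{k}. 1 / x - a j)) / P)"
    by (simp add: p1_def p2_def poly_prod poly_sum P_def add_divide_distrib sum_divide_distrib)
  have "(\<Prod>k\<in>K. 1 / x - t * a k) / P = (\<Prod>k\<in>K. (1 - x * t * a k) / (1 - x * a k))"
    unfolding P_def prod_dividef[symmetric] using x nz by (intro prod.cong) (auto simp: field_simps)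
  moreover have "c k * (1 / x * (\<Prod>j\<in>K-{k}. 1 / x - a j)) / P = c k / (1 - x * a k)" if "k \<in> K" for k
  proof -
    define Q where "Q = (\<Prod>j\<in>K-{k}. 1 / x - a j)"
    have PQ: "P = (1 / x - a k) * Q"
      unfolding P_def Q_def using K that by (subst prod.remove) auto
    have "1 - x * a k = x * (1 / x - a k)" using x by (simp add: right_diff_distrib)
    then show ?thesis using P nz[OF that] x(1) unfolding Q_def[symmetric] PQ by simp
  qed
  ultimately show ?thesis using eq by (simp add: c_def)
qed

lemma prod_int_interval_minus_0:
  fixes f :: "int \<Rightarrow> 'b :: comm_monoid_mult"
  shows "prod f ({- int a..int b} - {0}) = (\<Prod>l<b. f (int (Suc l))) * (\<Prod>l<a. f (- int (Suc l)))"
proof -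
  have "{- int a..int b} - {0} = (\<lambda>l. int (Suc l)) ` {..<b} \<union> (\<lambda>l. - int (Suc l)) ` {..<a}"
  proof (intro equalityI subsetI)
    fix x assume x: "x \<in> {- int a..int b} - {0}"
    show "x \<in> (\<lambda>l. int (Suc l)) ` {..<b} \<union> (\<lambda>l. - int (Suc l)) ` {..<a}"
    proof (cases "x > 0")
      case True
      then have "x = int (Suc (nat (x - 1)))" "nat (x - 1) < b" using x by auto
      then show ?thesis by blast
    next
      case False
      then have "x = - int (Suc (nat (- x - 1)))" "nat (- x - 1) < a" using x by auto
      then show ?thesis by blast
    qed
  qed auto
  then show ?thesis
    by (simp, subst prod.union_disjoint) (auto simp: prod.reindex inj_on_def)
qed

text \<open>The finite quotient (a q; q)_n / (q; q)_n, the form in which the partial fraction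
  coefficients appear.\<close>

definition qfrac :: "complex \<Rightarrow> complex \<Rightarrow> nat \<Rightarrow> complex" where
  "qfrac q a n = (\<Prod>l<n. (1 - a * q ^ Suc l) / (1 - q ^ Suc l))"

lemma qfrac_LIMSEQ:
  assumes "norm q < 1"
  shows "qfrac q a \<longlonglongrightarrow> qpoch q (a * q) / qpoch q q"
proof -
  have "qpoch q q \<noteq> 0"
  proof -
    have "q * q ^ k \<noteq> 1" for k
    proof
      assume "q * q ^ k = 1"
      then have "norm q ^ Suc k = 1" by (metis norm_one norm_power power_Suc)
      then show False using power_less_one_iff[of "norm q" "Suc k"] assms by auto
    qed
    then show ?thesis using qpoch_eq_0_iff[OF assms] by blast
  qed
  then have "(\<lambda>n. (\<Prod>l<n. 1 - (a * q) * q ^ l) / (\<Prod>l<n. 1 - q * q ^ l)) \<longlonglongrightarrow> qpoch q (a * q) / qpoch q q"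
    by (intro tendsto_divide qpoch_LIMSEQ[OF assms])
  then show ?thesis
    unfolding qfrac_def[abs_def] prod_dividef by (simp add: mult.assoc)
qed

lemma power_int_neq_1:
  fixes q :: complex
  assumes "norm q < 1" "q \<noteq> 0" "l \<noteq> 0"
  shows "q powi l \<noteq> 1"
proof
  assume "q powi l = 1"
  then have "norm q powi l = 1" by (metis norm_one norm_power_int)
  moreover have "norm q ^ n \<noteq> 1" if "n > 0" for n
    using power_less_one_iff[of "norm q" n] assms that by auto
  ultimately show False
    using assms by (cases l rule: int_cases2) (auto simp: power_int_minus)
qed

text \<open>
  The summands are written with both factors in non-negative powers of \<^term>\<open>q\<close>, which makes the
  limit \<open>N \<rightarrow> \<infinity>\<close> termwise.
\<close>

lemma qfrac_partial_fraction:
  assumes q: "norm q < 1" "q \<noteq> 0" and t: "t \<noteq> 0" "t \<noteq> 1"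
    and x: "x \<noteq> 0" "\<And>k. x * q powi k \<noteq> 1"
  shows "(1 - x * t) / ((1 - x) * (1 - t)) *
      (\<Prod>l<N. (1 - (x * t) * q ^ Suc l) / (1 - x * q ^ Suc l)) *
      (\<Prod>l<N. (1 - 1 / (x * t) * q ^ Suc l) / (1 - 1 / x * q ^ Suc l)) =
    t ^ Suc N / (1 - t) + (\<Sum>k=-int N..int N. t powi k * qfrac q t (nat (int N - k)) *
      qfrac q (1 / t) (nat (int N + k)) / (1 - x * q powi k))"
proof -
  \<comment> \<open>The symmetric range truncates the halves k > 0 and k < 0 of the theta quotient
    at the same length.\<close>
  let ?K = "{- int N..int N}"
  let ?g = "\<lambda>l. (1 - t * q powi l) / (1 - q powi l)"
  have inj: "inj_on (\<lambda>k. q powi k) ?K"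
  proof (rule inj_onI)
    fix k m assume "q powi k = q powi m"
    then have "q powi (k - m) = 1" using q by (simp add: power_int_diff)
    then show "k = m" using power_int_neq_1[OF q, of "k - m"] by auto
  qed
  have A: "(\<Prod>j\<in>?K-{k}. (1 - t * (q powi j / q powi k)) / (1 - q powi j / q powi k)) =
      t powi (int N + k) * qfrac q t (nat (int N - k)) * qfrac q (1 / t) (nat (int N + k))"
    if k: "k \<in> ?K" for k
  proof -
    \<comment> \<open>After the shift j - k the product depends on k only through its distances
      \<open>a\<close> and \<open>b\<close> to the lower and the upper end of the range.\<close>
    define a b where "a = nat (int N + k)" and "b = nat (int N - k)"
    have "(\<Prod>j\<in>?K-{k}. (1 - t * (q powi j / q powi k)) / (1 - q powi j / q powi k)) =
      (\<Prod>j\<in>?K-{k}. ?g (j - k))"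
      using q by (simp add: power_int_diff)
    also have "\<dots> = prod ?g ({- int a..int b} - {0})"
      by (rule prod.reindex_bij_witness[of _ "\<lambda>l. l + k" "\<lambda>j. j - k"])
         (use k in \<open>auto simp: a_def b_def\<close>)
    also have "\<dots> = qfrac q t b * (\<Prod>l<a. ?g (- int (Suc l)))"
      unfolding prod_int_interval_minus_0 qfrac_def by (simp add: power_int_def nat_add_distrib)
    \<comment> \<open>For a negative exponent the fraction is expanded by q^(l+1); this extracts a
      factor t and replaces t by 1/t.\<close>
    also have "(\<Prod>l<a. ?g (- int (Suc l))) = (\<Prod>l<a. t * ((1 - 1 / t * q ^ Suc l) / (1 - q ^ Suc l)))"
    proof (rule prod.cong)
      fix l
      have "q ^ Suc l \<noteq> 1" using power_int_neq_1[OF q, of "int (Suc l)"] by (simp only: power_int_of_nat) simp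
      then show "?g (- int (Suc l)) = t * ((1 - 1 / t * q ^ Suc l) / (1 - q ^ Suc l))"
        unfolding power_int_minus power_int_of_nat using q t by (simp add: divide_simps) (simp add: algebra_simps)
    qed simp
    also have "\<dots> = t ^ a * qfrac q (1 / t) a"
      unfolding qfrac_def prod.distrib by simp
    also have "t ^ a = t powi (int N + k)"
      using k by (simp add: power_int_def a_def)
    finally show ?thesis unfolding a_def b_def by (simp add: mult_ac)
  qed
  let ?P1 = "\<Prod>l<N. (1 - (x * t) * q ^ Suc l) / (1 - x * q ^ Suc l)"
  let ?P2 = "\<Prod>l<N. (1 - 1 / (x * t) * q ^ Suc l) / (1 - 1 / x * q ^ Suc l)"
  let ?h = "\<lambda>k. (1 - x * t * q powi k) / (1 - x * q powi k)"
  have "prod ?h ?K = ?h 0 * prod ?h (?K - {0})"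
    by (rule prod.remove) auto
  also have "prod ?h (?K - {0}) = (\<Prod>l<N. ?h (int (Suc l))) * (\<Prod>l<N. ?h (- int (Suc l)))"
    by (rule prod_int_interval_minus_0)
  also have "(\<Prod>l<N. ?h (int (Suc l))) = ?P1"
    by (simp add: power_int_def nat_add_distrib)
  also have "(\<Prod>l<N. ?h (- int (Suc l))) = (\<Prod>l<N. t * ((1 - 1 / (x * t) * q ^ Suc l) / (1 - 1 / x * q ^ Suc l)))"
  proof (rule prod.cong)
    fix l
    have "x * inverse (q ^ Suc l) \<noteq> 1"
      using x(2)[of "- int (Suc l)"] unfolding power_int_minus power_int_of_nat .
    then show "?h (- int (Suc l)) = t * ((1 - 1 / (x * t) * q ^ Suc l) / (1 - 1 / x * q ^ Suc l))"
      unfolding power_int_minus power_int_of_nat using q t x(1)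
      by (simp add: divide_simps) (simp add: algebra_simps)
  qed simp
  also have "\<dots> = t ^ N * ?P2"
    unfolding prod.distrib by simp
  finally have "?h 0 * (?P1 * (t ^ N * ?P2)) = prod ?h ?K" by simp
  also have "\<dots> = t ^ card ?K + (\<Sum>k\<in>?K. (1 - t) * (\<Prod>j\<in>?K-{k}. (1 - t * (q powi j / q powi k)) / (1 - q powi j / q powi k)) / (1 - x * q powi k))"
    by (rule prod_partial_fraction[OF _ inj]) (use q x in auto)
  also have "\<dots> = t ^ (2 * N + 1) + (\<Sum>k\<in>?K. (1 - t) * (t powi (int N + k) * qfrac q t (nat (int N - k)) * qfrac q (1 / t) (nat (int N + k))) / (1 - x * q powi k))"
  proof -
    have "card ?K = 2 * N + 1" by simp
    then show ?thesis using A by (intro arg_cong2[of _ _ _ _ "(+)"] sum.cong) simp_all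
  qed
  \<comment> \<open>The N negative indices on the left give t^N, which is also contained in the
    coefficient t^(N+k) on the right. Division leaves t^k, independent of N.\<close>
  also have "\<dots> = (t ^ N * (1 - t)) * (t ^ Suc N / (1 - t) + (\<Sum>k\<in>?K. t powi k * qfrac q t (nat (int N - k)) * qfrac q (1 / t) (nat (int N + k)) / (1 - x * q powi k)))"
  proof -
    have "t ^ (2 * N + 1) = (t ^ N * (1 - t)) * (t ^ Suc N / (1 - t))"
      using t by (simp add: mult_2 power_add)
    moreover have "t powi (int N + k) = t ^ N * t powi k" for k
      using t by (simp add: power_int_add)
    ultimately show ?thesis
      unfolding distrib_left by (simp add: sum_distrib_left mult_ac)
  qed
  finally have E: "?h 0 * (?P1 * (t ^ N * ?P2)) = (t ^ N * (1 - t)) * (t ^ Suc N / (1 - t) + (\<Sum>k\<in>?K. t powi k * qfrac q t (nat (int N - k)) * qfrac q (1 / t) (nat (int N + k)) / (1 - x * q powi k)))" .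
  have alg: "(t ^ N * (1 - t)) * ((1 - x * t) / ((1 - x) * (1 - t)) * P1 * P2) = ?h 0 * (P1 * (t ^ N * P2))" for P1 P2
    using t by simp
  note alg[of ?P1 ?P2, unfolded E]
  moreover have "t ^ N * (1 - t) \<noteq> 0" using t by simp
  ultimately show ?thesis unfolding mult_cancel_left using t by simp
qed

section \<open>Convergence of the two-sided series and Kronecker's formula\<close>

lemma summable_on_int_geometric:
  fixes r :: real
  assumes "0 \<le> r" "r < 1"
  shows "(\<lambda>k. r ^ nat \<bar>k\<bar>) summable_on (UNIV :: int set)"
proof -
  have g: "(\<lambda>n. r ^ n) summable_on UNIV"
    using assms by (subst summable_on_UNIV_nonneg_real_iff) (auto simp: summable_geometric)
  have "(\<lambda>k. r ^ nat \<bar>k\<bar>) summable_on range int"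
    using g by (subst summable_on_reindex) (auto simp: o_def)
  moreover have "(\<lambda>k. r ^ nat \<bar>k\<bar>) summable_on range (\<lambda>n. - int n)"
    using g by (subst summable_on_reindex) (auto simp: o_def inj_on_def)
  ultimately have "(\<lambda>k. r ^ nat \<bar>k\<bar>) summable_on (range int \<union> range (\<lambda>n. - int n))"
    by (rule summable_on_union)
  also have "range int \<union> range (\<lambda>n. - int n) = UNIV"
  proof -
    have "k \<in> range int \<union> range (\<lambda>n. - int n)" for k :: int
      by (cases k rule: int_cases2) auto
    then show ?thesis by blast
  qed
  finally show ?thesis .
qed

text \<open>For k \<ge> 0 the denominators stay away from 0, which leaves the decay |t|^k; for k =
  -n, expanding the fraction by q^n leaves |q/t|^n. Both rates are below 1 exactly in the annulus
  |q| < |t| < 1.\<close>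

lemma kronecker_term_bound:
  fixes q t x :: complex
  assumes q: "norm q < 1" "q \<noteq> 0" and t: "norm q < norm t" "norm t < 1"
    and x: "x \<noteq> 0" "\<And>k. x * q powi k \<noteq> 1"
  obtains C r where "0 \<le> r" "r < 1" "\<And>k :: int. norm (t powi k / (1 - x * q powi k)) \<le> C * r ^ nat \<bar>k\<bar>"
proof -
  define r where "r = max (norm t) (norm (q / t))"
  have "0 < norm t" using t(1) norm_ge_zero[of q] by linarith
  then have r: "0 \<le> r" "r < 1" using t q by (auto simp: r_def norm_divide le_max_iff_disj)
  have q0: "(\<lambda>n. q ^ n) \<longlonglongrightarrow> 0" using q by (intro LIMSEQ_power_zero) auto
  have qn': "q ^ n \<noteq> x" for n
    using x(2)[of "- int n"] q by (auto simp: power_int_minus)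
  have "(\<lambda>n. 1 / (1 - x * q ^ n)) \<longlonglongrightarrow> 1 / (1 - x * 0)"
    by (intro tendsto_intros q0) auto
  then have "Bseq (\<lambda>n. 1 / (1 - x * q ^ n))" using convergent_def convergent_imp_Bseq by blast
  then obtain C1 where C1: "\<And>n. norm (1 / (1 - x * q ^ n)) \<le> C1" by (auto simp: Bseq_def)
  have "(\<lambda>n. 1 / (q ^ n - x)) \<longlonglongrightarrow> 1 / (0 - x)"
    using x by (intro tendsto_intros q0) auto
  then have "Bseq (\<lambda>n. 1 / (q ^ n - x))" using convergent_def convergent_imp_Bseq by blast
  then obtain C2 where C2: "\<And>n. norm (1 / (q ^ n - x)) \<le> C2" by (auto simp: Bseq_def)
  have C0: "0 \<le> C1" "0 \<le> C2"
    using order_trans[OF norm_ge_zero C1[of 0]] order_trans[OF norm_ge_zero C2[of 0]] by auto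
  have bound: "norm (t powi k / (1 - x * q powi k)) \<le> max C1 C2 * r ^ nat \<bar>k\<bar>" for k :: int
  proof (cases k rule: int_cases2)
    case (nonneg n)
    have "norm (t powi k / (1 - x * q powi k)) = norm (1 / (1 - x * q ^ n)) * norm t ^ n"
      by (simp add: nonneg norm_divide norm_power)
    also have "\<dots> \<le> max C1 C2 * r ^ n"
      using r(1) C0 C1[of n] by (intro mult_mono power_mono) (auto simp: r_def le_max_iff_disj)
    finally show ?thesis by (simp add: nonneg)
  next
    case (nonpos n)
    have "t powi k / (1 - x * q powi k) = 1 / (q ^ n - x) * (q / t) ^ n"
    proof -
      have "1 - x / q ^ n = (q ^ n - x) / q ^ n"
        using q by (simp add: diff_divide_distrib)
      then show ?thesis
        by (simp add: nonpos power_int_minus power_divide flip: divide_inverse)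
           (simp add: divide_inverse mult_ac)
    qed
    then have "norm (t powi k / (1 - x * q powi k)) = norm (1 / (q ^ n - x)) * norm (q / t) ^ n"
      by (simp only: norm_mult norm_power)
    also have "\<dots> \<le> max C1 C2 * r ^ n"
      using r(1) C0 C2[of n] by (intro mult_mono power_mono) (auto simp: r_def le_max_iff_disj)
    finally show ?thesis by (simp add: nonpos)
  qed
  show ?thesis by (rule that[OF r bound])
qed

text \<open>The limit N to infinity of the finite identity. The correction factors
  \<open>qfrac\<close> are uniformly bounded and tend to constants \<open>W1\<close>,
  \<open>W2\<close> that do not depend on k, so they can be divided out afterwards.\<close>

lemma kronecker_formula:
  fixes q t x :: complex
  assumes q: "norm q < 1" "q \<noteq> 0" and t: "norm q < norm t" "norm t < 1"
    and x: "x \<noteq> 0" "\<And>k. x * q powi k \<noteq> 1"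
  shows "(\<lambda>k::int. norm (t powi k / (1 - x * q powi k))) summable_on UNIV"
    and "((\<lambda>k::int. t powi k / (1 - x * q powi k)) has_sum
      ((qpoch q q)\<^sup>2 * qtheta q (x * t) / (qtheta q x * qtheta q t))) UNIV"
proof -
  obtain C r where "0 \<le> r \<and> r < 1 \<and> (\<forall>k :: int. norm (t powi k / (1 - x * q powi k)) \<le> C * r ^ nat \<bar>k\<bar>)"
    using kronecker_term_bound[OF assms, of "\<exists>C r. 0 \<le> r \<and> r < 1 \<and> (\<forall>k :: int. norm (t powi k / (1 - x * q powi k)) \<le> C * r ^ nat \<bar>k\<bar>)"]
    by blast
  then have r: "0 \<le> r" "r < 1"
    and C: "norm (t powi k / (1 - x * q powi k)) \<le> C * r ^ nat \<bar>k\<bar>" for k :: int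
    by auto
  have sum_r: "(\<lambda>k::int. c * r ^ nat \<bar>k\<bar>) summable_on UNIV" for c
    by (intro summable_on_cmult_right summable_on_int_geometric r)
  show abs: "(\<lambda>k::int. norm (t powi k / (1 - x * q powi k))) summable_on UNIV"
    by (rule Infinite_Sum.abs_summable_on_comparison_test'[OF sum_r C])
  have t0: "t \<noteq> 0" "t \<noteq> 1" using t by auto
  define W1 where "W1 = qpoch q (t * q) / qpoch q q"
  define W2 where "W2 = qpoch q (1 / t * q) / qpoch q q"
  have lim1: "qfrac q t \<longlonglongrightarrow> W1" and lim2: "qfrac q (1 / t) \<longlonglongrightarrow> W2"
    unfolding W1_def W2_def by (rule qfrac_LIMSEQ[OF q(1)])+
  then have "Bseq (qfrac q t)" "Bseq (qfrac q (1 / t))"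
    using convergent_def convergent_imp_Bseq by blast+
  then obtain B1 B2 where B: "\<And>n. norm (qfrac q t n) \<le> B1" "\<And>n. norm (qfrac q (1 / t) n) \<le> B2"
    by (auto simp: Bseq_def)
  have B0: "0 \<le> B1" "0 \<le> B2" using B[of 0] norm_ge_zero order_trans by blast+
  define g where "g k = t powi k / (1 - x * q powi k)" for k :: int
  define f where "f k N = (if \<bar>k\<bar> \<le> int N then qfrac q t (nat (int N - k)) *
      qfrac q (1 / t) (nat (int N + k)) * g k else 0)" for k N
  have "((\<lambda>N. f k N) \<longlonglongrightarrow> W1 * W2 * g k)" for k
  proof (rule Lim_transform_eventually)
    have "filterlim (\<lambda>N. nat (int N + m)) at_top sequentially" for m
      unfolding filterlim_at_top
    proof
      fix Z show "\<forall>\<^sub>F N in sequentially. Z \<le> nat (int N + m)"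
        using eventually_ge_at_top[of "nat (int Z + \<bar>m\<bar>)"] by eventually_elim linarith
    qed
    from this[of "- k"] this[of k]
    have "filterlim (\<lambda>N. nat (int N - k)) at_top sequentially"
      and "filterlim (\<lambda>N. nat (int N + k)) at_top sequentially" by simp_all
    then show "(\<lambda>N. qfrac q t (nat (int N - k)) * qfrac q (1 / t) (nat (int N + k)) * g k) \<longlonglongrightarrow> W1 * W2 * g k"
      by (intro tendsto_intros filterlim_compose[OF lim1] filterlim_compose[OF lim2])
    show "\<forall>\<^sub>F N in sequentially. qfrac q t (nat (int N - k)) * qfrac q (1 / t) (nat (int N + k)) * g k = f k N"
      using eventually_ge_at_top[of "nat \<bar>k\<bar>"] by eventually_elim (auto simp: f_def)
  qed
  then have lim: "(\<lambda>N. f (int_decode n) N) \<longlonglongrightarrow> W1 * W2 * g (int_decode n)" for n .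
  have bound: "norm (f (int_decode n) N) \<le> B1 * B2 * C * r ^ nat \<bar>int_decode n\<bar>" for n N
  proof -
    have "norm (f (int_decode n) N) \<le> (B1 * B2) * (C * r ^ nat \<bar>int_decode n\<bar>)"
      unfolding f_def using B B0 C[of "int_decode n", folded g_def] order_trans[OF norm_ge_zero C[of "int_decode n", folded g_def]]
      by (auto simp: norm_mult intro!: mult_mono mult_nonneg_nonneg)
    then show ?thesis by (simp add: mult.assoc)
  qed
  have bij: "bij_betw int_decode UNIV UNIV" by (rule bij_int_decode)
  have "summable (\<lambda>n. B1 * B2 * C * r ^ nat \<bar>int_decode n\<bar>)"
    using summable_on_reindex_bij_betw[OF bij, of "\<lambda>k. B1 * B2 * C * r ^ nat \<bar>k\<bar>"] sum_r
    by (intro summable_on_imp_summable) simp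
  from tannerys_theorem[OF lim _ this]
  have "(\<lambda>N. suminf (\<lambda>n. f (int_decode n) N)) \<longlonglongrightarrow> (suminf (\<lambda>n. W1 * W2 * g (int_decode n)))"
    using bound by (simp add: case_prod_unfold)
  moreover have "(suminf (\<lambda>n. f (int_decode n) N)) = (\<Sum>k=-int N..int N. f k N)" for N
  proof -
    have "(suminf (\<lambda>n. f (int_decode n) N)) = (\<Sum>n\<in>int_decode -` {-int N..int N}. f (int_decode n) N)"
      by (rule suminf_finite) (auto simp: f_def intro!: finite_vimageI bij_is_inj[OF bij_int_decode])
    also have "\<dots> = (\<Sum>k=-int N..int N. f k N)"
      by (rule sum.reindex_bij_witness[of _ int_encode int_decode]) auto
    finally show ?thesis .
  qed
  ultimately have L1: "(\<lambda>N. \<Sum>k=-int N..int N. f k N) \<longlonglongrightarrow> (suminf (\<lambda>n. W1 * W2 * g (int_decode n)))"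
    by simp
  \<comment> \<open>The part of the finite identity outside the sum disappears in the limit because
    |t| < 1.\<close>
  have "(\<lambda>N. t ^ Suc N / (1 - t)) \<longlonglongrightarrow> 0"
    using t tendsto_divide[OF LIMSEQ_Suc[OF LIMSEQ_power_zero[of t]] tendsto_const, of "1 - t"] t0 by simp
  from tendsto_add[OF this L1]
  have L2: "(\<lambda>N. t ^ Suc N / (1 - t) + (\<Sum>k=-int N..int N. f k N)) \<longlonglongrightarrow> (suminf (\<lambda>n. W1 * W2 * g (int_decode n)))"
    by simp
  let ?F = "(1 - x * t) / ((1 - x) * (1 - t)) * (qpoch q (x * t * q) / qpoch q (x * q)) *
     (qpoch q (1 / (x * t) * q) / qpoch q (1 / x * q))"
  have xn: "qpoch q (x * q) \<noteq> 0" "qpoch q (1 / x * q) \<noteq> 0"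
  proof -
    have "x * q * q ^ k \<noteq> 1" for k
      using x(2)[of "int (Suc k)"] by (simp only: power_int_of_nat) (simp add: mult.assoc)
    then show "qpoch q (x * q) \<noteq> 0" using qpoch_eq_0_iff[OF q(1)] by blast
    have "1 / x * q * q ^ k \<noteq> 1" for k
      using x(2)[of "- int (Suc k)"] x(1) q unfolding power_int_minus power_int_of_nat
      by (auto simp: field_simps)
    then show "qpoch q (1 / x * q) \<noteq> 0" using qpoch_eq_0_iff[OF q(1)] by blast
  qed
  have "(\<lambda>N. (1 - x * t) / ((1 - x) * (1 - t)) * ((\<Prod>l<N. 1 - (x * t * q) * q ^ l) / (\<Prod>l<N. 1 - (x * q) * q ^ l)) *
      ((\<Prod>l<N. 1 - (1 / (x * t) * q) * q ^ l) / (\<Prod>l<N. 1 - (1 / x * q) * q ^ l))) \<longlonglongrightarrow> ?F"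
    by (intro tendsto_intros qpoch_LIMSEQ q xn)
  also have "(\<lambda>N. (1 - x * t) / ((1 - x) * (1 - t)) * ((\<Prod>l<N. 1 - (x * t * q) * q ^ l) / (\<Prod>l<N. 1 - (x * q) * q ^ l)) *
      ((\<Prod>l<N. 1 - (1 / (x * t) * q) * q ^ l) / (\<Prod>l<N. 1 - (1 / x * q) * q ^ l))) =
      (\<lambda>N. t ^ Suc N / (1 - t) + (\<Sum>k=-int N..int N. f k N))" (is "?lhs = ?rhs")
  proof
    fix N
    have "?lhs N = (1 - x * t) / ((1 - x) * (1 - t)) *
      (\<Prod>l<N. (1 - (x * t) * q ^ Suc l) / (1 - x * q ^ Suc l)) *
      (\<Prod>l<N. (1 - 1 / (x * t) * q ^ Suc l) / (1 - 1 / x * q ^ Suc l))"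
      unfolding prod_dividef by (simp add: mult.assoc)
    also have "\<dots> = ?rhs N"
      unfolding qfrac_partial_fraction[OF q t0 x]
      by (intro arg_cong2[of _ _ _ _ "(+)"] sum.cong refl) (auto simp: f_def g_def)
    finally show "?lhs N = ?rhs N" .
  qed
  finally have F: "(suminf (\<lambda>n. W1 * W2 * g (int_decode n))) = ?F"
    using L2 LIMSEQ_unique by blast
  have g_sum: "(\<lambda>n. norm (g (int_decode n))) summable_on UNIV"
    using abs summable_on_reindex_bij_betw[OF bij, of "\<lambda>k. norm (g k)"] by (simp add: g_def)
  have nW: "W1 \<noteq> 0" "W2 \<noteq> 0" "qpoch q q \<noteq> 0"
  proof -
    \<comment> \<open>The annulus condition keeps q, t q and q/t inside the unit disc, away from the
      zeros of the Pochhammer symbol.\<close>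
    have *: "qpoch q (a * q) \<noteq> 0" if "norm a \<le> 1 \<or> norm (a * q) < 1" for a
    proof -
      have "a * q * q ^ k \<noteq> 1" for k
      proof
        assume "a * q * q ^ k = 1"
        then have "norm (a * q) * norm q ^ k = 1" by (metis norm_mult norm_one norm_power)
        moreover have "norm (a * q) < 1"
          using that q(1) mult_left_le_one_le[of "norm q" "norm a"] by (auto simp: norm_mult)
        moreover have "norm q ^ k \<le> 1" using q by (simp add: power_le_one)
        ultimately show False
          using mult_left_le[of "norm q ^ k" "norm (a * q)"] norm_ge_zero[of "a * q"] by linarith
      qed
      then show ?thesis using qpoch_eq_0_iff[OF q(1)] by blast
    qed
    show "qpoch q q \<noteq> 0" using *[of 1] by simp
    moreover have "qpoch q (t * q) \<noteq> 0" using *[of t] t by simp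
    moreover have "qpoch q (1 / t * q) \<noteq> 0" using *[of "1 / t"] t t0 by (simp add: norm_divide)
    ultimately show "W1 \<noteq> 0" "W2 \<noteq> 0" by (auto simp: W1_def W2_def)
  qed
  have sN: "summable (\<lambda>n. norm (g (int_decode n)))"
    by (rule summable_on_imp_summable[OF g_sum])
  then have sg: "summable (\<lambda>n. g (int_decode n))"
    by (rule summable_norm_cancel)
  have "(g has_sum suminf (\<lambda>n. g (int_decode n))) UNIV"
    unfolding has_sum_reindex_bij_betw[OF bij, of g, symmetric]
    by (rule norm_summable_imp_has_sum[OF sN summable_sums[OF sg]])
  moreover have "suminf (\<lambda>n. g (int_decode n)) = ?F / (W1 * W2)"
  proof -
    from sg have "W1 * W2 * suminf (\<lambda>n. g (int_decode n)) = ?F"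
      unfolding F[symmetric] by (rule suminf_mult[symmetric])
    moreover have "W1 * W2 \<noteq> 0" using nW by simp
    ultimately show ?thesis by (metis nonzero_mult_div_cancel_left)
  qed
  moreover have "?F / (W1 * W2) = (qpoch q q)\<^sup>2 * qtheta q (x * t) / (qtheta q x * qtheta q t)"
    unfolding qtheta_def W1_def W2_def
      qpoch_rec[OF q(1), of "x * t"] qpoch_rec[OF q(1), of x] qpoch_rec[OF q(1), of t]
    using nW by (simp add: power2_eq_square mult_ac)
  ultimately show "((\<lambda>k::int. t powi k / (1 - x * q powi k)) has_sum
      ((qpoch q q)\<^sup>2 * qtheta q (x * t) / (qtheta q x * qtheta q t))) UNIV"
    by (simp add: g_def[abs_def])
qed


text \<open>The strip 0 < Im z < Im \<tau> is the annulus |q| < |t| < 1 in the coordinate t =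
  \<open>expi z\<close>.\<close>

lemma phi_st_has_sum:
  assumes "Im \<tau> > 0" "0 < Im z" "Im z < Im \<tau>" "\<sigma> \<notin> period_lattice \<tau>"
  shows "(\<lambda>k::int. norm (expi (of_int k * z) / (1 - expi (\<sigma> + of_int k * \<tau>)))) summable_on UNIV"
    and "((\<lambda>k::int. expi (of_int k * z) / (1 - expi (\<sigma> + of_int k * \<tau>))) has_sum phi_st z \<tau> \<sigma>) UNIV"
proof -
  note q = norm_expi_less_1[OF assms(1)]
  have z: "norm (expi \<tau>) < norm (expi z)" "norm (expi z) < 1"
    using assms by (auto simp: norm_expi)
  have x: "expi \<sigma> * expi \<tau> powi k \<noteq> 1" for k
    using expi_mult_power_eq_1_imp assms(4) by blast
  note K = kronecker_formula[OF q expi_neq_0 z expi_neq_0 x]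
  show "(\<lambda>k::int. norm (expi (of_int k * z) / (1 - expi (\<sigma> + of_int k * \<tau>)))) summable_on UNIV"
    using K(1) by (simp add: expi_of_int_mult expi_add)
  show "((\<lambda>k::int. expi (of_int k * z) / (1 - expi (\<sigma> + of_int k * \<tau>))) has_sum phi_st z \<tau> \<sigma>) UNIV"
    using K(2) unfolding phi_st_qtheta[OF q] by (simp add: expi_of_int_mult expi_add)
qed

section \<open>Difference operators and weighted sums of cones\<close>

text \<open>The product of the commuting operators 1 - T_i for i in \<open>A\<close>, where (T_i
  g)(x) = g(x - V i), expanded over the subsets of \<open>A\<close> so that no order of the factors
  has to be chosen.\<close>

definition fdiff :: "('i \<Rightarrow> 'a::real_vector) \<Rightarrow> 'i set \<Rightarrow> ('a \<Rightarrow> complex) \<Rightarrow> 'a \<Rightarrow> complex" where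
  "fdiff V A g x = (\<Sum>S\<in>Pow A. (- 1) ^ card S * g (x - (\<Sum>i\<in>S. V i)))"

lemma fdiff_empty [simp]: "fdiff V {} g = g"
  by (simp add: fdiff_def fun_eq_iff)

lemma fdiff_insert:
  assumes "finite A" "a \<notin> A"
  shows "fdiff V (insert a A) g x = fdiff V A g x - fdiff V A g (x - V a)"
proof -
  have inj: "inj_on (insert a) (Pow A)" using assms by (auto simp: inj_on_def)
  have disj: "Pow A \<inter> insert a ` Pow A = {}" using assms by auto
  have "fdiff V (insert a A) g x = fdiff V A g x +
      (\<Sum>S\<in>Pow A. (- 1) ^ card (insert a S) * g (x - (\<Sum>i\<in>insert a S. V i)))"
    unfolding fdiff_def Pow_insert
    using sum.union_disjoint[OF _ _ disj] assms by (simp add: sum.reindex[OF inj])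
  also have "(\<Sum>S\<in>Pow A. (- 1) ^ card (insert a S) * g (x - (\<Sum>i\<in>insert a S. V i))) =
      (\<Sum>S\<in>Pow A. - ((- 1) ^ card S * g (x - V a - (\<Sum>i\<in>S. V i))))"
  proof (rule sum.cong)
    fix S assume "S \<in> Pow A"
    then have "finite S" "a \<notin> S" using assms finite_subset by auto
    then show "(- 1) ^ card (insert a S) * g (x - (\<Sum>i\<in>insert a S. V i)) =
        - ((- 1) ^ card S * g (x - V a - (\<Sum>i\<in>S. V i)))"
      by (simp add: diff_diff_eq)
  qed simp
  finally show ?thesis by (simp add: fdiff_def sum_negf)
qed

lemma fdiff_union:
  assumes "finite A" "finite B" "A \<inter> B = {}"
  shows "fdiff V (A \<union> B) g = fdiff V A (fdiff V B g)"
  using assms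
proof (induction A rule: finite_induct)
  case (insert a A)
  then show ?case by (simp add: fdiff_insert fun_eq_iff)
qed simp

lemma fdiff_sum:
  "fdiff V A (\<lambda>x. \<Sum>I\<in>T. c I * g I x) x = (\<Sum>I\<in>T. c I * fdiff V A (g I) x)"
  unfolding fdiff_def sum_distrib_left by (subst sum.swap) (simp add: mult_ac)

text \<open>The single factor 1 - T_a already annihilates g.\<close>

lemma fdiff_periodic:
  assumes "finite A" "a \<in> A" "\<And>x. g (x - V a) = g x"
  shows "fdiff V A g x = 0"
proof -
  have "fdiff V (insert a (A - {a})) g x = 0"
  proof -
    have "g (x - V a - s) = g (x - s)" for s
      using assms(3)[of "x - s"] by (simp add: diff_diff_eq add.commute)
    then show ?thesis
      using assms(1) by (subst fdiff_insert) (auto simp: fdiff_def)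
  qed
  then show ?thesis using assms by (simp add: insert_absorb)
qed

lemma has_sum_sum:
  fixes f :: "'b \<Rightarrow> 'a \<Rightarrow> 'c :: topological_comm_monoid_add"
  assumes "\<And>i. i \<in> T \<Longrightarrow> (f i has_sum s i) A"
  shows "((\<lambda>x. \<Sum>i\<in>T. f i x) has_sum (\<Sum>i\<in>T. s i)) A"
  using assms by (induction T rule: infinite_finite_induct) (auto intro!: has_sum_add)

text \<open>As L is invariant under translation by V a, summation against the multiplicative \<psi>
  turns T_a into multiplication by \<psi>(V a). Differences preserve summability, so only the sum
  for g itself has to exist.\<close>

lemma has_sum_fdiff:
  fixes \<psi> :: "'a::real_vector \<Rightarrow> complex"
  assumes L: "\<And>x y. x \<in> L \<Longrightarrow> y \<in> L \<Longrightarrow> x + y \<in> L" "\<And>x y. x \<in> L \<Longrightarrow> y \<in> L \<Longrightarrow> x - y \<in> L"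
    and \<psi>: "\<And>x y. x \<in> L \<Longrightarrow> y \<in> L \<Longrightarrow> \<psi> (x + y) = \<psi> x * \<psi> y"
    and A: "finite A" "\<And>i. i \<in> A \<Longrightarrow> V i \<in> L"
    and s: "((\<lambda>x. \<psi> x * g x) has_sum s) L"
  shows "((\<lambda>x. \<psi> x * fdiff V A g x) has_sum (\<Prod>i\<in>A. 1 - \<psi> (V i)) * s) L"
  using A
proof (induction A rule: finite_induct)
  case (insert a A)
  let ?s = "(\<Prod>i\<in>A. 1 - \<psi> (V i)) * s"
  have IH: "((\<lambda>x. \<psi> x * fdiff V A g x) has_sum ?s) L" and a: "V a \<in> L"
    using insert by auto
  have "((\<lambda>x. \<psi> (x - V a) * fdiff V A g (x - V a)) has_sum ?s) L"
    using IH
    by (subst has_sum_reindex_bij_witness[where j = "\<lambda>x. x - V a" and i = "\<lambda>x. x + V a" and T = L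
         and h = "\<lambda>x. \<psi> x * fdiff V A g x"]) (use a L in auto)
  then have "((\<lambda>x. \<psi> (V a) * (\<psi> (x - V a) * fdiff V A g (x - V a))) has_sum \<psi> (V a) * ?s) L"
    by (rule has_sum_cmult_right)
  also have "?this \<longleftrightarrow> ((\<lambda>x. \<psi> x * fdiff V A g (x - V a)) has_sum \<psi> (V a) * ?s) L"
    using \<psi>[OF a L(2)[OF _ a]] by (intro has_sum_cong) (simp flip: mult.assoc)
  finally have "((\<lambda>x. \<psi> x * fdiff V A g (x - V a)) has_sum \<psi> (V a) * ?s) L" .
  from has_sum_add[OF IH has_sum_uminusI[OF this]]
  have "((\<lambda>x. \<psi> x * fdiff V A g x - \<psi> x * fdiff V A g (x - V a)) has_sum ?s - \<psi> (V a) * ?s) L"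
    by simp
  then show ?case
    using insert.hyps by (simp add: fdiff_insert algebra_simps)
qed (use s in simp)

text \<open>The operator of i sees only the coordinate \<open>c i\<close>, where the indicator of
  c_i > 0 minus that of c_i > 1 is the indicator of 0 < c_i \<le> 1. The alternating sum over
  subsets is the expanded product of these differences.\<close>

lemma fdiff_cone:
  assumes "finite I" and L: "\<And>x S. S \<subseteq> I \<Longrightarrow> x - (\<Sum>j\<in>S. V j) \<in> L \<longleftrightarrow> x \<in> L"
    and c: "\<And>x i S. x \<in> L \<Longrightarrow> i \<in> I \<Longrightarrow> S \<subseteq> I \<Longrightarrow> c i (x - (\<Sum>j\<in>S. V j)) = c i x - (if i \<in> S then 1 else (0::real))"
  shows "fdiff V I (\<lambda>x. of_bool (x \<in> L \<and> (\<forall>i\<in>I. 0 < c i x))) x =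
    of_bool (x \<in> L \<and> (\<forall>i\<in>I. 0 < c i x \<and> c i x \<le> 1))"
proof (cases "x \<in> L")
  case True
  have pb: "(\<Prod>i\<in>S. of_bool (P i)) = (of_bool (\<forall>i\<in>S. P i) :: complex)" if "finite S" for S :: "'b set" and P
    using that by induction auto
  have "fdiff V I (\<lambda>x. of_bool (x \<in> L \<and> (\<forall>i\<in>I. 0 < c i x))) x =
      (\<Sum>S\<in>Pow I. (- 1) ^ card S * (\<Prod>i\<in>S. of_bool (1 < c i x)) * (\<Prod>i\<in>I-S. of_bool (0 < c i x)))"
    unfolding fdiff_def
  proof (rule sum.cong)
    fix S assume "S \<in> Pow I"
    then have S: "S \<subseteq> I" "finite S" "finite (I - S)" using assms(1) finite_subset by auto
    have "(\<forall>i\<in>I. 0 < c i (x - (\<Sum>j\<in>S. V j))) \<longleftrightarrow> (\<forall>i\<in>S. 1 < c i x) \<and> (\<forall>i\<in>I-S. 0 < c i x)"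
      using c[OF True _ S(1)] S(1) by (auto; force)
    then show "(- 1) ^ card S * of_bool (x - (\<Sum>j\<in>S. V j) \<in> L \<and> (\<forall>i\<in>I. 0 < c i (x - (\<Sum>j\<in>S. V j)))) =
       ((- 1) ^ card S * (\<Prod>i\<in>S. of_bool (1 < c i x)) * (\<Prod>i\<in>I-S. of_bool (0 < c i x)) :: complex)"
      using L[OF S(1)] True S by (simp add: pb)
  qed simp
  also have "\<dots> = (\<Prod>i\<in>I. of_bool (0 < c i x) - of_bool (1 < c i x))"
    by (rule prod_diff_conv_sum[symmetric]) fact
  also have "\<dots> = (\<Prod>i\<in>I. of_bool (0 < c i x \<and> c i x \<le> 1))"
    by (rule prod.cong) auto
  finally show ?thesis using True assms(1) by (simp add: pb)
next
  case False
  then show ?thesis using L by (simp add: fdiff_def)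
qed

text \<open>
  The product of the difference operators of all edge vectors annihilates a constant function. Each
  cone is turned into its fundamental box by the operators of its own edges, and the remaining
  operators act on the finite generating function by multiplication, so that no region of
  convergence is needed.
\<close>

lemma weighted_cone_sum_eq_0:
  fixes \<psi> :: "'a::real_vector \<Rightarrow> complex" and c :: "'i set \<Rightarrow> 'i \<Rightarrow> 'a \<Rightarrow> real" and m :: "'i set \<Rightarrow> complex"
  assumes L: "\<And>x y. x \<in> L \<Longrightarrow> y \<in> L \<Longrightarrow> x + y \<in> L" "\<And>x y. x \<in> L \<Longrightarrow> y \<in> L \<Longrightarrow> x - y \<in> L"
    and \<psi>: "\<And>x y. x \<in> L \<Longrightarrow> y \<in> L \<Longrightarrow> \<psi> (x + y) = \<psi> x * \<psi> y"
    and T: "finite T" "\<And>I. I \<in> T \<Longrightarrow> I \<subseteq> E"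
    and E: "finite E" "E \<noteq> {}" "\<And>i. i \<in> E \<Longrightarrow> V i \<in> L" "\<And>i. i \<in> E \<Longrightarrow> \<psi> (V i) \<noteq> 1"
    and c: "\<And>I x i j. I \<in> T \<Longrightarrow> x \<in> L \<Longrightarrow> i \<in> I \<Longrightarrow> j \<in> I \<Longrightarrow> c I i (x - V j) = c I i x - (if i = j then 1 else 0)"
    and box: "\<And>I. I \<in> T \<Longrightarrow> finite {x \<in> L. \<forall>i\<in>I. 0 < c I i x \<and> c I i x \<le> 1}"
    and deg: "\<And>x. x \<in> L \<Longrightarrow> (\<Sum>I\<in>T. m I * of_bool (\<forall>i\<in>I. 0 < c I i x)) = D"
  shows "(\<Sum>I\<in>T. m I * ((\<Sum>x | x \<in> L \<and> (\<forall>i\<in>I. 0 < c I i x \<and> c I i x \<le> 1). \<psi> x) / (\<Prod>i\<in>I. 1 - \<psi> (V i)))) = 0"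
proof -
  define B where "B I = {x \<in> L. \<forall>i\<in>I. 0 < c I i x \<and> c I i x \<le> 1}" for I
  define g where "g I x = (of_bool (x \<in> L \<and> (\<forall>i\<in>I. 0 < c I i x)) :: complex)" for I x
  have fin: "finite I" if "I \<in> T" for I using T(2)[OF that] E(1) by (rule finite_subset)
  have VL: "x - V j \<in> L \<longleftrightarrow> x \<in> L" if "j \<in> E" for x j
    using L(1)[of "x - V j" "V j"] L(2)[of x "V j"] E(3)[OF that] by auto
  have VS: "x - (\<Sum>j\<in>S. V j) \<in> L \<longleftrightarrow> x \<in> L" if "S \<subseteq> E" for x S
    using finite_subset[OF that E(1)] that
  proof (induction S rule: finite_induct)
    case (insert a S)
    have "x - (\<Sum>j\<in>insert a S. V j) = (x - (\<Sum>j\<in>S. V j)) - V a" using insert by simp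
    moreover have "a \<in> E" "x - (\<Sum>j\<in>S. V j) \<in> L \<longleftrightarrow> x \<in> L" using insert by auto
    ultimately show ?case using VL by metis
  qed simp
  have cS: "c I i (x - (\<Sum>j\<in>S. V j)) = c I i x - (if i \<in> S then 1 else 0)"
    if "I \<in> T" "x \<in> L" "i \<in> I" "S \<subseteq> I" for I x i S
    using finite_subset[OF that(4) fin[OF that(1)]] that(4)
  proof (induction S rule: finite_induct)
    case (insert a S)
    have eq: "x - (\<Sum>j\<in>insert a S. V j) = (x - (\<Sum>j\<in>S. V j)) - V a" using insert by simp
    have "x - (\<Sum>j\<in>S. V j) \<in> L" using VS[of S x] insert T(2) that by blast
    then show ?case unfolding eq using insert c[OF that(1) _ that(3), of "x - (\<Sum>j\<in>S. V j)" a] by auto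
  qed simp
  \<comment> \<open>By \<open>deg\<close> the weighted sum is D times the indicator of L, hence
    invariant under translation by any V a; a nonempty E provides such an operator.\<close>
  have sum0: "fdiff V E (\<lambda>x. \<Sum>I\<in>T. m I * g I x) x = 0" for x
  proof -
    obtain a where a: "a \<in> E" using E by blast
    have "(\<Sum>I\<in>T. m I * g I x) = (if x \<in> L then D else 0)" for x
      using deg[of x] by (auto simp: g_def)
    then show ?thesis
      using VL[OF a] by (intro fdiff_periodic[OF E(1) a]) simp
  qed
  let ?P = "\<lambda>A. \<Prod>i\<in>A. 1 - \<psi> (V i)"
  have P: "?P A \<noteq> 0" if "A \<subseteq> E" for A
    using E(4) that finite_subset[OF that E(1)] by (auto simp: subset_eq)
  have gI: "((\<lambda>x. \<psi> x * fdiff V E (g I) x) has_sum ?P (E - I) * (\<Sum>x\<in>B I. \<psi> x)) L" if I: "I \<in> T" for I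
  proof -
    have "(E - I) \<inter> I = {}" "(E - I) \<union> I = E" using T(2)[OF I] by auto
    then have "fdiff V E (g I) = fdiff V (E - I) (fdiff V I (g I))"
      using fdiff_union[of "E - I" I V "g I"] T(2)[OF I] E(1) fin[OF I] by simp
    also have "fdiff V I (g I) = (\<lambda>x. of_bool (x \<in> B I))"
      unfolding g_def B_def using fdiff_cone[OF fin[OF I], of V L "c I"] VS cS[OF I] T(2)[OF I]
      by (auto simp: fun_eq_iff)
    finally have eq: "fdiff V E (g I) = fdiff V (E - I) (\<lambda>x. of_bool (x \<in> B I))" .
    have "((\<lambda>x. \<psi> x * of_bool (x \<in> B I)) has_sum (\<Sum>x\<in>B I. \<psi> x * of_bool (x \<in> B I))) (B I)"
      using box[OF I] by (intro has_sum_finite) (simp add: B_def)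
    also have "?this \<longleftrightarrow> ((\<lambda>x. \<psi> x * of_bool (x \<in> B I)) has_sum (\<Sum>x\<in>B I. \<psi> x * of_bool (x \<in> B I))) L"
      by (rule has_sum_cong_neutral) (auto simp: B_def)
    finally have "((\<lambda>x. \<psi> x * of_bool (x \<in> B I)) has_sum (\<Sum>x\<in>B I. \<psi> x)) L"
      by simp
    then show ?thesis
      unfolding eq using E by (intro has_sum_fdiff[OF L \<psi>]) auto
  qed
  have "((\<lambda>x. \<Sum>I\<in>T. m I * (\<psi> x * fdiff V E (g I) x)) has_sum (\<Sum>I\<in>T. m I * (?P (E - I) * (\<Sum>x\<in>B I. \<psi> x)))) L"
    by (intro has_sum_sum has_sum_cmult_right gI)
  also have "(\<lambda>x. \<Sum>I\<in>T. m I * (\<psi> x * fdiff V E (g I) x)) = (\<lambda>x. \<psi> x * fdiff V E (\<lambda>x. \<Sum>I\<in>T. m I * g I x) x)"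
    unfolding fdiff_sum by (simp add: sum_distrib_left mult_ac)
  also have "\<dots> = (\<lambda>x. 0)" by (simp add: sum0)
  finally have "(\<Sum>I\<in>T. m I * (?P (E - I) * (\<Sum>x\<in>B I. \<psi> x))) = 0"
    using has_sum_unique[OF _ has_sum_0[of L "\<lambda>_. 0 :: complex"]] by auto
  \<comment> \<open>Factoring out the nonzero full product \<open>?P E\<close> turns the product
    over E - I into the reciprocal of the one over I.\<close>
  moreover have "?P (E - I) = ?P E / ?P I" if "I \<in> T" for I
    using prod.subset_diff[OF T(2)[OF that] E(1), of "\<lambda>i. 1 - \<psi> (V i)"] P[OF T(2)[OF that]] by simp
  ultimately have "(\<Sum>I\<in>T. ?P E * (m I * ((\<Sum>x\<in>B I. \<psi> x) / ?P I))) = 0"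
    by (simp add: mult_ac cong: sum.cong)
  then have "?P E * (\<Sum>I\<in>T. m I * ((\<Sum>x\<in>B I. \<psi> x) / ?P I)) = 0"
    unfolding sum_distrib_left[of "?P E" _ T] .
  then show ?thesis using P[of E] by (simp add: B_def)
qed

section \<open>The face ring and simplicial cones\<close>

lemma prod_var_poly:
  assumes "finite J"
  shows "(\<Prod>j\<in>J. var_poly j) = Poly_Mapping.single (\<Sum>j\<in>J. Poly_Mapping.single j 1) 1"
  using assms by induction (simp_all add: var_poly_def mult_single)

lemma lookup_linear_poly:
  assumes "finite (vertices \<Delta>)" "i \<in> vertices \<Delta>"
  shows "Poly_Mapping.lookup (linear_poly \<Delta> d) (Poly_Mapping.single i 1) = d i"
proof -
  have inj: "Poly_Mapping.single j (1::nat) = Poly_Mapping.single i 1 \<longleftrightarrow> j = i" for j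
    by (metis lookup_single_eq lookup_single_not_eq one_neq_zero)
  have "Poly_Mapping.lookup (linear_poly \<Delta> d) (Poly_Mapping.single i 1) =
      (\<Sum>j\<in>vertices \<Delta>. if j = i then d j else 0)"
    unfolding linear_poly_def lookup_sum
    by (intro sum.cong) (auto simp: const_poly_def var_poly_def mult_single lookup_single when_def inj simp del: One_nat_def)
  then show ?thesis using assms by simp
qed

text \<open>A generator contributes only monomials divisible by the squarefree monomial of a
  non-simplex J. If x_i were among them, J would lie in {i}; but the empty set and {i} are
  simplices.\<close>

lemma lookup_face_ideal_linear:
  assumes fin: "finite (vertices \<Delta>)" and "{} \<in> simplices \<Delta>" and i: "i \<in> vertices \<Delta>"
    and p: "p \<in> face_ideal \<Delta>"
  shows "Poly_Mapping.lookup p (Poly_Mapping.single i 1) = 0"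
proof -
  obtain r where p: "p = (\<Sum>J | J \<subseteq> vertices \<Delta> \<and> J \<notin> simplices \<Delta>. r J * (\<Prod>i\<in>J. var_poly i))"
    using p unfolding face_ideal_def by blast
  have "Poly_Mapping.lookup (r J * (\<Prod>i\<in>J. var_poly i)) (Poly_Mapping.single i 1) = 0"
    if J: "J \<subseteq> vertices \<Delta>" "J \<notin> simplices \<Delta>" for J
  proof (rule ccontr)
    let ?m = "\<Sum>j\<in>J. Poly_Mapping.single j (1::nat)"
    have finJ: "finite J" using J(1) fin by (rule finite_subset)
    assume "\<not> ?thesis"
    then have "Poly_Mapping.single i 1 \<in> Poly_Mapping.keys (r J * Poly_Mapping.single ?m 1)"
      by (simp add: prod_var_poly[OF finJ] in_keys_iff)
    then obtain a where a: "Poly_Mapping.single i 1 = a + ?m"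
      using keys_mult[of "r J" "Poly_Mapping.single ?m 1"] by (auto split: if_splits simp del: One_nat_def)
    have "J \<subseteq> {i}"
    proof
      fix j assume "j \<in> J"
      then have "Poly_Mapping.lookup ?m j = 1"
        using finJ by (simp add: lookup_sum lookup_single when_def del: One_nat_def)
      then have "Poly_Mapping.lookup (Poly_Mapping.single i (1::nat)) j \<ge> 1"
        unfolding a by (simp add: lookup_add del: One_nat_def)
      then show "j \<in> {i}" by (simp add: lookup_single when_def split: if_splits)
    qed
    then show False using J assms by (auto simp: vertices_def subset_singleton_iff)
  qed
  then show ?thesis unfolding p lookup_sum by (intro sum.neutral) auto
qed

text \<open>Linear forms inject into the face ring, so \<xi> = u is an identity of
  coefficients.\<close>

lemma face_ring_eq_linearD:
  assumes "finite (vertices \<Delta>)" "{} \<in> simplices \<Delta>"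
    and "face_ring_eq \<Delta> (linear_poly \<Delta> d) (linear_poly \<Delta> d')" "i \<in> vertices \<Delta>"
  shows "d i = d' i"
  using lookup_face_ideal_linear[OF assms(1,2,4), of "linear_poly \<Delta> d - linear_poly \<Delta> d'"] assms
  by (simp add: face_ring_eq_def lookup_minus lookup_linear_poly del: One_nat_def)

section \<open>Extreme rays and the generation of simplicial cones by edge vectors\<close>

lemma convex_cone_hull_finite:
  assumes "finite S"
  shows "convex_cone hull S = {\<Sum>s\<in>S. a s *\<^sub>R s | a. \<forall>s\<in>S. 0 \<le> a s}"
proof (rule hull_unique)
  show "S \<subseteq> {\<Sum>s\<in>S. a s *\<^sub>R s | a. \<forall>s\<in>S. 0 \<le> a s}"
  proof
    fix s assume "s \<in> S"
    then have "s = (\<Sum>t\<in>S. (if t = s then 1 else 0) *\<^sub>R t)"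
      using assms by (simp add: if_distrib[of "\<lambda>c. c *\<^sub>R _"] cong: if_cong)
    then show "s \<in> {\<Sum>s\<in>S. a s *\<^sub>R s | a. \<forall>s\<in>S. 0 \<le> a s}"
      by (intro CollectI exI[of _ "\<lambda>t. if t = s then 1 else 0"]) simp
  qed
  show "convex_cone {\<Sum>s\<in>S. a s *\<^sub>R s | a. \<forall>s\<in>S. 0 \<le> a s}"
    unfolding convex_cone_iff
  proof (intro conjI ballI allI impI)
    have "0 = (\<Sum>s\<in>S. 0 *\<^sub>R s)" by simp
    then show "0 \<in> {\<Sum>s\<in>S. a s *\<^sub>R s | a. \<forall>s\<in>S. 0 \<le> a s}"
      by (intro CollectI exI[of _ "\<lambda>_. 0"]) simp
  next
    fix x y assume "x \<in> {\<Sum>s\<in>S. a s *\<^sub>R s | a. \<forall>s\<in>S. 0 \<le> a s}" "y \<in> {\<Sum>s\<in>S. a s *\<^sub>R s | a. \<forall>s\<in>S. 0 \<le> a s}"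
    then obtain a b where "x = (\<Sum>s\<in>S. a s *\<^sub>R s)" "y = (\<Sum>s\<in>S. b s *\<^sub>R s)" "\<forall>s\<in>S. 0 \<le> a s" "\<forall>s\<in>S. 0 \<le> b s"
      by auto
    then show "x + y \<in> {\<Sum>s\<in>S. a s *\<^sub>R s | a. \<forall>s\<in>S. 0 \<le> a s}"
      by (intro CollectI exI[of _ "\<lambda>s. a s + b s"]) (simp add: sum.distrib scaleR_left_distrib)
  next
    fix x c assume "x \<in> {\<Sum>s\<in>S. a s *\<^sub>R s | a. \<forall>s\<in>S. 0 \<le> a s}" "(0::real) \<le> c"
    then obtain a where "x = (\<Sum>s\<in>S. a s *\<^sub>R s)" "\<forall>s\<in>S. 0 \<le> a s" by auto
    then show "c *\<^sub>R x \<in> {\<Sum>s\<in>S. a s *\<^sub>R s | a. \<forall>s\<in>S. 0 \<le> a s}"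
      using \<open>0 \<le> c\<close> by (intro CollectI exI[of _ "\<lambda>s. c * a s"]) (simp add: scaleR_sum_right)
  qed
  fix T assume "S \<subseteq> T" "convex_cone T"
  then show "{\<Sum>s\<in>S. a s *\<^sub>R s | a. \<forall>s\<in>S. 0 \<le> a s} \<subseteq> T"
  proof -
    have "(\<Sum>s\<in>S'. a s *\<^sub>R s) \<in> T" if "S' \<subseteq> S" "\<forall>s\<in>S'. 0 \<le> a s" for S' and a :: "'a \<Rightarrow> real"
      using finite_subset[OF that(1) assms] that
      by (induction S' rule: finite_induct)
         (use \<open>convex_cone T\<close> \<open>S \<subseteq> T\<close> in \<open>auto intro!: convex_cone_add convex_cone_scaleR convex_cone_contains_0\<close>)
    then show ?thesis by blast
  qed
qed

text \<open>One summand is minus the sum of the others, hence lies both in the cone and in its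
  negative.\<close>

lemma strongly_convex_sum_eq_0:
  assumes C: "strongly_convex (convex_cone hull S)" and S: "finite S" "s \<in> S"
    and a: "\<forall>s\<in>S. 0 \<le> a s" "(\<Sum>s\<in>S. a s *\<^sub>R s) = 0"
  shows "a s *\<^sub>R s = 0"
proof -
  have 1: "a s *\<^sub>R s \<in> convex_cone hull S"
    using a S by (intro convex_cone_hull_mul hull_inc) auto
  have "(\<Sum>t\<in>S. a t *\<^sub>R t) = a s *\<^sub>R s + (\<Sum>t\<in>S-{s}. a t *\<^sub>R t)"
    using S by (rule sum.remove)
  then have 2: "a s *\<^sub>R s = - (\<Sum>t\<in>S-{s}. a t *\<^sub>R t)"
    using a by (simp add: eq_neg_iff_add_eq_0)
  have "(\<Sum>t\<in>S-{s}. a t *\<^sub>R t) = (\<Sum>t\<in>S. (if t = s then 0 else a t) *\<^sub>R t)"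
    using S by (intro sum.mono_neutral_cong_left) auto
  then have "(\<Sum>t\<in>S-{s}. a t *\<^sub>R t) \<in> convex_cone hull S"
    unfolding convex_cone_hull_finite[OF S(1)] using a
    by (intro CollectI exI[of _ "\<lambda>t. if t = s then 0 else a t"]) auto
  with 1 2 have "a s *\<^sub>R s \<in> convex_cone hull S \<inter> uminus ` (convex_cone hull S)" by blast
  then show ?thesis using C unfolding strongly_convex_def by auto
qed

text \<open>
  A generating set of minimal size consists of vectors on extreme rays.
\<close>

lemma strongly_convex_extreme_generators:
  assumes "finite S0" and C: "strongly_convex (convex_cone hull S0)"
  shows "\<exists>S. finite S \<and> convex_cone hull S = convex_cone hull S0 \<and>
    (\<forall>s\<in>S. s \<noteq> 0 \<and> convex_cone hull {s} face_of convex_cone hull S0)"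
proof -
  define P where "P S \<longleftrightarrow> S \<subseteq> S0 \<and> convex_cone hull S = convex_cone hull S0" for S
  have "P S0" by (simp add: P_def)
  then obtain S where PS: "P S" and min: "\<And>S'. P S' \<Longrightarrow> card S \<le> card S'"
    using ex_has_least_nat[of P S0 card] by blast
  have S: "finite S" "S \<subseteq> S0" "convex_cone hull S = convex_cone hull S0"
    using PS assms(1) finite_subset by (auto simp: P_def)
  have CS: "strongly_convex (convex_cone hull S)" using C S(3) by simp
  \<comment> \<open>Otherwise \<open>s\<close> could be dropped, against the minimality of the
    cardinality.\<close>
  have notin: "s \<notin> convex_cone hull (S - {s})" if "s \<in> S" for s
  proof
    assume "s \<in> convex_cone hull (S - {s})"
    then have "S \<subseteq> convex_cone hull (S - {s})" by (auto intro: hull_inc)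
    then have "convex_cone hull S \<subseteq> convex_cone hull (S - {s})"
      using convex_cone_convex_cone_hull by (rule hull_minimal)
    moreover have "convex_cone hull (S - {s}) \<subseteq> convex_cone hull S" by (rule hull_mono) auto
    ultimately have "P (S - {s})" using PS by (auto simp: P_def)
    from min[OF this] show False
      using card_Diff1_less[OF S(1) that] by simp
  qed
  have nz: "s \<noteq> 0" if "s \<in> S" for s
    using notin[OF that] convex_cone_hull_contains_0 by metis
  have "convex_cone hull {s} face_of convex_cone hull S" if s: "s \<in> S" for s
    unfolding face_of_def
  proof (intro conjI ballI impI)
    show "convex_cone hull {s} \<subseteq> convex_cone hull S" using s by (intro hull_mono) auto
    show "convex (convex_cone hull {s})" by (rule convex_convex_cone_hull)
    fix a b x assume ab: "a \<in> convex_cone hull S" "b \<in> convex_cone hull S"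
      and x: "x \<in> convex_cone hull {s}" "x \<in> open_segment a b"
    obtain \<alpha> where \<alpha>: "a = (\<Sum>t\<in>S. \<alpha> t *\<^sub>R t)" "\<forall>t\<in>S. 0 \<le> \<alpha> t"
      using ab(1) unfolding convex_cone_hull_finite[OF S(1)] by blast
    obtain \<beta> where \<beta>: "b = (\<Sum>t\<in>S. \<beta> t *\<^sub>R t)" "\<forall>t\<in>S. 0 \<le> \<beta> t"
      using ab(2) unfolding convex_cone_hull_finite[OF S(1)] by blast
    obtain r where r: "x = r *\<^sub>R s" "0 \<le> r"
      using x(1) by (auto simp: convex_cone_hull_finite)
    obtain \<theta> where \<theta>: "0 < \<theta>" "\<theta> < 1" "x = (1 - \<theta>) *\<^sub>R a + \<theta> *\<^sub>R b"
      using x(2) by (auto simp: in_segment)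
    define \<gamma> where "\<gamma> t = (1 - \<theta>) * \<alpha> t + \<theta> * \<beta> t" for t
    have \<gamma>: "0 \<le> \<gamma> t" if "t \<in> S" for t using that \<alpha> \<beta> \<theta> by (auto simp: \<gamma>_def)
    have "r *\<^sub>R s = (\<Sum>t\<in>S. \<gamma> t *\<^sub>R t)"
      using r \<theta> \<alpha> \<beta> by (simp add: \<gamma>_def sum.distrib scaleR_left_distrib scaleR_sum_right)
    also have "\<dots> = \<gamma> s *\<^sub>R s + (\<Sum>t\<in>S-{s}. \<gamma> t *\<^sub>R t)" using S(1) s by (rule sum.remove)
    finally have eq: "(r - \<gamma> s) *\<^sub>R s = (\<Sum>t\<in>S-{s}. \<gamma> t *\<^sub>R t)" by (simp add: algebra_simps)
    \<comment> \<open>Otherwise solving \<open>eq\<close> for \<open>s\<close> would express it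
      through the other generators.\<close>
    have "r \<le> \<gamma> s"
    proof (rule ccontr)
      assume "\<not> r \<le> \<gamma> s"
      then have "s = (\<Sum>t\<in>S-{s}. (\<gamma> t / (r - \<gamma> s)) *\<^sub>R t)"
        using arg_cong[OF eq, of "\<lambda>v. (1 / (r - \<gamma> s)) *\<^sub>R v"]
        by (simp add: scaleR_sum_right divide_inverse mult_ac)
      moreover have "\<forall>t\<in>S-{s}. 0 \<le> \<gamma> t / (r - \<gamma> s)" using \<gamma> \<open>\<not> r \<le> \<gamma> s\<close> by simp
      ultimately have "s \<in> convex_cone hull (S - {s})"
        unfolding convex_cone_hull_finite[OF finite_Diff[OF S(1)]]
        by (intro CollectI exI[of _ "\<lambda>t. \<gamma> t / (r - \<gamma> s)"] conjI)
      then show False using notin[OF s] by blast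
    qed
    \<comment> \<open>The relation moved to one side: its coefficients are non-negative because r
      \<le> \<gamma> s, so strong convexity makes every term vanish.\<close>
    define \<delta> where "\<delta> t = (if t = s then \<gamma> s - r else \<gamma> t)" for t
    have "(\<Sum>t\<in>S. \<delta> t *\<^sub>R t) = \<delta> s *\<^sub>R s + (\<Sum>t\<in>S-{s}. \<delta> t *\<^sub>R t)" using S(1) s by (rule sum.remove)
    also have "(\<Sum>t\<in>S-{s}. \<delta> t *\<^sub>R t) = (\<Sum>t\<in>S-{s}. \<gamma> t *\<^sub>R t)" by (intro sum.cong) (auto simp: \<delta>_def)
    also have "\<delta> s *\<^sub>R s + \<dots> = 0" unfolding eq[symmetric] by (simp add: \<delta>_def algebra_simps)
    finally have "(\<Sum>t\<in>S. \<delta> t *\<^sub>R t) = 0" .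
    moreover have "\<forall>t\<in>S. 0 \<le> \<delta> t" using \<gamma> \<open>r \<le> \<gamma> s\<close> by (auto simp: \<delta>_def)
    ultimately have \<delta>0: "\<delta> t *\<^sub>R t = 0" if "t \<in> S" for t
      using strongly_convex_sum_eq_0[OF CS S(1) that] by blast
    have \<gamma>0: "\<gamma> t = 0" if "t \<in> S - {s}" for t
      using \<delta>0[of t] nz[of t] that by (simp add: \<delta>_def)
    have \<alpha>\<beta>: "\<alpha> t = 0 \<and> \<beta> t = 0" if "t \<in> S - {s}" for t
    proof -
      have "0 \<le> (1 - \<theta>) * \<alpha> t" "0 \<le> \<theta> * \<beta> t" using that \<alpha> \<beta> \<theta> by auto
      moreover have "(1 - \<theta>) * \<alpha> t + \<theta> * \<beta> t = 0" using \<gamma>0[OF that] by (simp add: \<gamma>_def)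
      ultimately have "(1 - \<theta>) * \<alpha> t = 0" "\<theta> * \<beta> t = 0" by linarith+
      then show ?thesis using \<theta> by simp
    qed
    have "\<alpha> s *\<^sub>R s \<in> convex_cone hull {s}" "\<beta> s *\<^sub>R s \<in> convex_cone hull {s}"
      using \<alpha>(2) \<beta>(2) s by (auto intro: convex_cone_hull_mul[OF hull_inc])
    moreover have "a = \<alpha> s *\<^sub>R s" "b = \<beta> s *\<^sub>R s"
      unfolding \<alpha>(1) \<beta>(1) sum.remove[OF S(1) s] using \<alpha>\<beta> by simp_all
    ultimately show "a \<in> convex_cone hull {s}" "b \<in> convex_cone hull {s}"
      by (simp_all only:)
  qed
  with S nz show ?thesis by (intro exI[of _ S]) auto
qed

lemma simplicial_multi_fanD:
  assumes "simplicial_multi_fan L \<Delta>"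
  shows "finite (simplices \<Delta>)" and "{} \<in> simplices \<Delta>"
    and "top_simplices L \<Delta> \<noteq> {}" and "cone_of \<Delta> {} = {0}"
    and "J \<in> simplices \<Delta> \<Longrightarrow> finite J"
    and "J \<in> simplices \<Delta> \<Longrightarrow> J' \<subseteq> J \<Longrightarrow> J' \<in> simplices \<Delta>"
    and "J \<in> simplices \<Delta> \<Longrightarrow> \<exists>I\<in>top_simplices L \<Delta>. J \<subseteq> I"
    and "J \<in> simplices \<Delta> \<Longrightarrow> rational_polyhedral_cone L (cone_of \<Delta> J)"
    and "J \<in> simplices \<Delta> \<Longrightarrow> strongly_convex (cone_of \<Delta> J)"
    and "J \<in> simplices \<Delta> \<Longrightarrow> dim (cone_of \<Delta> J) = card J"
    and "J \<in> simplices \<Delta> \<Longrightarrow> bij_betw (cone_of \<Delta>) (Pow J) (cone_faces (cone_of \<Delta> J))"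
    and "I \<in> simplices \<Delta> \<Longrightarrow> J \<subseteq> I \<Longrightarrow> J' \<subseteq> I \<Longrightarrow> J \<subseteq> J' \<longleftrightarrow> cone_of \<Delta> J \<subseteq> cone_of \<Delta> J'"
proof -
  note * = assms[unfolded simplicial_multi_fan_def]
  from * show "finite (simplices \<Delta>)" "{} \<in> simplices \<Delta>" "top_simplices L \<Delta> \<noteq> {}"
    "cone_of \<Delta> {} = {0}" by - (elim conjE, assumption)+
  from * have 1: "\<forall>J\<in>simplices \<Delta>. finite J \<and> (\<forall>J'\<subseteq>J. J' \<in> simplices \<Delta>)"
    and 2: "\<forall>J\<in>simplices \<Delta>. \<exists>I\<in>top_simplices L \<Delta>. J \<subseteq> I"
    and 3: "\<forall>J\<in>simplices \<Delta>. rational_polyhedral_cone L (cone_of \<Delta> J) \<and>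
        strongly_convex (cone_of \<Delta> J) \<and> dim (cone_of \<Delta> J) = card J"
    and 4: "\<forall>I\<in>simplices \<Delta>. bij_betw (cone_of \<Delta>) (Pow I) (cone_faces (cone_of \<Delta> I)) \<and>
        (\<forall>J\<subseteq>I. \<forall>J'\<subseteq>I. J \<subseteq> J' \<longleftrightarrow> cone_of \<Delta> J \<subseteq> cone_of \<Delta> J')"
    by - (elim conjE, assumption)+
  from 1 show "J \<in> simplices \<Delta> \<Longrightarrow> finite J" "J \<in> simplices \<Delta> \<Longrightarrow> J' \<subseteq> J \<Longrightarrow> J' \<in> simplices \<Delta>"
    by simp_all
  from 2 show "J \<in> simplices \<Delta> \<Longrightarrow> \<exists>I\<in>top_simplices L \<Delta>. J \<subseteq> I" by simp
  from 3 show "J \<in> simplices \<Delta> \<Longrightarrow> rational_polyhedral_cone L (cone_of \<Delta> J)"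
    "J \<in> simplices \<Delta> \<Longrightarrow> strongly_convex (cone_of \<Delta> J)"
    "J \<in> simplices \<Delta> \<Longrightarrow> dim (cone_of \<Delta> J) = card J" by simp_all
  from 4 show "J \<in> simplices \<Delta> \<Longrightarrow> bij_betw (cone_of \<Delta>) (Pow J) (cone_faces (cone_of \<Delta> J))"
    "I \<in> simplices \<Delta> \<Longrightarrow> J \<subseteq> I \<Longrightarrow> J' \<subseteq> I \<Longrightarrow> J \<subseteq> J' \<longleftrightarrow> cone_of \<Delta> J \<subseteq> cone_of \<Delta> J'"
    by simp_all
qed

text \<open>An extreme generator spans a one-dimensional face. By the bijection with the subsets of
  I this is the cone of a single vertex i, hence the ray of V i. So the vectors V i generate the
  cone, and its dimension |I| leaves no room for a relation among them.\<close>

lemma simplex_cone: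
  assumes fan: "simplicial_multi_fan L \<Delta>" and V: "edge_vectors L \<Delta> V" and I: "I \<in> simplices \<Delta>"
  shows "cone_of \<Delta> I = {\<Sum>i\<in>I. a i *\<^sub>R V i | a. \<forall>i\<in>I. 0 \<le> a i}"
    and "inj_on V I" "independent (V ` I)" "span (cone_of \<Delta> I) = span (V ` I)"
proof -
  note finI = simplicial_multi_fanD(5)[OF fan I] and sub = simplicial_multi_fanD(6)[OF fan I]
    and bij = simplicial_multi_fanD(11)[OF fan I] and mono = simplicial_multi_fanD(12)[OF fan I]
    and cones = simplicial_multi_fanD(8-10)[OF fan]
  have Vi: "V i \<noteq> 0" "V i \<in> cone_of \<Delta> {i}" "V i \<in> cone_of \<Delta> I" if "i \<in> I" for i
  proof -
    have "{i} \<in> simplices \<Delta>" using sub[of "{i}"] that by auto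
    then show "V i \<noteq> 0" and *: "V i \<in> cone_of \<Delta> {i}"
      using V unfolding edge_vectors_def vertices_def by auto
    show "V i \<in> cone_of \<Delta> I" using * mono[of "{i}" I] that by blast
  qed
  obtain S0 where S0: "finite S0" "cone_of \<Delta> I = convex_cone hull S0"
    using cones(1)[OF I] unfolding rational_polyhedral_cone_def by blast
  obtain S where "finite S \<and> convex_cone hull S = convex_cone hull S0 \<and>
    (\<forall>s\<in>S. s \<noteq> 0 \<and> convex_cone hull {s} face_of convex_cone hull S0)"
    using strongly_convex_extreme_generators[OF S0(1)] cones(2)[OF I] S0(2) by auto
  then have S: "finite S" "convex_cone hull S = cone_of \<Delta> I"
    "\<And>s. s \<in> S \<Longrightarrow> s \<noteq> 0" "\<And>s. s \<in> S \<Longrightarrow> convex_cone hull {s} face_of cone_of \<Delta> I"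
    using S0(2) by auto
  have gen: "s \<in> convex_cone hull (V ` I)" if s: "s \<in> S" for s
  proof -
    have "convex_cone hull {s} \<in> cone_faces (cone_of \<Delta> I)"
      using S(4)[OF s] convex_cone_hull_nonempty by (auto simp: cone_faces_def)
    also have "cone_faces (cone_of \<Delta> I) = cone_of \<Delta> ` Pow I"
      using bij by (simp add: bij_betw_def)
    finally obtain J where "J \<in> Pow I" "convex_cone hull {s} = cone_of \<Delta> J"
      by (rule imageE)
    then have J: "J \<subseteq> I" "cone_of \<Delta> J = convex_cone hull {s}" by simp_all
    have "span (convex_cone hull {s}) = span {s}"
    proof (rule antisym)
      show "span (convex_cone hull {s}) \<subseteq> span {s}"
        by (intro span_minimal hull_minimal convex_cone_span subspace_span) (auto intro: span_base)
      show "span {s} \<subseteq> span (convex_cone hull {s})"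
        by (intro span_mono hull_subset)
    qed
    then have "dim (convex_cone hull {s}) = 1"
      using S(3)[OF s] dim_span[of "{s}"] dim_span[of "convex_cone hull {s}"]
        dim_eq_card_independent[of "{s}"] by (simp add: dependent_single)
    then have "card J = 1" using cones(3)[OF sub[OF J(1)]] J(2) by simp
    then obtain i where i: "J = {i}" by (auto simp: card_1_singleton_iff)
    then have "V i \<in> convex_cone hull {s}" using Vi(2)[of i] J by auto
    then obtain c where c: "V i = c *\<^sub>R s" "0 \<le> c" by (auto simp: convex_cone_hull_finite)
    moreover have "c \<noteq> 0" using Vi(1)[of i] i J c by auto
    ultimately have "s = (1 / c) *\<^sub>R V i" "0 \<le> 1 / c" by auto
    moreover have "V i \<in> convex_cone hull (V ` I)" using i J by (intro hull_inc) auto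
    ultimately show ?thesis using convex_cone_hull_mul[of "V i" "V ` I" "1 / c"] by simp
  qed
  have hull: "cone_of \<Delta> I = convex_cone hull (V ` I)"
  proof (rule antisym)
    show "cone_of \<Delta> I \<subseteq> convex_cone hull (V ` I)"
      unfolding S(2)[symmetric] using gen by (intro hull_minimal convex_cone_convex_cone_hull) auto
    show "convex_cone hull (V ` I) \<subseteq> cone_of \<Delta> I"
      unfolding S(2)[symmetric] by (intro hull_minimal convex_cone_convex_cone_hull) (use Vi S(2) in auto)
  qed
  show sp: "span (cone_of \<Delta> I) = span (V ` I)"
  proof (rule antisym)
    show "span (cone_of \<Delta> I) \<subseteq> span (V ` I)"
      unfolding hull by (intro span_minimal hull_minimal convex_cone_span subspace_span) (auto intro: span_base)
    show "span (V ` I) \<subseteq> span (cone_of \<Delta> I)"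
      using Vi by (intro span_mono) auto
  qed
  have "card I = dim (V ` I)" using cones(3)[OF I] sp by (metis dim_span)
  moreover have "dim (V ` I) \<le> card (V ` I)" using finI by (intro dim_le_card') auto
  moreover have "card (V ` I) \<le> card I" using finI by (rule card_image_le)
  ultimately have c: "card (V ` I) = card I" "dim (V ` I) = card (V ` I)" by auto
  show inj: "inj_on V I" using c finI by (simp add: eq_card_imp_inj_on)
  show "independent (V ` I)"
    using c finI by (intro card_le_dim_spanning[of "V ` I" "V ` I"]) (auto intro: span_base)
  show "cone_of \<Delta> I = {\<Sum>i\<in>I. a i *\<^sub>R V i | a. \<forall>i\<in>I. 0 \<le> a i}"
  proof (intro set_eqI iffI)
    fix x assume "x \<in> cone_of \<Delta> I"
    then obtain a where "x = (\<Sum>v\<in>V ` I. a v *\<^sub>R v)" "\<forall>v\<in>V ` I. 0 \<le> a v"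
      unfolding hull using finI by (auto simp: convex_cone_hull_finite)
    then show "x \<in> {\<Sum>i\<in>I. a i *\<^sub>R V i | a. \<forall>i\<in>I. 0 \<le> a i}"
      using inj by (intro CollectI exI[of _ "a \<circ> V"]) (auto simp: sum.reindex)
  next
    fix x assume "x \<in> {\<Sum>i\<in>I. a i *\<^sub>R V i | a. \<forall>i\<in>I. 0 \<le> a i}"
    then obtain a where a: "x = (\<Sum>i\<in>I. a i *\<^sub>R V i)" "\<forall>i\<in>I. 0 \<le> a i" by auto
    have "(\<Sum>i\<in>I'. a i *\<^sub>R V i) \<in> convex_cone hull (V ` I)" if "I' \<subseteq> I" for I'
      using finite_subset[OF that finI] that
      by (induction I' rule: finite_induct)
         (use a in \<open>auto intro!: convex_cone_hull_add convex_cone_hull_mul convex_cone_hull_contains_0 intro: hull_inc\<close>)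
    then show "x \<in> cone_of \<Delta> I" unfolding hull a by blast
  qed
qed

section \<open>Lattices and fundamental boxes\<close>

lemma int_span_finite:
  assumes "finite B"
  shows "int_span B = {\<Sum>b\<in>B. of_int (c b) *\<^sub>R b | c. True}"
proof (intro set_eqI iffI)
  fix x assume "x \<in> int_span B"
  then obtain T c where T: "x = (\<Sum>b\<in>T. of_int (c b) *\<^sub>R b)" "finite T" "T \<subseteq> B"
    unfolding int_span_def by blast
  have "x = (\<Sum>b\<in>B. of_int (if b \<in> T then c b else 0) *\<^sub>R b)"
    unfolding T(1) using T assms by (intro sum.mono_neutral_cong_left) auto
  then show "x \<in> {\<Sum>b\<in>B. of_int (c b) *\<^sub>R b | c. True}"
    by (intro CollectI exI[of _ "\<lambda>b. if b \<in> T then c b else 0"] conjI TrueI)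
next
  fix x assume "x \<in> {\<Sum>b\<in>B. of_int (c b) *\<^sub>R b | c. True}"
  then show "x \<in> int_span B" using assms unfolding int_span_def by blast
qed

lemma is_latticeE:
  assumes "is_lattice L"
  obtains B where "finite B" "independent B" "L = {\<Sum>b\<in>B. of_int (c b) *\<^sub>R b | c. True}" "B \<subseteq> L"
proof -
  obtain B where B: "independent B" "L = int_span B"
    using assms unfolding is_lattice_def by blast
  have fin: "finite B" using B(1) by (rule independent_imp_finite)
  have "B \<subseteq> L"
  proof
    fix b assume "b \<in> B"
    then have "b = (\<Sum>b'\<in>{b}. of_int 1 *\<^sub>R b')" by simp
    then show "b \<in> L" unfolding B(2) int_span_def using \<open>b \<in> B\<close>
      by (intro CollectI exI[of _ "{b}"] exI[of _ "\<lambda>_. 1"]) simp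
  qed
  then show ?thesis using that[OF fin B(1)] int_span_finite[OF fin] B(2) by simp
qed

lemma lattice_0: "is_lattice L \<Longrightarrow> 0 \<in> L"
  by (erule is_latticeE) (auto intro!: exI[of _ "\<lambda>_. 0"])

lemma lattice_add:
  assumes "is_lattice L" "x \<in> L" "y \<in> L"
  shows "x + y \<in> L"
proof -
  obtain B where L: "L = {\<Sum>b\<in>B. of_int (c b) *\<^sub>R b | c. True}"
    using assms(1) by (rule is_latticeE)
  obtain c d where "x = (\<Sum>b\<in>B. of_int (c b) *\<^sub>R b)" "y = (\<Sum>b\<in>B. of_int (d b) *\<^sub>R b)"
    using assms L by blast
  then have "x + y = (\<Sum>b\<in>B. of_int (c b + d b) *\<^sub>R b)"
    by (simp add: sum.distrib scaleR_left_distrib)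
  then show ?thesis unfolding L by (intro CollectI exI[of _ "\<lambda>b. c b + d b"] conjI TrueI)
qed

lemma lattice_scale_int:
  assumes "is_lattice L" "x \<in> L"
  shows "of_int n *\<^sub>R x \<in> L"
proof -
  obtain B where L: "L = {\<Sum>b\<in>B. of_int (c b) *\<^sub>R b | c. True}"
    using assms(1) by (rule is_latticeE)
  obtain c where "x = (\<Sum>b\<in>B. of_int (c b) *\<^sub>R b)"
    using assms L by blast
  then have "of_int n *\<^sub>R x = (\<Sum>b\<in>B. of_int (n * c b) *\<^sub>R b)"
    by (simp add: scaleR_sum_right)
  then show ?thesis unfolding L by (intro CollectI exI[of _ "\<lambda>b. n * c b"] conjI TrueI)
qed

lemma lattice_diff:
  assumes "is_lattice L" "x \<in> L" "y \<in> L"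
  shows "x - y \<in> L"
  using lattice_add[OF assms(1,2) lattice_scale_int[OF assms(1,3), of "- 1"]] by simp

lemma lattice_sum:
  assumes "is_lattice L" "\<And>i. i \<in> A \<Longrightarrow> f i \<in> L"
  shows "sum f A \<in> L"
  using assms(2) by (induction A rule: infinite_finite_induct) (auto intro: lattice_0 lattice_add assms(1))

lemma countable_lattice:
  assumes "is_lattice L"
  shows "countable L"
proof -
  obtain B where B: "finite B" "L = {\<Sum>b\<in>B. of_int (c b) *\<^sub>R b | c. True}"
    using assms by (rule is_latticeE)
  have "L \<subseteq> (\<lambda>c. \<Sum>b\<in>B. of_int (c b) *\<^sub>R b) ` (PiE B (\<lambda>_. UNIV :: int set))"
  proof
    fix x assume "x \<in> L"
    then obtain c where "x = (\<Sum>b\<in>B. of_int (c b) *\<^sub>R b)" using B(2) by blast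
    then have "x = (\<Sum>b\<in>B. of_int (restrict c B b) *\<^sub>R b)" by simp
    then show "x \<in> (\<lambda>c. \<Sum>b\<in>B. of_int (c b) *\<^sub>R b) ` (PiE B (\<lambda>_. UNIV))"
      by (intro image_eqI[where x = "restrict c B"]) auto
  qed
  moreover have "countable (PiE B (\<lambda>_. UNIV :: int set))"
    using B(1) by (intro countable_PiE) auto
  ultimately show ?thesis by (rule countable_subset[OF _ countable_image])
qed

text \<open>Additivity on L gives compatibility with integer multiples, so f is determined by its
  values on a basis, from which it extends linearly. This makes a functional on the whole space out
  of u, which is controlled on L only.\<close>

lemma additive_on_lattice_extends:
  fixes f :: "'a::euclidean_space \<Rightarrow> real"
  assumes L: "is_lattice L" and f: "\<And>x y. x \<in> L \<Longrightarrow> y \<in> L \<Longrightarrow> f (x + y) = f x + f y"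
  shows "\<exists>g. linear g \<and> (\<forall>x\<in>L. g x = f x)"
proof -
  obtain B where B: "finite B" "independent B" "L = {\<Sum>b\<in>B. of_int (c b) *\<^sub>R b | c. True}" "B \<subseteq> L"
    using L by (rule is_latticeE)
  obtain g where g: "linear g" "\<forall>x\<in>B. g x = f x"
    using linear_independent_extend[OF B(2)] by blast
  note closed = lattice_0[OF L] lattice_scale_int[OF L] lattice_add[OF L]
  have f0: "f 0 = 0" using f[of 0 0] closed(1) by simp
  have fneg: "f (- x) = - f x" if "x \<in> L" for x
    using f[of x "- x"] closed(2)[OF that, of "- 1"] that f0 by simp
  have fnat: "f (of_nat n *\<^sub>R x) = of_nat n * f x" if "x \<in> L" for x n
  proof (induction n)
    case (Suc n)
    have "of_nat n *\<^sub>R x \<in> L" using closed(2)[OF that, of "int n"] by simp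
    then show ?case using f[of "of_nat n *\<^sub>R x" x] that Suc by (simp add: algebra_simps)
  qed (simp add: f0)
  have fint: "f (of_int n *\<^sub>R x) = of_int n * f x" if "x \<in> L" for x n
  proof (cases n rule: int_cases2)
    case (nonpos m)
    have "of_nat m *\<^sub>R x \<in> L" using closed(2)[OF that, of "int m"] by simp
    then show ?thesis using fneg fnat[OF that, of m] nonpos by fastforce
  qed (use fnat[OF that] in simp)
  have "g x = f x" if xL: "x \<in> L" for x
  proof -
    obtain c where c: "x = (\<Sum>b\<in>B. of_int (c b) *\<^sub>R b)" using B(3) xL by blast
    have fs: "f (\<Sum>b\<in>B'. of_int (c b) *\<^sub>R b) = (\<Sum>b\<in>B'. of_int (c b) * f b)" if "B' \<subseteq> B" for B'
      using finite_subset[OF that B(1)] that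
    proof (induction B' rule: finite_induct)
      case (insert b B')
      have "b \<in> L" using insert B(4) by blast
      moreover have "(\<Sum>b\<in>B'. of_int (c b) *\<^sub>R b) \<in> L"
        using insert B(4) by (intro lattice_sum[OF L] closed(2)) blast
      ultimately show ?case using insert f[of "of_int (c b) *\<^sub>R b"] closed(2)[of b] fint[of b "c b"] by simp
    qed (simp add: f0)
    have "g x = (\<Sum>b\<in>B. of_int (c b) * g b)"
      unfolding c using g(1) by (simp add: linear_sum linear_scale)
    also have "\<dots> = f x" unfolding c fs[OF subset_refl] using g(2) by simp
    finally show ?thesis .
  qed
  with g(1) show ?thesis by blast
qed

text \<open>Coordinates with respect to a basis of L are linear, hence bounded on X, and integral on
  L; finitely many tuples remain.\<close>

lemma finite_lattice_bounded:
  assumes "is_lattice L" "bounded X"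
  shows "finite (L \<inter> X)"
proof -
  obtain B where B: "finite B" "independent B" "L = {\<Sum>b\<in>B. of_int (c b) *\<^sub>R b | c. True}"
    using assms(1) by (rule is_latticeE)
  have "\<exists>g. linear g \<and> (\<forall>x\<in>B. g x = (if x = b then 1 else 0 :: real))" for b
    by (rule linear_independent_extend[OF B(2)])
  then obtain g where g: "\<And>b. linear (g b)" "\<And>b x. x \<in> B \<Longrightarrow> g b x = (if x = b then 1 else 0 :: real)"
    by metis
  obtain K where K: "\<And>x. x \<in> X \<Longrightarrow> norm x \<le> K" using assms(2) by (auto simp: bounded_iff)
  have "\<exists>M. \<forall>x. norm (g b x) \<le> M * norm x" for b by (rule linear_bounded[OF g(1)])
  then obtain M where M: "\<And>b x. norm (g b x) \<le> M b * norm x" by metis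
  have "L \<inter> X \<subseteq> (\<lambda>c. \<Sum>b\<in>B. of_int (c b) *\<^sub>R b) ` (PiE B (\<lambda>b. {- \<lceil>\<bar>M b\<bar> * K\<rceil>..\<lceil>\<bar>M b\<bar> * K\<rceil>}))"
  proof
    fix x assume x: "x \<in> L \<inter> X"
    then obtain c where c: "x = (\<Sum>b\<in>B. of_int (c b) *\<^sub>R b)" using B(3) by blast
    have gc: "g b x = of_int (c b)" if "b \<in> B" for b
    proof -
      have "g b x = (\<Sum>b'\<in>B. of_int (c b') * g b b')"
        unfolding c using g(1) by (simp add: linear_sum linear_scale)
      also have "\<dots> = (\<Sum>b'\<in>B. if b' = b then of_int (c b') else 0)"
        by (intro sum.cong) (auto simp: g(2))
      finally show ?thesis using that B(1) by simp
    qed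
    have "restrict c B \<in> PiE B (\<lambda>b. {- \<lceil>\<bar>M b\<bar> * K\<rceil>..\<lceil>\<bar>M b\<bar> * K\<rceil>})"
    proof (intro PiE_I)
      fix b assume b: "b \<in> B"
      have "\<bar>of_int (c b)\<bar> \<le> M b * norm x" using M[of b x] gc[OF b] by simp
      also have "\<dots> \<le> \<bar>M b\<bar> * K" using K[of x] x by (intro mult_mono) auto
      finally show "restrict c B b \<in> {- \<lceil>\<bar>M b\<bar> * K\<rceil>..\<lceil>\<bar>M b\<bar> * K\<rceil>}"
        using b by (auto simp: abs_le_iff) linarith+
    qed auto
    moreover have "x = (\<Sum>b\<in>B. of_int (restrict c B b) *\<^sub>R b)" using c by simp
    ultimately show "x \<in> (\<lambda>c. \<Sum>b\<in>B. of_int (c b) *\<^sub>R b) ` (PiE B (\<lambda>b. {- \<lceil>\<bar>M b\<bar> * K\<rceil>..\<lceil>\<bar>M b\<bar> * K\<rceil>}))"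
      by (intro image_eqI[where x = "restrict c B"])
  qed
  moreover have "finite (PiE B (\<lambda>b. {- \<lceil>\<bar>M b\<bar> * K\<rceil>..\<lceil>\<bar>M b\<bar> * K\<rceil>}))"
    using B(1) by (intro finite_PiE) auto
  ultimately show ?thesis by (rule finite_subset[OF _ finite_imageI])
qed

section \<open>One top simplex: dual basis, fundamental box and the finite group H\<close>

text \<open>Isolates what a single top simplex provides, a real basis of \<open>span L\<close> made
  of lattice vectors, so that the local computations need not refer to the fan.\<close>

locale simplex_basis =
  fixes L :: "'a::euclidean_space set" and V :: "'i \<Rightarrow> 'a" and I :: "'i set"
  assumes lattice: "is_lattice L"
    and finite_I: "finite I" and inj: "inj_on V I" and indep: "independent (V ` I)"
    and V_in_L: "V ` I \<subseteq> L" and span_V: "span (V ` I) = span L"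
begin

abbreviation "u \<equiv> dual_basis V I"

lemma dual_basis_sum:
  assumes "x \<in> span L"
  shows "(\<Sum>i\<in>I. u i x *\<^sub>R V i) = x"
proof -
  have "(\<Sum>v\<in>V ` I. representation (V ` I) x v *\<^sub>R v) = x"
    using assms finite_I by (intro sum_representation_eq indep) (auto simp: span_V)
  then show ?thesis by (simp add: sum.reindex[OF inj] dual_basis_def)
qed

lemma dual_basis_V:
  assumes "i \<in> I" "j \<in> I"
  shows "u i (V j) = (if i = j then 1 else 0)"
  using assms inj by (auto simp: dual_basis_def representation_basis[OF indep] inj_on_def)

text \<open>\<open>representation\<close> is zero off the span, so \<open>u i\<close> is in general
  linear on \<open>span L\<close> only. Arguments about linearity are run through a globally linear
  function that agrees with it there.\<close>

lemma dual_basis_linear_extension: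
  assumes "i \<in> I"
  obtains g where "linear g" "\<And>x. x \<in> span L \<Longrightarrow> u i x = g x"
proof -
  obtain g where g: "linear g" "\<forall>v\<in>V ` I. g v = u i v"
    using linear_independent_extend[OF indep] by blast
  have "g x = u i x" if "x \<in> span L" for x
  proof -
    have "g x = (\<Sum>j\<in>I. u j x * g (V j))"
      using g(1) by (subst dual_basis_sum[OF that, symmetric]) (simp add: linear_sum linear_scale)
    also have "\<dots> = (\<Sum>j\<in>I. if j = i then u j x else 0)"
      using g(2) assms by (intro sum.cong) (auto simp: dual_basis_V)
    finally show ?thesis using assms finite_I by simp
  qed
  with g(1) that show ?thesis by metis
qed

lemma dual_basis_add:
  assumes "i \<in> I" "x \<in> span L" "y \<in> span L"
  shows "u i (x + y) = u i x + u i y"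
  by (rule dual_basis_linear_extension[OF assms(1)]) (use assms in \<open>simp add: span_add linear_add\<close>)

lemma dual_basis_diff:
  assumes "i \<in> I" "x \<in> span L" "y \<in> span L"
  shows "u i (x - y) = u i x - u i y"
  by (rule dual_basis_linear_extension[OF assms(1)]) (use assms in \<open>simp add: span_diff linear_diff\<close>)

lemma dual_basis_scale:
  assumes "i \<in> I" "x \<in> span L"
  shows "u i (c *\<^sub>R x) = c * u i x"
  by (rule dual_basis_linear_extension[OF assms(1)]) (use assms in \<open>simp add: span_scale linear_scale\<close>)

lemma linear_expand:
  fixes g :: "'a \<Rightarrow> real"
  assumes "linear g" "x \<in> span L"
  shows "g x = (\<Sum>j\<in>I. u j x * g (V j))"
  using assms(1) by (subst dual_basis_sum[OF assms(2), symmetric]) (simp add: linear_sum linear_scale)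

lemma dual_basis_sum_V:
  assumes "i \<in> I"
  shows "u i (\<Sum>j\<in>I. c j *\<^sub>R V j) = c i"
proof -
  have sp: "V j \<in> span L" if "j \<in> I" for j using V_in_L that by (auto intro: span_base)
  obtain g where g: "linear g" "\<And>x. x \<in> span L \<Longrightarrow> u i x = g x"
    using dual_basis_linear_extension[OF assms] by metis
  have "u i (\<Sum>j\<in>I. c j *\<^sub>R V j) = (\<Sum>j\<in>I. c j * u i (V j))"
    using g sp by (simp add: linear_sum linear_scale span_sum span_scale)
  also have "\<dots> = (\<Sum>j\<in>I. if j = i then c j else 0)"
    using assms by (intro sum.cong) (auto simp: dual_basis_V)
  finally show ?thesis using assms finite_I by simp
qed

lemma edge_lattice_iff:
  assumes "x \<in> span L"
  shows "x \<in> edge_lattice V I \<longleftrightarrow> (\<forall>i\<in>I. u i x \<in> \<int>)"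
proof
  assume "x \<in> edge_lattice V I"
  then obtain c where "x = (\<Sum>v\<in>V ` I. of_int (c v) *\<^sub>R v)"
    unfolding edge_lattice_def int_span_finite[OF finite_imageI[OF finite_I]] by blast
  then have "x = (\<Sum>i\<in>I. of_int (c (V i)) *\<^sub>R V i)" by (simp add: sum.reindex[OF inj])
  then show "\<forall>i\<in>I. u i x \<in> \<int>" using dual_basis_sum_V[of _ "\<lambda>i. of_int (c (V i))"] by simp
next
  assume int: "\<forall>i\<in>I. u i x \<in> \<int>"
  define c where "c v = \<lfloor>u (inv_into I V v) x\<rfloor>" for v
  have "x = (\<Sum>i\<in>I. of_int (c (V i)) *\<^sub>R V i)"
    using int inj by (subst dual_basis_sum[OF assms, symmetric]) (auto simp: c_def intro!: sum.cong elim!: Ints_cases)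
  then have "x = (\<Sum>v\<in>V ` I. of_int (c v) *\<^sub>R v)" by (simp add: sum.reindex[OF inj])
  then show "x \<in> edge_lattice V I"
    unfolding edge_lattice_def int_span_finite[OF finite_imageI[OF finite_I]] by blast
qed

text \<open>The lattice points of a half-open parallelepiped at \<open>y\<close>, open at the lower
  and closed at the upper facets, as produced by the differences of open cones in
  \<open>fdiff_cone\<close>.\<close>

definition box :: "'a \<Rightarrow> 'a set" where
  "box y = {x \<in> L. \<forall>i\<in>I. 0 < u i (x - y) \<and> u i (x - y) \<le> 1}"

lemma finite_box:
  assumes "y \<in> span L"
  shows "finite (box y)"
proof -
  have "box y \<subseteq> L \<inter> cball y (\<Sum>i\<in>I. norm (V i))"
  proof
    fix x assume x: "x \<in> box y"
    then have xy: "x - y \<in> span L" using assms by (auto simp: box_def intro: span_base span_diff)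
    have "norm (x - y) = norm (\<Sum>i\<in>I. u i (x - y) *\<^sub>R V i)" using dual_basis_sum[OF xy] by simp
    also have "\<dots> \<le> (\<Sum>i\<in>I. norm (u i (x - y) *\<^sub>R V i))" by (rule norm_sum)
    also have "\<dots> \<le> (\<Sum>i\<in>I. norm (V i))"
      using x by (intro sum_mono) (auto simp: box_def intro!: mult_left_le_one_le)
    finally show "x \<in> L \<inter> cball y (\<Sum>i\<in>I. norm (V i))"
      using x by (auto simp: box_def dist_norm norm_minus_commute)
  qed
  then show ?thesis
    using finite_subset finite_lattice_bounded[OF lattice bounded_cball] by blast
qed

abbreviation "cong_rel \<equiv> {(x, y). x \<in> L \<and> y \<in> L \<and> x - y \<in> edge_lattice V I}"

lemma cong_rel_iff:
  "(x, y) \<in> cong_rel \<longleftrightarrow> x \<in> L \<and> y \<in> L \<and> (\<forall>i\<in>I. u i x - u i y \<in> \<int>)"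
  using span_base[of _ L] by (auto simp: edge_lattice_iff span_diff dual_basis_diff)

lemma equiv_cong_rel: "equiv L cong_rel"
proof (rule equivI)
  show "refl_on L cong_rel" by (intro refl_onI) (auto simp: cong_rel_iff simp del: mem_Collect_eq case_prod_conv)
  show "sym cong_rel"
  proof (rule symI)
    fix x y assume "(x, y) \<in> cong_rel"
    then show "(y, x) \<in> cong_rel"
      unfolding cong_rel_iff using Ints_minus[of "u _ x - u _ y"] by fastforce
  qed
  show "trans cong_rel"
  proof (rule transI)
    fix x y z assume "(x, y) \<in> cong_rel" "(y, z) \<in> cong_rel"
    then show "(x, z) \<in> cong_rel"
      unfolding cong_rel_iff using Ints_add[of "u _ x - u _ y" "u _ y - u _ z"] by fastforce
  qed
qed auto

lemma coset_rep_cong: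
  assumes "x \<in> L"
  shows "(x, coset_rep (cong_rel `` {x})) \<in> cong_rel"
proof -
  have "x \<in> cong_rel `` {x}" using equiv_class_self[OF equiv_cong_rel assms] .
  then have "coset_rep (cong_rel `` {x}) \<in> cong_rel `` {x}"
    unfolding coset_rep_def by (rule someI)
  then show ?thesis by blast
qed

text \<open>Congruent points have coordinates that differ by integers, and a half-open unit interval
  contains exactly one member of each class modulo 1.\<close>

lemma bij_betw_box:
  assumes y: "y \<in> span L"
  shows "bij_betw (\<lambda>x. cong_rel `` {x}) (box y) (H_group L V I)"
proof (rule bij_betwI')
  fix x x' assume x: "x \<in> box y" "x' \<in> box y"
  show "cong_rel `` {x} = cong_rel `` {x'} \<longleftrightarrow> x = x'"
  proof
    assume eq: "cong_rel `` {x} = cong_rel `` {x'}"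
    have xL: "x \<in> L" "x' \<in> L" using x by (auto simp: box_def)
    have xs: "x \<in> span L" "x' \<in> span L" using xL by (auto intro: span_base)
    have "(x, x') \<in> cong_rel" by (rule eq_equiv_class[OF eq equiv_cong_rel xL(2)])
    then have int: "u i x - u i x' \<in> \<int>" if "i \<in> I" for i using that unfolding cong_rel_iff by blast
    have "u i x = u i x'" if i: "i \<in> I" for i
    proof -
      have "0 < u i x - u i y" "u i x - u i y \<le> 1" "0 < u i x' - u i y" "u i x' - u i y \<le> 1"
        using x i xs y by (auto simp: box_def dual_basis_diff)
      then have "\<bar>u i x - u i x'\<bar> < 1" by linarith
      moreover obtain k where k: "u i x - u i x' = of_int k" using int[OF i] by (elim Ints_cases)
      ultimately have "k = 0" by linarith
      then show ?thesis using k by simp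
    qed
    then have "(\<Sum>i\<in>I. u i x *\<^sub>R V i) = (\<Sum>i\<in>I. u i x' *\<^sub>R V i)" by (intro sum.cong) simp_all
    then show "x = x'" unfolding dual_basis_sum[OF xs(1)] dual_basis_sum[OF xs(2)] .
  qed simp
next
  fix x assume "x \<in> box y"
  then show "cong_rel `` {x} \<in> H_group L V I"
    unfolding H_group_def by (intro quotientI) (simp add: box_def)
next
  fix h assume "h \<in> H_group L V I"
  then obtain x where x: "x \<in> L" "h = cong_rel `` {x}" unfolding H_group_def by (rule quotientE)
  \<comment> \<open>Ceiling minus 1, and not the floor, because the target interval is (0,
    1].\<close>
  define z where "z = (\<Sum>i\<in>I. of_int (\<lceil>u i (x - y)\<rceil> - 1) *\<^sub>R V i)"
  have zL: "z \<in> L" unfolding z_def using V_in_L by (intro lattice_sum lattice lattice_scale_int) auto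
  have uz: "u i z = of_int (\<lceil>u i (x - y)\<rceil> - 1)" if "i \<in> I" for i
    unfolding z_def by (rule dual_basis_sum_V[OF that])
  have sp: "x \<in> span L" "z \<in> span L" using x zL by (auto intro: span_base)
  have xz: "x - z \<in> L" by (rule lattice_diff[OF lattice x(1) zL])
  have "x - z \<in> box y"
    unfolding box_def
  proof (intro CollectI conjI ballI xz)
    fix i assume i: "i \<in> I"
    have "u i (x - z - y) = u i x - u i z - u i y"
      using dual_basis_diff[OF i] sp y by (simp add: span_diff)
    then have "u i (x - z - y) = u i (x - y) - of_int (\<lceil>u i (x - y)\<rceil> - 1)"
      using uz[OF i] dual_basis_diff[OF i sp(1) y] by simp
    then show "0 < u i (x - z - y)" "u i (x - z - y) \<le> 1" by simp_all linarith+
  qed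
  moreover have "(x, x - z) \<in> cong_rel"
    unfolding cong_rel_iff using x xz uz dual_basis_diff sp by auto
  then have "h = cong_rel `` {x - z}" unfolding x(2) by (rule equiv_class_eq[OF equiv_cong_rel])
  ultimately show "\<exists>x\<in>box y. h = cong_rel `` {x}" by blast
qed

text \<open>Frees a class function from the arbitrary choice in \<open>coset_rep\<close>. The base
  point is at disposal and will be Im w / Im \<tau> in the expansion of the genus.\<close>

lemma sum_H_group:
  assumes y: "y \<in> span L"
    and G: "\<And>x x'. (x, x') \<in> cong_rel \<Longrightarrow> G x = G x'"
  shows "(\<Sum>h\<in>H_group L V I. G (coset_rep h)) = (\<Sum>x\<in>box y. G x)"
proof -
  have "(\<Sum>h\<in>H_group L V I. G (coset_rep h)) = (\<Sum>x\<in>box y. G (coset_rep (cong_rel `` {x})))"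
    by (rule sum.reindex_bij_betw[OF bij_betw_box[OF y], symmetric])
  also have "\<dots> = (\<Sum>x\<in>box y. G x)"
  proof (rule sum.cong)
    fix x assume "x \<in> box y"
    then have "x \<in> L" by (simp add: box_def)
    from G[OF coset_rep_cong[OF this]] show "G (coset_rep (cong_rel `` {x})) = G x" by simp
  qed simp
  finally show ?thesis .
qed

lemma finite_H_group: "finite (H_group L V I)"
  using bij_betw_finite[OF bij_betw_box[OF span_zero]] finite_box[OF span_zero] by blast

lemma card_H_group_pos: "card (H_group L V I) > 0"
proof -
  have "cong_rel `` {0} \<in> H_group L V I"
    unfolding H_group_def by (rule quotientI[OF lattice_0[OF lattice]])
  then show ?thesis using finite_H_group by (auto simp: card_gt_0_iff)
qed

lemma coset_rep_in_L:
  assumes "h \<in> H_group L V I"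
  shows "coset_rep h \<in> L"
proof -
  obtain x where "x \<in> L" "h = cong_rel `` {x}" using assms unfolding H_group_def by (rule quotientE)
  then show ?thesis using coset_rep_cong[of x] by blast
qed

text \<open>Orthogonality of characters. If ch(a) \<noteq> 1, translation by \<open>a\<close>
  carries the box at 0 to the box at \<open>a\<close>; both represent the group, so the sum S
  satisfies S = ch(a) S.\<close>

lemma sum_character:
  fixes ch :: "'a \<Rightarrow> complex"
  assumes mult: "\<And>x y. x \<in> L \<Longrightarrow> y \<in> L \<Longrightarrow> ch (x + y) = ch x * ch y"
    and triv: "\<And>x. x \<in> edge_lattice V I \<Longrightarrow> x \<in> L \<Longrightarrow> ch x = 1"
  shows "(\<Sum>h\<in>H_group L V I. ch (coset_rep h)) =
    (if \<forall>x\<in>L. ch x = 1 then of_nat (card (H_group L V I)) else 0)"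
proof (cases "\<forall>x\<in>L. ch x = 1")
  case True
  then show ?thesis using coset_rep_in_L by simp
next
  case False
  then obtain a where a: "a \<in> L" "ch a \<noteq> 1" by blast
  have inv: "ch x = ch x'" if "(x, x') \<in> cong_rel" for x x'
  proof -
    from that have x: "x \<in> L" "x' \<in> L" "x - x' \<in> edge_lattice V I" by auto
    have "ch x = ch ((x - x') + x')" by simp
    also have "\<dots> = ch (x - x') * ch x'" by (intro mult lattice_diff lattice x)
    also have "ch (x - x') = 1" by (intro triv lattice_diff lattice x)
    finally show ?thesis by simp
  qed
  have as: "a \<in> span L" using a by (simp add: span_base)
  have "(\<Sum>h\<in>H_group L V I. ch (coset_rep h)) = (\<Sum>x\<in>box a. ch x)"
    by (rule sum_H_group[OF as inv])
  also have "\<dots> = (\<Sum>x\<in>box 0. ch (a + x))"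
    by (rule sum.reindex_bij_witness[of _ "\<lambda>x. a + x" "\<lambda>x. x - a"])
       (use a lattice_add[OF lattice] lattice_diff[OF lattice] in \<open>auto simp: box_def\<close>)
  also have "\<dots> = ch a * (\<Sum>x\<in>box 0. ch x)"
    unfolding sum_distrib_left by (intro sum.cong refl mult a) (simp add: box_def)
  also have "(\<Sum>x\<in>box 0. ch x) = (\<Sum>h\<in>H_group L V I. ch (coset_rep h))"
    by (rule sum_H_group[OF span_zero inv, symmetric])
  finally have "(1 - ch a) * (\<Sum>h\<in>H_group L V I. ch (coset_rep h)) = 0" by (simp add: left_diff_distrib)
  then have "(\<Sum>h\<in>H_group L V I. ch (coset_rep h)) = 0" using a by simp
  then show ?thesis by (simp only: False if_False)
qed

end

section \<open>Fourier expansion of a summand\<close>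

lemma of_real_of_rat: "complex_of_real (of_rat r) = of_rat r"
  by (cases r) (simp add: of_rat_rat)

text \<open>A function on \<open>insert x A\<close> is a value together with a function on
  \<open>A\<close>, so the absolute multiple series is an iterated sum.\<close>

lemma norm_prod_summable_on_PiE:
  fixes f :: "'i \<Rightarrow> 'k \<Rightarrow> complex"
  assumes "finite A" "\<And>x. x \<in> A \<Longrightarrow> (\<lambda>k. norm (f x k)) summable_on B"
  shows "(\<lambda>g. norm (\<Prod>x\<in>A. f x (g x))) summable_on (PiE A (\<lambda>_. B))"
  using assms
proof (induction A rule: finite_induct)
  case (insert x A)
  let ?h = "\<lambda>(y, g). g(x := y)"
  define s where "s = infsum (\<lambda>g. norm (\<Prod>z\<in>A. f z (g z))) (PiE A (\<lambda>_. B))"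
  have "(\<lambda>(y, g). norm (\<Prod>z\<in>A. f z (g z)) * norm (f x y)) summable_on (B \<times> PiE A (\<lambda>_. B))"
  proof (rule summable_on_SigmaI)
    fix y
    show "((\<lambda>g. case (y, g) of (y, g) \<Rightarrow> norm (\<Prod>z\<in>A. f z (g z)) * norm (f x y)) has_sum
        s * norm (f x y)) (PiE A (\<lambda>_. B))"
      unfolding s_def using insert by (simp add: has_sum_cmult_left)
    show "(\<lambda>y. s * norm (f x y)) summable_on B"
      using insert.prems by (intro summable_on_cmult_right) auto
  qed auto
  also have "?this \<longleftrightarrow> (\<lambda>p. norm (\<Prod>z\<in>insert x A. f z (?h p z))) summable_on (B \<times> PiE A (\<lambda>_. B))"
  proof (rule summable_on_cong)
    fix p :: "'k \<times> ('i \<Rightarrow> 'k)"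
    have "(\<Prod>z\<in>A. f z (?h p z)) = (\<Prod>z\<in>A. f z (snd p z))"
      using insert.hyps by (intro prod.cong) (auto simp: case_prod_unfold)
    then show "(case p of (y, g) \<Rightarrow> norm (\<Prod>z\<in>A. f z (g z)) * norm (f x y)) = norm (\<Prod>z\<in>insert x A. f z (?h p z))"
      using insert.hyps by (simp add: case_prod_unfold norm_mult mult.commute)
  qed
  also have "\<dots> \<longleftrightarrow> (\<lambda>g. norm (\<Prod>z\<in>insert x A. f z (g z))) summable_on (PiE (insert x A) (\<lambda>_. B))"
    unfolding PiE_insert_eq
    by (subst summable_on_reindex[OF inj_combinator[OF insert.hyps(2)]]) (simp add: o_def case_prod_unfold)
  finally show ?case .
qed simp

lemma has_sum_prod_PiE:
  fixes f :: "'i \<Rightarrow> 'k \<Rightarrow> complex"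
  assumes "finite A" "\<And>x. x \<in> A \<Longrightarrow> (\<lambda>k. norm (f x k)) summable_on B" "\<And>x. x \<in> A \<Longrightarrow> (f x has_sum s x) B"
  shows "((\<lambda>g. \<Prod>x\<in>A. f x (g x)) has_sum (\<Prod>x\<in>A. s x)) (PiE A (\<lambda>_. B))"
proof -
  have "(\<lambda>g. \<Prod>x\<in>A. f x (g x)) summable_on (PiE A (\<lambda>_. B))"
    using norm_prod_summable_on_PiE[OF assms(1,2)] by (rule abs_summable_summable)
  moreover have "infsum (\<lambda>g. \<Prod>x\<in>A. f x (g x)) (PiE A (\<lambda>_. B)) = (\<Prod>x\<in>A. infsum (f x) B)"
    by (rule infsum_prod_PiE_abs[OF assms(1,2)])
  moreover have "(\<Prod>x\<in>A. infsum (f x) B) = (\<Prod>x\<in>A. s x)"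
    using assms(3) by (intro prod.cong) (auto intro: infsumI)
  ultimately show ?thesis using has_sum_infsum by metis
qed

text \<open>Restriction to \<open>span L\<close> makes each homomorphism from L to \<int> occur
  exactly once even if L is not of full rank, as is necessary for an index set of a sum.\<close>

definition dual_lattice :: "'a::euclidean_space set \<Rightarrow> ('a \<Rightarrow> real) set" where
  "dual_lattice L = (\<lambda>g. restrict g (span L)) ` {g. linear g \<and> g ` L \<subseteq> \<int>}"

lemma dual_latticeE:
  assumes "f \<in> dual_lattice L"
  obtains g where "linear g" "\<forall>x\<in>L. g x \<in> \<int>" "f = restrict g (span L)"
proof -
  obtain g where "f = restrict g (span L)" "g \<in> {g. linear g \<and> g ` L \<subseteq> \<int>}"
    using assms unfolding dual_lattice_def by (rule imageE)
  then show ?thesis by (intro that[of g]) auto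
qed

context simplex_basis
begin

lemma V_span: "i \<in> I \<Longrightarrow> V i \<in> span L"
  using V_in_L by (auto intro: span_base)

text \<open>An exponent tuple m of the multiple series is the functional \<Sum> m_i u_i, whose value
  at V i is m_i. The floor only converts integral reals to type \<open>int\<close>.\<close>

lemma bij_betw_dual_lattice:
  "bij_betw (\<lambda>f. \<lambda>i\<in>I. \<lfloor>f (V i)\<rfloor>) (dual_lattice L)
     {m \<in> PiE I (\<lambda>_. UNIV). \<forall>v\<in>L. (\<Sum>i\<in>I. of_int (m i) * u i v) \<in> \<int>}"
proof (rule bij_betwI')
  fix f f' assume f: "f \<in> dual_lattice L" "f' \<in> dual_lattice L"
  obtain g where g: "linear g" "\<forall>x\<in>L. g x \<in> \<int>" "f = restrict g (span L)"
    using f(1) by (rule dual_latticeE)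
  obtain g' where g': "linear g'" "\<forall>x\<in>L. g' x \<in> \<int>" "f' = restrict g' (span L)"
    using f(2) by (rule dual_latticeE)
  show "(\<lambda>i\<in>I. \<lfloor>f (V i)\<rfloor>) = (\<lambda>i\<in>I. \<lfloor>f' (V i)\<rfloor>) \<longleftrightarrow> f = f'"
  proof
    assume eq: "(\<lambda>i\<in>I. \<lfloor>f (V i)\<rfloor>) = (\<lambda>i\<in>I. \<lfloor>f' (V i)\<rfloor>)"
    have gV: "g (V i) = g' (V i)" if i: "i \<in> I" for i
    proof -
      have "\<lfloor>g (V i)\<rfloor> = \<lfloor>g' (V i)\<rfloor>"
        using fun_cong[OF eq, of i] i V_span[OF i] by (simp add: g(3) g'(3))
      moreover have "g (V i) \<in> \<int>" "g' (V i) \<in> \<int>" using g(2) g'(2) V_in_L i by auto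
      ultimately show ?thesis by (auto elim!: Ints_cases)
    qed
    have "g x = g' x" if x: "x \<in> span L" for x
      unfolding linear_expand[OF g(1) x] linear_expand[OF g'(1) x] using gV by (intro sum.cong) simp_all
    then show "f = f'" unfolding g(3) g'(3) by (rule restrict_ext)
  qed simp
next
  fix f assume f: "f \<in> dual_lattice L"
  obtain g where g: "linear g" "\<forall>x\<in>L. g x \<in> \<int>" "f = restrict g (span L)"
    using f by (rule dual_latticeE)
  have int: "(\<Sum>i\<in>I. of_int ((\<lambda>i\<in>I. \<lfloor>f (V i)\<rfloor>) i) * u i v) \<in> \<int>" if v: "v \<in> L" for v
  proof -
    have "of_int \<lfloor>f (V i)\<rfloor> = g (V i)" if "i \<in> I" for i
      using bspec[OF g(2), of "V i"] V_in_L V_span[OF that] that by (auto simp: g(3) elim!: Ints_cases)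
    then have "(\<Sum>i\<in>I. of_int ((\<lambda>i\<in>I. \<lfloor>f (V i)\<rfloor>) i) * u i v) = (\<Sum>i\<in>I. u i v * g (V i))"
      by (intro sum.cong) auto
    also have "\<dots> = g v" using linear_expand[OF g(1) span_base[OF v]] by simp
    finally show ?thesis using bspec[OF g(2) v] by simp
  qed
  show "(\<lambda>i\<in>I. \<lfloor>f (V i)\<rfloor>) \<in> {m \<in> PiE I (\<lambda>_. UNIV). \<forall>v\<in>L. (\<Sum>i\<in>I. of_int (m i) * u i v) \<in> \<int>}"
    by (intro CollectI conjI ballI int restrict_PiE_iff[THEN iffD2]) auto
next
  fix m :: "'i \<Rightarrow> int"
  assume m: "m \<in> {m \<in> PiE I (\<lambda>_. UNIV). \<forall>v\<in>L. (\<Sum>i\<in>I. of_int (m i) * u i v) \<in> \<int>}"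
  have "\<exists>g. linear g \<and> (\<forall>v\<in>V ` I. g v = real_of_int (m (inv_into I V v)))"
    by (rule linear_independent_extend[OF indep])
  then obtain g where g: "linear g" "\<forall>v\<in>V ` I. g v = real_of_int (m (inv_into I V v))"
    by blast
  have gV: "g (V i) = of_int (m i)" if "i \<in> I" for i using g(2) that inj by simp
  have "g v \<in> \<int>" if v: "v \<in> L" for v
  proof -
    have "g v = (\<Sum>i\<in>I. of_int (m i) * u i v)"
      unfolding linear_expand[OF g(1) span_base[OF v]] using gV by (intro sum.cong) auto
    then show ?thesis using m v by auto
  qed
  then have "restrict g (span L) \<in> dual_lattice L"
    unfolding dual_lattice_def using g(1) by (intro imageI CollectI conjI image_subsetI)
  moreover have "m = (\<lambda>i\<in>I. \<lfloor>restrict g (span L) (V i)\<rfloor>)"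
  proof
    fix i show "m i = (\<lambda>i\<in>I. \<lfloor>restrict g (span L) (V i)\<rfloor>) i"
      using m gV[of i] V_span[of i] by (cases "i \<in> I") (auto simp: PiE_def extensional_def)
  qed
  ultimately show "\<exists>f\<in>dual_lattice L. m = (\<lambda>i\<in>I. \<lfloor>f (V i)\<rfloor>)"
    by (intro bexI[of _ "restrict g (span L)"])
qed

lemma pairing_shifted_point:
  assumes i: "i \<in> I" and w: "w \<in> lattice_complex L" and v: "v1 \<in> L" "v2 \<in> L"
  shows "pairing_complex (u i) (shifted_point \<tau> w v1 v2) =
    - pairing_complex (u i) w + of_real (u i v1) * \<tau> - of_real (u i v2)"
proof -
  have sp: "fst w \<in> span L" "snd w \<in> span L" "v1 \<in> span L" "v2 \<in> span L"
    using w v by (auto simp: lattice_complex_def span_base)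
  obtain g where g: "linear g" "\<And>x. x \<in> span L \<Longrightarrow> u i x = g x"
    using dual_basis_linear_extension[OF i] by metis
  have sp': "- fst w + Re \<tau> *\<^sub>R v1 - v2 \<in> span L" "- snd w + Im \<tau> *\<^sub>R v1 \<in> span L"
    using sp by (auto intro!: span_add span_diff span_scale span_neg)
  have "shifted_point \<tau> w v1 v2 = (- fst w + Re \<tau> *\<^sub>R v1 - v2, - snd w + Im \<tau> *\<^sub>R v1)"
    by (simp add: shifted_point_def cscale_def complexify_def prod_eq_iff)
  then show ?thesis
    unfolding pairing_complex_def using g sp sp'
    by (simp add: complex_eq_iff linear_add linear_diff linear_neg linear_scale mult.commute)
qed

text \<open>
  Kronecker's expansion of each factor turns a summand of the genus into a multiple Fourier series;
  averaging over the second group element selects the frequencies in the dual lattice. The first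
  group element is represented in the fundamental box at \<^term>\<open>y\<close>, where all expansions are valid.
\<close>

lemma term_has_sum:
  fixes d :: "'i \<Rightarrow> rat" and U :: "'a \<Rightarrow> real"
  assumes \<tau>: "Im \<tau> > 0" and w: "w \<in> lattice_complex L"
    and U: "linear U" "\<And>i. i \<in> I \<Longrightarrow> U (V i) = of_rat (d i)"
    and \<sigma>: "\<And>i. i \<in> I \<Longrightarrow> of_rat (d i) * \<sigma> \<notin> period_lattice \<tau>"
    and y: "y = (1 / Im \<tau>) *\<^sub>R snd w"
    and gen: "\<And>v i. v \<in> L \<Longrightarrow> i \<in> I \<Longrightarrow> u i (v - y) \<notin> \<int>"
  shows "((\<lambda>f. expi (- pairing_complex f w) *
      ((\<Sum>v\<in>box y. expi (of_real (U v) * \<sigma> + of_real (f v) * \<tau>)) /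
       (\<Prod>i\<in>I. 1 - expi (of_real (U (V i)) * \<sigma> + of_real (f (V i)) * \<tau>)))) has_sum
    (1 / of_nat (card (H_group L V I)) *
        (\<Sum>(h1, h2)\<in>H_group L V I \<times> H_group L V I.
           \<Prod>i\<in>I.
             expi (of_rat (d i) * of_real (u i (coset_rep h1)) * \<sigma>) *
             phi_st
               (pairing_complex (u i) (shifted_point \<tau> w (coset_rep h1) (coset_rep h2)))
               \<tau> (of_rat (d i) * \<sigma>)))) (dual_lattice L)"
proof -
  let ?H = "H_group L V I"
  define D where "D i = (of_rat (d i) * \<sigma> :: complex)" for i
  define z where "z i v1 v2 = - pairing_complex (u i) w + of_real (u i v1) * \<tau> - of_real (u i v2)" for i v1 v2
  define K where "K v1 v2 = (\<Prod>i\<in>I. expi (of_real (u i v1) * D i) * phi_st (z i v1 v2) \<tau> (D i))" for v1 v2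
  have ysp: "y \<in> span L" using w by (auto simp: y lattice_complex_def intro!: span_scale)
  \<comment> \<open>An integral change n of u_i(v_1) shifts z by n \<tau>; the multiplier of
    \<open>phi_st\<close> cancels the change of the \<zeta>-power.\<close>
  have K1: "K v1 v2 = K v1' v2" if "(v1, v1') \<in> cong_rel" for v1 v1' v2
    unfolding K_def
  proof (rule prod.cong)
    fix i assume i: "i \<in> I"
    have "u i v1 - u i v1' \<in> \<int>" using that i unfolding cong_rel_iff by blast
    then obtain n where n: "u i v1 - u i v1' = of_int n" by (rule Ints_cases)
    then have u1: "u i v1 = u i v1' + of_int n" by simp
    have "z i v1 v2 = z i v1' v2 + of_int n * \<tau>" by (simp add: z_def u1 algebra_simps)
    then have eq1: "phi_st (z i v1 v2) \<tau> (D i) = phi_st (z i v1' v2) \<tau> (D i) * expi (- of_int n * D i)"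
      by (simp only: phi_st_shift_int[OF \<tau>])
    have eq2: "expi (of_real (u i v1) * D i) * expi (- of_int n * D i) = expi (of_real (u i v1') * D i)"
      unfolding expi_add[symmetric] by (simp add: u1 algebra_simps)
    show "expi (of_real (u i v1) * D i) * phi_st (z i v1 v2) \<tau> (D i) =
        expi (of_real (u i v1') * D i) * phi_st (z i v1' v2) \<tau> (D i)"
      unfolding eq1 eq2[symmetric] by (simp only: mult_ac)
  qed simp
  have "(\<Sum>(h1, h2)\<in>?H \<times> ?H. \<Prod>i\<in>I.
             expi (of_rat (d i) * of_real (u i (coset_rep h1)) * \<sigma>) *
             phi_st (pairing_complex (u i) (shifted_point \<tau> w (coset_rep h1) (coset_rep h2)))
               \<tau> (of_rat (d i) * \<sigma>)) = (\<Sum>(h1, h2)\<in>?H \<times> ?H. K (coset_rep h1) (coset_rep h2))"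
    by (intro sum.cong refl)
       (auto simp: K_def z_def D_def pairing_shifted_point[OF _ w] coset_rep_in_L mult_ac intro!: prod.cong)
  also have "\<dots> = (\<Sum>h1\<in>?H. \<Sum>h2\<in>?H. K (coset_rep h1) (coset_rep h2))"
    by (rule sum.cartesian_product[symmetric])
  also have "\<dots> = (\<Sum>v1\<in>box y. \<Sum>h2\<in>?H. K v1 (coset_rep h2))"
    by (rule sum_H_group[OF ysp]) (intro sum.cong refl K1)
  finally have lhs: "(\<Sum>(h1, h2)\<in>?H \<times> ?H. \<Prod>i\<in>I.
             expi (of_rat (d i) * of_real (u i (coset_rep h1)) * \<sigma>) *
             phi_st (pairing_complex (u i) (shifted_point \<tau> w (coset_rep h1) (coset_rep h2)))
               \<tau> (of_rat (d i) * \<sigma>)) = (\<Sum>v1\<in>box y. \<Sum>h2\<in>?H. K v1 (coset_rep h2))" .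
  define M where "M = {m \<in> PiE I (\<lambda>_. UNIV :: int set). \<forall>v\<in>L. (\<Sum>i\<in>I. of_int (m i) * u i v) \<in> \<int>}"
  define Q where "Q m = (\<Prod>i\<in>I. 1 - expi (D i + of_int (m i) * \<tau>))" for m :: "'i \<Rightarrow> int"
  \<comment> \<open>The part of the term with exponent m that does not involve the second group
    element.\<close>
  define E where "E m v1 = expi (\<Sum>i\<in>I. of_real (u i v1) * D i + of_int (m i) * (of_real (u i v1) * \<tau> - pairing_complex (u i) w)) / Q m"
    for m :: "'i \<Rightarrow> int" and v1
  have K_sum: "((\<lambda>m. E m v1 * expi (- of_real (\<Sum>i\<in>I. of_int (m i) * u i v2))) has_sum K v1 v2) (PiE I (\<lambda>_. UNIV))"
    if v1: "v1 \<in> box y" and v2: "v2 \<in> L" for v1 v2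
  proof -
    have v1L: "v1 \<in> L" using v1 by (simp add: box_def)
    let ?f = "\<lambda>i k. expi (of_real (u i v1) * D i) * (expi (of_int k * z i v1 v2) / (1 - expi (D i + of_int k * \<tau>)))"
    \<comment> \<open>The scaling of y makes Im z equal to Im \<tau> u_i(v_1 - y). The box admits
      the value 1 of the last factor, which \<open>gen\<close> excludes.\<close>
    have Imz: "0 < Im (z i v1 v2)" "Im (z i v1 v2) < Im \<tau>" if i: "i \<in> I" for i
    proof -
      have "u i (v1 - y) = u i v1 - u i y" by (rule dual_basis_diff[OF i span_base[OF v1L] ysp])
      also have "u i y = u i (snd w) / Im \<tau>"
        unfolding y using w by (subst dual_basis_scale[OF i]) (auto simp: lattice_complex_def)
      finally have eq: "Im (z i v1 v2) = Im \<tau> * u i (v1 - y)"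
        using \<tau> by (simp add: z_def pairing_complex_def field_simps)
      have "0 < u i (v1 - y)" "u i (v1 - y) \<le> 1" using v1 i by (auto simp: box_def)
      moreover have "u i (v1 - y) \<noteq> 1" using gen[OF v1L i] by auto
      ultimately have "0 < u i (v1 - y)" "u i (v1 - y) < 1" by auto
      then show "0 < Im (z i v1 v2)" "Im (z i v1 v2) < Im \<tau>" unfolding eq using \<tau> by auto
    qed
    have phi: "(\<lambda>k. norm (expi (of_int k * z i v1 v2) / (1 - expi (D i + of_int k * \<tau>)))) summable_on UNIV"
       "((\<lambda>k. expi (of_int k * z i v1 v2) / (1 - expi (D i + of_int k * \<tau>))) has_sum phi_st (z i v1 v2) \<tau> (D i)) UNIV"
      if i: "i \<in> I" for i
      using phi_st_has_sum[OF \<tau> Imz[OF i] \<sigma>[OF i]] by (simp_all add: D_def)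
    have "((\<lambda>m. \<Prod>i\<in>I. ?f i (m i)) has_sum K v1 v2) (PiE I (\<lambda>_. UNIV))"
      unfolding K_def
    proof (rule has_sum_prod_PiE[OF finite_I])
      fix i assume i: "i \<in> I"
      show "(\<lambda>k. norm (?f i k)) summable_on UNIV"
        unfolding norm_mult[of "expi (of_real (u i v1) * D i)"] by (rule summable_on_cmult_right[OF phi(1)[OF i]])
      show "(?f i has_sum expi (of_real (u i v1) * D i) * phi_st (z i v1 v2) \<tau> (D i)) UNIV"
        by (rule has_sum_cmult_right[OF phi(2)[OF i]])
    qed
    also have "(\<lambda>m. \<Prod>i\<in>I. ?f i (m i)) = (\<lambda>m. E m v1 * expi (- of_real (\<Sum>i\<in>I. of_int (m i) * u i v2)))"
    proof
      fix m :: "'i \<Rightarrow> int"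
      have "(\<Prod>i\<in>I. ?f i (m i)) = (\<Prod>i\<in>I. expi (of_real (u i v1) * D i) * expi (of_int (m i) * z i v1 v2)) / Q m"
        unfolding Q_def prod_dividef[symmetric] by simp
      also have "(\<Prod>i\<in>I. expi (of_real (u i v1) * D i) * expi (of_int (m i) * z i v1 v2)) =
          expi (\<Sum>i\<in>I. of_real (u i v1) * D i + of_int (m i) * z i v1 v2)"
        unfolding expi_sum by (simp add: expi_add)
      also have "(\<Sum>i\<in>I. of_real (u i v1) * D i + of_int (m i) * z i v1 v2) =
          (\<Sum>i\<in>I. of_real (u i v1) * D i + of_int (m i) * (of_real (u i v1) * \<tau> - pairing_complex (u i) w))
          + (- of_real (\<Sum>i\<in>I. of_int (m i) * u i v2))"
        unfolding z_def of_real_sum sum_negf[symmetric] sum.distrib[symmetric]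
        by (intro sum.cong) (auto simp: algebra_simps)
      finally show "(\<Prod>i\<in>I. ?f i (m i)) = E m v1 * expi (- of_real (\<Sum>i\<in>I. of_int (m i) * u i v2))"
        unfolding expi_add E_def by simp
    qed
    finally show ?thesis .
  qed
  have chi: "(\<Sum>h\<in>?H. expi (- of_real (\<Sum>i\<in>I. of_int (m i) * u i (coset_rep h)))) =
      (if m \<in> M then of_nat (card ?H) else 0)" if m: "m \<in> PiE I (\<lambda>_. UNIV)" for m :: "'i \<Rightarrow> int"
  proof -
    let ?ch = "\<lambda>x. expi (- of_real (\<Sum>i\<in>I. of_int (m i) * u i x))"
    have one: "?ch x = 1 \<longleftrightarrow> (\<Sum>i\<in>I. of_int (m i) * u i x) \<in> \<int>" for x
    proof -
      have "?ch x = 1 \<longleftrightarrow> - complex_of_real (\<Sum>i\<in>I. of_int (m i) * u i x) \<in> \<int>" by (rule expi_eq_1_iff)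
      also have "\<dots> \<longleftrightarrow> (\<Sum>i\<in>I. of_int (m i) * u i x) \<in> \<int>"
        unfolding minus_in_Ints_iff of_real_in_Ints_iff ..
      finally show ?thesis .
    qed
    have "(\<Sum>h\<in>?H. ?ch (coset_rep h)) = (if \<forall>x\<in>L. ?ch x = 1 then of_nat (card ?H) else 0)"
    proof (rule sum_character)
      fix x x' assume x: "x \<in> L" "x' \<in> L"
      have "(\<Sum>i\<in>I. of_int (m i) * u i (x + x')) = (\<Sum>i\<in>I. of_int (m i) * u i x) + (\<Sum>i\<in>I. of_int (m i) * u i x')"
        unfolding sum.distrib[symmetric]
        by (intro sum.cong) (auto simp: dual_basis_add span_base x distrib_left)
      then show "?ch (x + x') = ?ch x * ?ch x'"
        unfolding expi_add[symmetric] by (simp only:) simp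
    next
      fix x assume x: "x \<in> edge_lattice V I" "x \<in> L"
      then have "u i x \<in> \<int>" if "i \<in> I" for i using edge_lattice_iff[OF span_base[OF x(2)]] that by blast
      then show "?ch x = 1" unfolding one by (intro Ints_sum Ints_mult) auto
    qed
    then show ?thesis unfolding one using m by (simp add: M_def)
  qed
  have "((\<lambda>m. 1 / of_nat (card ?H) * (\<Sum>v1\<in>box y. \<Sum>h2\<in>?H. E m v1 * expi (- of_real (\<Sum>i\<in>I. of_int (m i) * u i (coset_rep h2))))) has_sum
      (1 / of_nat (card ?H) * (\<Sum>v1\<in>box y. \<Sum>h2\<in>?H. K v1 (coset_rep h2)))) (PiE I (\<lambda>_. UNIV))"
    by (intro has_sum_cmult_right has_sum_sum K_sum coset_rep_in_L)
  \<comment> \<open>By orthogonality the sum of characters over h_2 is the group order on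
    \<open>M\<close> and 0 elsewhere; this cancels the prefactor and leaves the exponents that are
    integral on L.\<close>
  also have "?this \<longleftrightarrow> ((\<lambda>m. \<Sum>v1\<in>box y. E m v1) has_sum
      (1 / of_nat (card ?H) * (\<Sum>v1\<in>box y. \<Sum>h2\<in>?H. K v1 (coset_rep h2)))) M"
  proof (rule has_sum_cong_neutral)
    have eq: "1 / of_nat (card ?H) * (\<Sum>v1\<in>box y. \<Sum>h2\<in>?H. E m v1 * expi (- of_real (\<Sum>i\<in>I. of_int (m i) * u i (coset_rep h2)))) =
        (if m \<in> M then \<Sum>v1\<in>box y. E m v1 else 0)" if "m \<in> PiE I (\<lambda>_. UNIV)" for m
      unfolding sum_distrib_left[symmetric] chi[OF that] using card_H_group_pos
      by (simp flip: sum_distrib_right)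
    show "1 / of_nat (card ?H) * (\<Sum>v1\<in>box y. \<Sum>h2\<in>?H. E m v1 * expi (- of_real (\<Sum>i\<in>I. of_int (m i) * u i (coset_rep h2)))) = 0"
      if "m \<in> PiE I (\<lambda>_. UNIV) - M" for m
      using eq[of m] that by simp
    show "1 / of_nat (card ?H) * (\<Sum>v1\<in>box y. \<Sum>h2\<in>?H. E m v1 * expi (- of_real (\<Sum>i\<in>I. of_int (m i) * u i (coset_rep h2)))) =
        (\<Sum>v1\<in>box y. E m v1)" if "m \<in> PiE I (\<lambda>_. UNIV) \<inter> M" for m
      using eq[of m] that by simp
    show "(\<Sum>v1\<in>box y. E m v1) = 0" if "m \<in> M - PiE I (\<lambda>_. UNIV)" for m
      using that unfolding M_def by blast
  qed
  also have "\<dots> \<longleftrightarrow> ((\<lambda>f. \<Sum>v1\<in>box y. E (\<lambda>i\<in>I. \<lfloor>f (V i)\<rfloor>) v1) has_sum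
      (1 / of_nat (card ?H) * (\<Sum>v1\<in>box y. \<Sum>h2\<in>?H. K v1 (coset_rep h2)))) (dual_lattice L)"
    using has_sum_reindex_bij_betw[OF bij_betw_dual_lattice, folded M_def, of "\<lambda>m. \<Sum>v1\<in>box y. E m v1"]
    by blast
  also have "\<dots> \<longleftrightarrow> ((\<lambda>f. expi (- pairing_complex f w) *
      ((\<Sum>v\<in>box y. expi (of_real (U v) * \<sigma> + of_real (f v) * \<tau>)) /
       (\<Prod>i\<in>I. 1 - expi (of_real (U (V i)) * \<sigma> + of_real (f (V i)) * \<tau>)))) has_sum
      (1 / of_nat (card ?H) * (\<Sum>v1\<in>box y. \<Sum>h2\<in>?H. K v1 (coset_rep h2)))) (dual_lattice L)"
  proof (rule has_sum_cong)
    fix f assume f: "f \<in> dual_lattice L"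
    obtain g where g: "linear g" "\<forall>x\<in>L. g x \<in> \<int>" "f = restrict g (span L)"
      using f by (rule dual_latticeE)
    define m where "m = (\<lambda>i\<in>I. \<lfloor>f (V i)\<rfloor>)"
    have fg: "f x = g x" if "x \<in> span L" for x using that g(3) by simp
    have mg: "of_int (m i) = g (V i)" if "i \<in> I" for i
      using bspec[OF g(2), of "V i"] V_in_L V_span[OF that] that by (auto simp: m_def g(3) elim!: Ints_cases)
    have mg': "complex_of_int (m i) = of_real (g (V i))" if "i \<in> I" for i
      using mg[OF that] by (metis of_real_of_int_eq)
    have D: "D i = of_real (U (V i)) * \<sigma>" if "i \<in> I" for i
      using U(2)[OF that] by (simp add: D_def of_real_of_rat)
    have Qf: "Q m = (\<Prod>i\<in>I. 1 - expi (of_real (U (V i)) * \<sigma> + of_real (f (V i)) * \<tau>))"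
      unfolding Q_def by (intro prod.cong) (auto simp: D mg' fg V_span)
    have wsp: "fst w \<in> span L" "snd w \<in> span L" using w by (auto simp: lattice_complex_def)
    \<comment> \<open>Expansion in the dual basis collapses the three sums over i in the exponent to
      U(v), f(v) and f(w).\<close>
    have "E m v = expi (- pairing_complex f w) * expi (of_real (U v) * \<sigma> + of_real (f v) * \<tau>) / Q m"
      if v: "v \<in> box y" for v
    proof -
      have vsp: "v \<in> span L" using v by (simp add: box_def span_base)
      have "(\<Sum>i\<in>I. of_real (u i v) * D i) = of_real (\<Sum>i\<in>I. u i v * U (V i)) * \<sigma>"
        unfolding of_real_sum sum_distrib_right by (intro sum.cong) (auto simp: D mult_ac)
      also have "(\<Sum>i\<in>I. u i v * U (V i)) = U v" by (rule linear_expand[OF U(1) vsp, symmetric])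
      finally have s1: "(\<Sum>i\<in>I. of_real (u i v) * D i) = of_real (U v) * \<sigma>" .
      have "(\<Sum>i\<in>I. of_int (m i) * (of_real (u i v) * \<tau>)) = of_real (\<Sum>i\<in>I. u i v * g (V i)) * \<tau>"
        unfolding of_real_sum sum_distrib_right by (intro sum.cong) (auto simp: mg' mult_ac)
      also have "(\<Sum>i\<in>I. u i v * g (V i)) = f v" using linear_expand[OF g(1) vsp] fg[OF vsp] by simp
      finally have s2: "(\<Sum>i\<in>I. of_int (m i) * (of_real (u i v) * \<tau>)) = of_real (f v) * \<tau>" .
      have "(\<Sum>i\<in>I. of_int (m i) * pairing_complex (u i) w) =
          Complex (\<Sum>i\<in>I. u i (fst w) * g (V i)) (\<Sum>i\<in>I. u i (snd w) * g (V i))"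
        by (simp add: complex_eq_iff pairing_complex_def mg' mult_ac)
      also have "\<dots> = pairing_complex f w"
        unfolding linear_expand[OF g(1) wsp(1), symmetric] linear_expand[OF g(1) wsp(2), symmetric]
        by (simp add: pairing_complex_def fg wsp)
      finally have s3: "(\<Sum>i\<in>I. of_int (m i) * pairing_complex (u i) w) = pairing_complex f w" .
      have s4: "(\<Sum>i\<in>I. of_real (u i v) * D i + of_int (m i) * (of_real (u i v) * \<tau> - pairing_complex (u i) w)) =
          - pairing_complex f w + (of_real (U v) * \<sigma> + of_real (f v) * \<tau>)"
        unfolding right_diff_distrib sum.distrib sum_subtractf s1 s2 s3 by simp
      show ?thesis by (simp only: E_def s4 expi_add)
    qed
    then have "(\<Sum>v\<in>box y. E m v) = (\<Sum>v\<in>box y. expi (- pairing_complex f w) * expi (of_real (U v) * \<sigma> + of_real (f v) * \<tau>) / Q m)"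
      by (intro sum.cong) auto
    also have "\<dots> = expi (- pairing_complex f w) * ((\<Sum>v\<in>box y. expi (of_real (U v) * \<sigma> + of_real (f v) * \<tau>)) / Q m)"
      by (simp add: sum_distrib_left sum_divide_distrib)
    finally show "(\<Sum>v1\<in>box y. E (\<lambda>i\<in>I. \<lfloor>f (V i)\<rfloor>) v1) = expi (- pairing_complex f w) *
      ((\<Sum>v\<in>box y. expi (of_real (U v) * \<sigma> + of_real (f v) * \<tau>)) /
       (\<Prod>i\<in>I. 1 - expi (of_real (U (V i)) * \<sigma> + of_real (f (V i)) * \<tau>)))"
      unfolding m_def Qf[unfolded m_def] .
  qed
  finally show ?thesis unfolding lhs .
qed

end

section \<open>Vanishing of the genus\<close>

lemma orth_proj_zero: "orth_proj {0} x = x"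
  unfolding orth_proj_def by (rule the_equality) (auto simp: orthogonal_comp_def orthogonal_def)

lemma projected_multi_fan_empty:
  assumes "cone_of \<Delta> {} = {0}"
  shows "projected_multi_fan \<Delta> {} = \<Delta>" "quotient_lattice L \<Delta> {} = L"
  using assms by (simp_all add: projected_multi_fan_def quotient_lattice_def orth_proj_zero image_def)

text \<open>The instance K = {}: its cone is {0}, projection along {0} is the identity, and the
  projected fan is the fan itself.\<close>

lemma complete_imp_pre_complete:
  assumes "simplicial_multi_fan L \<Delta>" "complete_multi_fan L \<Delta>"
  shows "pre_complete L \<Delta>"
proof -
  have "pre_complete (quotient_lattice L \<Delta> {}) (projected_multi_fan \<Delta> {})"
    using assms simplicial_multi_fanD(2)[OF assms(1)] unfolding complete_multi_fan_def by blast
  then show ?thesis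
    unfolding projected_multi_fan_empty[OF simplicial_multi_fanD(4)[OF assms(1)]] .
qed

lemma top_simplex_vertices:
  assumes "simplicial_multi_fan L \<Delta>" "I \<in> top_simplices L \<Delta>"
  shows "I \<subseteq> vertices \<Delta>"
  using simplicial_multi_fanD(6)[OF assms(1), of I] assms(2)
  by (auto simp: top_simplices_def vertices_def)

lemma finite_vertices:
  assumes "simplicial_multi_fan L \<Delta>"
  shows "finite (vertices \<Delta>)"
proof -
  have "(\<lambda>i. {i}) ` vertices \<Delta> \<subseteq> simplices \<Delta>" by (auto simp: vertices_def)
  then have "finite ((\<lambda>i. {i}) ` vertices \<Delta>)"
    using simplicial_multi_fanD(1)[OF assms] by (rule finite_subset)
  then show ?thesis by (rule finite_imageD) simp
qed

text \<open>The edge vectors of a top simplex are independent, lie in L, and are as many as the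
  dimension of L.\<close>

lemma top_simplex_basis:
  assumes "is_lattice L" and fan: "simplicial_multi_fan L \<Delta>" and V: "edge_vectors L \<Delta> V"
    and I: "I \<in> top_simplices L \<Delta>"
  shows "simplex_basis L V I"
proof
  have Is: "I \<in> simplices \<Delta>" and card: "card I = dim L" using I by (auto simp: top_simplices_def)
  note cone = simplex_cone[OF fan V Is]
  show "is_lattice L" "finite I" "inj_on V I" "independent (V ` I)"
    using assms(1) simplicial_multi_fanD(5)[OF fan Is] cone by auto
  show VL: "V ` I \<subseteq> L"
    using top_simplex_vertices[OF fan I] V by (auto simp: edge_vectors_def)
  show "span (V ` I) = span L"
  proof (rule antisym)
    show "span (V ` I) \<subseteq> span L" by (rule span_mono[OF VL])
    have "L \<subseteq> span (V ` I)"
      using VL cone(3) by (rule card_ge_dim_independent) (simp add: card_image[OF cone(2)] card)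
    then show "span L \<subseteq> span (V ` I)" by (rule span_minimal) (rule subspace_span)
  qed
qed

lemma mem_top_cone_iff:
  assumes "is_lattice L" and fan: "simplicial_multi_fan L \<Delta>" and V: "edge_vectors L \<Delta> V"
    and I: "I \<in> top_simplices L \<Delta>" and x: "x \<in> span L"
  shows "x \<in> cone_of \<Delta> I \<longleftrightarrow> (\<forall>i\<in>I. 0 \<le> dual_basis V I i x)"
proof -
  interpret simplex_basis L V I by (rule top_simplex_basis[OF assms(1-4)])
  have "I \<in> simplices \<Delta>" using I by (simp add: top_simplices_def)
  note cone = simplex_cone(1)[OF fan V this]
  show ?thesis
  proof
    assume "x \<in> cone_of \<Delta> I"
    then obtain a where a: "x = (\<Sum>i\<in>I. a i *\<^sub>R V i)" "\<forall>i\<in>I. 0 \<le> a i" unfolding cone by auto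
    then show "\<forall>i\<in>I. 0 \<le> dual_basis V I i x" using dual_basis_sum_V by simp
  next
    assume *: "\<forall>i\<in>I. 0 \<le> dual_basis V I i x"
    have "x = (\<Sum>i\<in>I. dual_basis V I i x *\<^sub>R V i)" using dual_basis_sum[OF x] by simp
    with * show "x \<in> cone_of \<Delta> I" unfolding cone
      by (intro CollectI exI[of _ "\<lambda>i. dual_basis V I i x"] conjI)
  qed
qed

section \<open>Points off the walls: generic translates and vanishing there\<close>

text \<open>One condition with two uses: it excludes the coordinate 0, which makes every v - y
  generic, and the coordinate 1, where Kronecker's expansion breaks down.\<close>

definition wall_avoiding :: "'a::euclidean_space set \<Rightarrow> ('i, 'a) multi_fan \<Rightarrow> ('i \<Rightarrow> 'a) \<Rightarrow> 'a \<Rightarrow> bool" where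
  "wall_avoiding L \<Delta> V y \<longleftrightarrow> (\<forall>I\<in>top_simplices L \<Delta>. \<forall>i\<in>I. \<forall>v\<in>L. dual_basis V I i (v - y) \<notin> \<int>)"

text \<open>A simplex J whose cone has smaller dimension is a proper face of some top simplex I. The
  coordinate of a vertex of I outside J vanishes on the span of the cone of J, but not at v -
  y.\<close>

lemma wall_avoiding_generic:
  assumes "is_lattice L" and fan: "simplicial_multi_fan L \<Delta>" and V: "edge_vectors L \<Delta> V"
    and y: "y \<in> span L" "wall_avoiding L \<Delta> V y" and v: "v \<in> L"
  shows "generic_vector L \<Delta> (v - y)"
  unfolding generic_vector_def
proof (intro conjI ballI impI)
  show "v - y \<in> span L" using y(1) v by (simp add: span_base span_diff)
  fix J assume J: "J \<in> simplices \<Delta>" "dim (cone_of \<Delta> J) < dim L"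
  obtain I where I: "I \<in> top_simplices L \<Delta>" "J \<subseteq> I" using simplicial_multi_fanD(7)[OF fan J(1)] by blast
  interpret simplex_basis L V I by (rule top_simplex_basis[OF assms(1-3) I(1)])
  have "card J < card I"
    using J simplicial_multi_fanD(10)[OF fan J(1)] I(1) by (simp add: top_simplices_def)
  then obtain i where i: "i \<in> I" "i \<notin> J" using I(2) by (metis less_irrefl subsetI subset_antisym)
  obtain g where g: "linear g" "\<And>x. x \<in> span L \<Longrightarrow> dual_basis V I i x = g x"
    using dual_basis_linear_extension[OF i(1)] by metis
  have g0: "g x = 0" if xV: "x \<in> V ` J" for x
  proof -
    obtain j where j: "j \<in> J" "x = V j" using xV by blast
    then have "g x = dual_basis V I i (V j)" using g(2)[OF V_span[of j]] I(2) by auto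
    then show ?thesis using dual_basis_V[OF i(1), of j] j i I(2) by auto
  qed
  show "v - y \<notin> span (cone_of \<Delta> J)"
  proof
    assume "v - y \<in> span (cone_of \<Delta> J)"
    then have "v - y \<in> span (V ` J)" unfolding simplex_cone(4)[OF fan V J(1)] .
    then have "g (v - y) = 0" by (intro linear_eq_0_on_span[OF g(1) g0])
    then have "dual_basis V I i (v - y) = 0"
      using g(2)[of "v - y"] y(1) v by (simp add: span_base span_diff)
    moreover have "dual_basis V I i (v - y) \<notin> \<int>"
      using y(2) I(1) i(1) v unfolding wall_avoiding_def by blast
    ultimately show False by simp
  qed
qed

text \<open>\<open>local_degree\<close> counts closed cones, whereas the difference operators work
  with open ones; off the walls no coordinate vanishes and the two counts agree.\<close>

lemma local_degree_wall_avoiding: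
  assumes "is_lattice L" and fan: "simplicial_multi_fan L \<Delta>" and V: "edge_vectors L \<Delta> V"
    and y: "y \<in> span L" "wall_avoiding L \<Delta> V y" and v: "v \<in> L"
  shows "(\<Sum>I\<in>top_simplices L \<Delta>. of_int (weight \<Delta> I) * of_bool (\<forall>i\<in>I. 0 < dual_basis V I i (v - y))) =
    (of_int (local_degree L \<Delta> (v - y)) :: complex)"
proof -
  have fin: "finite (top_simplices L \<Delta>)"
    using simplicial_multi_fanD(1)[OF fan] by (simp add: top_simplices_def)
  have sp: "v - y \<in> span L" using y(1) v by (simp add: span_base span_diff)
  have iff: "(\<forall>i\<in>I. 0 < dual_basis V I i (v - y)) \<longleftrightarrow> v - y \<in> cone_of \<Delta> I" if I: "I \<in> top_simplices L \<Delta>" for I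
  proof -
    have nz: "dual_basis V I i (v - y) \<noteq> 0" if "i \<in> I" for i
    proof -
      have "dual_basis V I i (v - y) \<notin> \<int>"
        using y(2) I that v unfolding wall_avoiding_def by blast
      then show ?thesis by auto
    qed
    then show ?thesis
      unfolding mem_top_cone_iff[OF assms(1-3) I sp] by (auto simp: less_le)
  qed
  have "(\<Sum>I\<in>top_simplices L \<Delta>. of_int (weight \<Delta> I) * of_bool (\<forall>i\<in>I. 0 < dual_basis V I i (v - y))) =
      (\<Sum>I\<in>top_simplices L \<Delta>. if v - y \<in> cone_of \<Delta> I then of_int (weight \<Delta> I) else (0 :: complex))"
    by (intro sum.cong) (auto simp: iff)
  also have "\<dots> = (\<Sum>I\<in>{I \<in> top_simplices L \<Delta>. v - y \<in> cone_of \<Delta> I}. of_int (weight \<Delta> I))"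
    by (rule sum.inter_filter[OF fin, symmetric])
  finally show ?thesis by (simp add: local_degree_def)
qed

text \<open>All top simplices share the frequencies \<open>dual_lattice L\<close> and the factors
  \<open>expi (- pairing_complex f w)\<close>, so their series add up frequency by frequency, and
  \<open>weighted_cone_sum_eq_0\<close> kills each total coefficient.\<close>

lemma orb_elliptic_genus_wall_avoiding:
  fixes U :: "'a::euclidean_space \<Rightarrow> real"
  assumes L: "is_lattice L" and fan: "simplicial_multi_fan L \<Delta>" and V: "edge_vectors L \<Delta> V"
    and "complete_multi_fan L \<Delta>" and "dim L > 0"
    and U: "linear U" "\<And>i. i \<in> vertices \<Delta> \<Longrightarrow> U (V i) = of_rat (d i)"
    and \<tau>: "Im \<tau> > 0" and \<sigma>: "\<forall>i\<in>vertices \<Delta>. of_rat (d i) * \<sigma> \<notin> period_lattice \<tau>"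
    and w: "w \<in> lattice_complex L"
    and y: "y = (1 / Im \<tau>) *\<^sub>R snd w" "wall_avoiding L \<Delta> V y"
  shows "orb_elliptic_genus L \<Delta> V d \<tau> \<sigma> w = 0"
proof -
  let ?T = "top_simplices L \<Delta>"
  let ?\<psi> = "\<lambda>f x. expi (of_real (U x) * \<sigma> + of_real (f x) * \<tau>)"
  have ysp: "y \<in> span L" using w by (auto simp: y lattice_complex_def intro!: span_scale)
  note sub = top_simplex_vertices[OF fan]
  have finT: "finite ?T" using simplicial_multi_fanD(1)[OF fan] by (simp add: top_simplices_def)
  define S where "S f I = (\<Sum>x | x \<in> L \<and> (\<forall>i\<in>I. 0 < dual_basis V I i (x - y) \<and> dual_basis V I i (x - y) \<le> 1). ?\<psi> f x) /
      (\<Prod>i\<in>I. 1 - ?\<psi> f (V i))" for f I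
  define R where "R I = 1 / of_nat (card (H_group L V I)) *
        (\<Sum>(h1, h2)\<in>H_group L V I \<times> H_group L V I.
           \<Prod>i\<in>I.
             expi (of_rat (d i) * of_real (dual_basis V I i (coset_rep h1)) * \<sigma>) *
             phi_st
               (pairing_complex (dual_basis V I i) (shifted_point \<tau> w (coset_rep h1) (coset_rep h2)))
               \<tau> (of_rat (d i) * \<sigma>))" for I
  have R: "((\<lambda>f. expi (- pairing_complex f w) * S f I) has_sum R I) (dual_lattice L)" if I: "I \<in> ?T" for I
  proof -
    interpret simplex_basis L V I by (rule top_simplex_basis[OF L fan V I])
    have 1: "U (V i) = of_rat (d i)" "of_rat (d i) * \<sigma> \<notin> period_lattice \<tau>" if "i \<in> I" for i
      using U(2) \<sigma> sub[OF I] that by blast+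
    have 2: "dual_basis V I i (v - y) \<notin> \<int>" if "v \<in> L" "i \<in> I" for v i
      using y(2) I that unfolding wall_avoiding_def by blast
    show ?thesis
      using term_has_sum[OF \<tau> w U(1) 1 y(1) 2] unfolding S_def R_def box_def by simp
  qed
  have S0: "(\<Sum>I\<in>?T. of_int (weight \<Delta> I) * S f I) = 0" if f: "f \<in> dual_lattice L" for f
  proof -
    obtain g where g: "linear g" "\<forall>x\<in>L. g x \<in> \<int>" "f = restrict g (span L)"
      using f by (rule dual_latticeE)
    have fg: "f x = g x" if "x \<in> L" for x using that g(3) by (simp add: span_base)
    have VL: "V i \<in> L" if "i \<in> vertices \<Delta>" for i using V that by (auto simp: edge_vectors_def)
    have pc: "pre_complete L \<Delta>" by (rule complete_imp_pre_complete[OF fan assms(4)])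
    show ?thesis
      unfolding S_def
    proof (rule weighted_cone_sum_eq_0[where E = "vertices \<Delta>" and c = "\<lambda>I i x. dual_basis V I i (x - y)"
          and D = "of_int (local_degree L \<Delta> (0 - y))" and L = L])
      show "?\<psi> f (x + x') = ?\<psi> f x * ?\<psi> f x'" if "x \<in> L" "x' \<in> L" for x x'
        using that g(1) U(1) lattice_add[OF L that]
        by (simp add: fg linear_add expi_add[symmetric] algebra_simps)
      show "vertices \<Delta> \<noteq> {}"
      proof -
        obtain I where I: "I \<in> ?T" using simplicial_multi_fanD(3)[OF fan] by blast
        then have "card I > 0" using \<open>dim L > 0\<close> by (simp add: top_simplices_def)
        then show ?thesis using sub[OF I] by auto
      qed
      \<comment> \<open>With the integer k = f(V i), the value is \<zeta>^(d_i) q^k, and d_i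
        \<sigma> lies outside the period lattice.\<close>
      show "?\<psi> f (V i) \<noteq> 1" if i: "i \<in> vertices \<Delta>" for i
      proof
        assume one: "?\<psi> f (V i) = 1"
        obtain k where k: "g (V i) = of_int k" using bspec[OF g(2) VL[OF i]] by (rule Ints_cases)
        have "expi (of_rat (d i) * \<sigma>) * expi \<tau> powi k = 1"
          using one U(2)[OF i] k fg[OF VL[OF i]] by (simp add: of_real_of_rat expi_add expi_of_int_mult)
        then show False using expi_mult_power_eq_1_imp \<sigma> i by blast
      qed
      fix I assume I: "I \<in> ?T"
      interpret simplex_basis L V I by (rule top_simplex_basis[OF L fan V I])
      show "dual_basis V I i (x - V j - y) = dual_basis V I i (x - y) - (if i = j then 1 else 0)"
        if "x \<in> L" "i \<in> I" "j \<in> I" for x i j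
      proof -
        have eq: "x - V j - y = (x - y) - V j" by simp
        show ?thesis
          unfolding eq using that dual_basis_diff[OF that(2), of "x - y" "V j"] V_span[OF that(3)] dual_basis_V[OF that(2,3)] ysp
          by (simp add: span_base span_diff)
      qed
      show "finite {x \<in> L. \<forall>i\<in>I. 0 < dual_basis V I i (x - y) \<and> dual_basis V I i (x - y) \<le> 1}"
        using finite_box[OF ysp] unfolding box_def .
    next
      \<comment> \<open>Pre-completeness enters here: all x - y with x in L are generic, so they
        have the degree of the one vector 0 - y.\<close>
      fix x assume x: "x \<in> L"
      have "local_degree L \<Delta> (x - y) = local_degree L \<Delta> (0 - y)"
        using pc wall_avoiding_generic[OF L fan V ysp y(2)] x lattice_0[OF L]
        unfolding pre_complete_def by blast
      then show "(\<Sum>I\<in>?T. of_int (weight \<Delta> I) * of_bool (\<forall>i\<in>I. 0 < dual_basis V I i (x - y))) =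
          complex_of_int (local_degree L \<Delta> (0 - y))"
        using local_degree_wall_avoiding[OF L fan V ysp y(2) x] by simp
    qed (use lattice_add[OF L] lattice_diff[OF L] finT sub finite_vertices[OF fan] VL in auto)
  qed
  have "((\<lambda>f. \<Sum>I\<in>?T. of_int (weight \<Delta> I) * (expi (- pairing_complex f w) * S f I)) has_sum
      (\<Sum>I\<in>?T. of_int (weight \<Delta> I) * R I)) (dual_lattice L)"
    by (intro has_sum_sum has_sum_cmult_right R)
  also have "?this \<longleftrightarrow> ((\<lambda>f. 0) has_sum (\<Sum>I\<in>?T. of_int (weight \<Delta> I) * R I)) (dual_lattice L)"
  proof (rule has_sum_cong)
    fix f assume "f \<in> dual_lattice L"
    have "(\<Sum>I\<in>?T. of_int (weight \<Delta> I) * (expi (- pairing_complex f w) * S f I)) =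
        expi (- pairing_complex f w) * (\<Sum>I\<in>?T. of_int (weight \<Delta> I) * S f I)"
      unfolding sum_distrib_left by (intro sum.cong) (simp_all only: mult_ac)
    then show "(\<Sum>I\<in>?T. of_int (weight \<Delta> I) * (expi (- pairing_complex f w) * S f I)) = 0"
      using S0[OF \<open>f \<in> dual_lattice L\<close>] by simp
  qed
  finally have "(\<Sum>I\<in>?T. of_int (weight \<Delta> I) * R I) = 0"
    using has_sum_unique[OF _ has_sum_0_simp] by blast
  moreover have "orb_elliptic_genus L \<Delta> V d \<tau> \<sigma> w = (\<Sum>I\<in>?T. of_int (weight \<Delta> I) * R I)"
    unfolding orb_elliptic_genus_def R_def by simp
  ultimately show ?thesis by simp
qed

text \<open>On the line c + k b a functional that is nonzero at b vanishes for one k only. Only the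
  new functional can vanish at b, and it is then constant and nonzero along the line.\<close>

lemma avoid_kernels:
  fixes g :: "'k \<Rightarrow> 'a::real_vector \<Rightarrow> real"
  assumes "finite A" "subspace S" "\<And>j. j \<in> A \<Longrightarrow> linear (g j)" "\<And>j. j \<in> A \<Longrightarrow> \<exists>x\<in>S. g j x \<noteq> 0"
  shows "\<exists>b\<in>S. \<forall>j\<in>A. g j b \<noteq> 0"
  using assms(1,3,4)
proof (induction A rule: finite_induct)
  case empty
  then show ?case using subspace_0[OF assms(2)] by blast
next
  case (insert a A)
  obtain b where b: "b \<in> S" "\<forall>j\<in>A. g j b \<noteq> 0" using insert by auto
  obtain c where c: "c \<in> S" "g a c \<noteq> 0" using insert.prems by blast
  \<comment> \<open>If g_j(b) = 0 the quotient is 0 by convention; avoiding k = 0 as well does no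
    harm.\<close>
  have "\<exists>k. k \<notin> (\<lambda>j. - g j c / g j b) ` insert a A"
    using insert.hyps(1) by (intro ex_new_if_finite[OF infinite_UNIV_char_0]) simp
  then obtain k where k: "k \<notin> (\<lambda>j. - g j c / g j b) ` insert a A" ..
  have lin: "g j (c + k *\<^sub>R b) = g j c + k * g j b" if "j \<in> insert a A" for j
    using insert.prems(1)[OF that] by (simp add: linear_add linear_scale)
  have "g j (c + k *\<^sub>R b) \<noteq> 0" if j: "j \<in> insert a A" for j
  proof
    assume 0: "g j (c + k *\<^sub>R b) = 0"
    show False
    proof (cases "g j b = 0")
      case True
      then have "j = a" using b(2) j by auto
      then show False using 0 lin[OF j] True c(2) by simp
    next
      case False
      then have "k = - g j c / g j b" using 0 lin[OF j] by (simp add: field_simps)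
      then show False using k j by blast
    qed
  qed
  moreover have "c + k *\<^sub>R b \<in> S" using b c assms(2) by (simp add: subspace_add subspace_scale)
  ultimately show ?case by blast
qed

theorem theorem4p2:
  fixes L :: "'a::euclidean_space set"
    and \<Delta> :: "('i, 'a) multi_fan"
    and \<V> :: "'i \<Rightarrow> 'a"
    and d :: "'i \<Rightarrow> rat"
    and u :: "'a \<Rightarrow> rat"
    and \<tau> \<sigma> :: complex
    and w :: "'a \<times> 'a"
  assumes "is_lattice L"
    and "simplicial_multi_fan L \<Delta>"
    and "complete_multi_fan L \<Delta>"
    and "edge_vectors L \<Delta> \<V>"
    and "u \<in> dual_rat L" and "\<exists>x\<in>L. u x \<noteq> 0"
    and "face_ring_eq \<Delta> (linear_poly \<Delta> d) (dual_poly \<Delta> \<V> u)"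
    and "Im \<tau> > 0"
    and "\<forall>i\<in>vertices \<Delta>. of_rat (d i) * \<sigma> \<notin> period_lattice \<tau>"
    and "w \<in> lattice_complex L"
    and "regular_point L \<Delta> \<V> \<tau> w"
  shows "orb_elliptic_genus L \<Delta> \<V> d \<tau> \<sigma> w = 0"
proof (rule ccontr)
  note L = assms(1) and fan = assms(2) and V = assms(4) and \<tau> = assms(8)
  let ?T = "top_simplices L \<Delta>"
  have finT: "finite ?T" using simplicial_multi_fanD(1)[OF fan] by (simp add: top_simplices_def)
  have wsp: "fst w \<in> span L" "snd w \<in> span L" using assms(10) by (auto simp: lattice_complex_def)
  have VL: "\<V> i \<in> L" if "i \<in> vertices \<Delta>" for i using V that by (auto simp: edge_vectors_def)
  have uadd: "real_of_rat (u (x + y)) = real_of_rat (u x) + real_of_rat (u y)" if "x \<in> L" "y \<in> L" for x y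
    using assms(5) that by (simp add: dual_rat_def of_rat_add)
  have "\<exists>U. linear U \<and> (\<forall>x\<in>L. U x = real_of_rat (u x))"
    by (rule additive_on_lattice_extends[OF L uadd])
  then obtain U where U: "linear U" "\<forall>x\<in>L. U x = real_of_rat (u x)" by blast
  have Ud: "U (\<V> i) = real_of_rat (d i)" if "i \<in> vertices \<Delta>" for i
    using face_ring_eq_linearD[OF finite_vertices[OF fan] simplicial_multi_fanD(2)[OF fan] assms(7)[unfolded dual_poly_def] that]
      U(2) VL[OF that] by simp
  \<comment> \<open>An additive u vanishes on a lattice of rank 0. That rank has to be excluded,
    since the genus is then the weight of the empty simplex.\<close>
  have dim: "dim L > 0"
  proof (rule ccontr)
    assume "\<not> dim L > 0"
    then have "L \<subseteq> {0}" by (simp add: dim_eq_0)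
    then have "u 0 \<noteq> 0" "0 \<in> L" using assms(6) lattice_0[OF L] by auto
    then show False using uadd[of 0 0] by simp
  qed
  define A where "A = Sigma ?T (\<lambda>I. I)"
  have finA: "finite A"
    using finT simplicial_multi_fanD(5)[OF fan] by (auto simp: A_def top_simplices_def)
  have "\<exists>g. linear g \<and> (\<forall>x\<in>span L. dual_basis \<V> (fst p) (snd p) x = g x)" if "p \<in> A" for p
  proof -
    have p: "fst p \<in> ?T" "snd p \<in> fst p" using that by (auto simp: A_def)
    interpret simplex_basis L \<V> "fst p" by (rule top_simplex_basis[OF L fan V p(1)])
    show ?thesis using dual_basis_linear_extension[OF p(2)] by metis
  qed
  then obtain g where g: "\<And>p. p \<in> A \<Longrightarrow> linear (g p)"
     "\<And>p x. p \<in> A \<Longrightarrow> x \<in> span L \<Longrightarrow> dual_basis \<V> (fst p) (snd p) x = g p x"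
    by metis
  have "\<exists>b\<in>span L. \<forall>p\<in>A. g p b \<noteq> 0"
  proof (rule avoid_kernels[OF finA subspace_span g(1)])
    fix p assume pA: "p \<in> A"
    then have p: "fst p \<in> ?T" "snd p \<in> fst p" by (auto simp: A_def)
    interpret simplex_basis L \<V> "fst p" by (rule top_simplex_basis[OF L fan V p(1)])
    have "g p (\<V> (snd p)) = 1"
      using g(2)[OF pA V_span[OF p(2)]] dual_basis_V[OF p(2) p(2)] by simp
    then show "\<exists>x\<in>span L. g p x \<noteq> 0" using V_span[OF p(2)] by (intro bexI[of _ "\<V> (snd p)"]) auto
  qed
  then obtain b where b: "b \<in> span L" "\<forall>p\<in>A. g p b \<noteq> 0" by blast
  \<comment> \<open>Only the imaginary part of w is moved, because y depends on it alone; the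
    direction b is transversal to all walls.\<close>
  define W where "W s = w + (0, s *\<^sub>R b)" for s :: real
  have W0: "W 0 = w" by (simp add: W_def zero_prod_def[symmetric])
  have Wsp: "W s \<in> lattice_complex L" for s
    using wsp b(1) by (simp add: W_def lattice_complex_def mem_Times_iff span_add span_scale)
  let ?F = "\<lambda>s. orb_elliptic_genus L \<Delta> \<V> d \<tau> \<sigma> (W s)"
  \<comment> \<open>The parameters s at which a coordinate of v - Im(W s) / Im \<tau> takes the
    integral value k, found by solving this linear equation for s.\<close>
  define bad where "bad = (\<Union>p\<in>A. \<Union>v\<in>L. \<Union>k::int. {(Im \<tau> * (g p v - of_int k) - g p (snd w)) / g p b})"
  have "countable bad"
    unfolding bad_def by (intro countable_UN countable_finite[OF finA] countable_lattice[OF L]) auto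
  have F0: "?F s = 0" if s: "s \<notin> bad" for s
  proof (rule orb_elliptic_genus_wall_avoiding[OF L fan V assms(3) dim U(1) Ud \<tau> assms(9) Wsp refl])
    show "wall_avoiding L \<Delta> \<V> ((1 / Im \<tau>) *\<^sub>R snd (W s))"
      unfolding wall_avoiding_def
    proof (intro ballI notI)
      fix I i v assume Ii: "I \<in> ?T" "i \<in> I" and v: "v \<in> L"
        and "dual_basis \<V> I i (v - (1 / Im \<tau>) *\<^sub>R snd (W s)) \<in> \<int>"
      then obtain k where k: "dual_basis \<V> I i (v - (1 / Im \<tau>) *\<^sub>R snd (W s)) = of_int k"
        by (auto elim: Ints_cases)
      have p: "(I, i) \<in> A" using Ii by (simp add: A_def)
      have sp: "v - (1 / Im \<tau>) *\<^sub>R snd (W s) \<in> span L"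
        using v Wsp[of s] by (auto simp: lattice_complex_def intro!: span_diff span_scale intro: span_base)
      have "dual_basis \<V> I i (v - (1 / Im \<tau>) *\<^sub>R snd (W s)) = g (I, i) (v - (1 / Im \<tau>) *\<^sub>R snd (W s))"
        using g(2)[OF p sp] by simp
      also have "\<dots> = g (I, i) v - (1 / Im \<tau>) * (g (I, i) (snd w) + s * g (I, i) b)"
        using g(1)[OF p] by (simp add: W_def linear_diff linear_scale linear_add add_divide_distrib)
      finally have "of_int k = g (I, i) v - (1 / Im \<tau>) * (g (I, i) (snd w) + s * g (I, i) b)"
        using k by simp
      moreover have "g (I, i) b \<noteq> 0" using b(2) p by blast
      ultimately have "s = (Im \<tau> * (g (I, i) v - of_int k) - g (I, i) (snd w)) / g (I, i) b"
        using \<tau> by (simp add: field_simps)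
      then have "s \<in> bad"
        unfolding bad_def by (intro UN_I[OF p] UN_I[OF v] UN_I[of k]) simp_all
      then show False using s by simp
    qed
  qed
  \<comment> \<open>Regularity of w is used here: at s = 0 no argument of \<open>phi_st\<close> is a
    pole, although w may lie on a wall.\<close>
  have "isCont ?F 0"
    unfolding orb_elliptic_genus_def sum.cartesian_product[symmetric]
  proof (intro continuous_sum continuous_mult continuous_const continuous_prod)
    fix I h1 h2 i
    assume I: "I \<in> ?T" and h: "h1 \<in> H_group L \<V> I" "h2 \<in> H_group L \<V> I" and i: "i \<in> I"
    interpret simplex_basis L \<V> I by (rule top_simplex_basis[OF L fan V I])
    let ?z = "\<lambda>s. pairing_complex (dual_basis \<V> I i) (shifted_point \<tau> (W s) (coset_rep h1) (coset_rep h2))"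
    note rep = coset_rep_in_L[OF h(1)] coset_rep_in_L[OF h(2)]
    have z: "?z s = ?z 0 - \<i> * of_real (s * dual_basis \<V> I i b)" for s
      unfolding pairing_shifted_point[OF i Wsp rep]
      using wsp b(1) by (simp add: W_def pairing_complex_def complex_eq_iff dual_basis_add[OF i] dual_basis_scale[OF i] span_scale)
    have "isCont (\<lambda>s. ?z 0 - \<i> * of_real (s * dual_basis \<V> I i b)) 0"
      by (intro continuous_intros)
    then have cz: "isCont ?z 0" unfolding z[symmetric] .
    have "?z 0 \<notin> period_lattice \<tau>"
      using assms(11) I i rep unfolding regular_point_def W0 by blast
    moreover have "of_rat (d i) * \<sigma> \<notin> period_lattice \<tau>"
      using assms(9) top_simplex_vertices[OF fan I] i by blast
    ultimately show "isCont (\<lambda>s. phi_st (?z s) \<tau> (of_rat (d i) * \<sigma>)) 0"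
      using cz \<tau> by (intro isCont_o2[OF cz continuous_phi_st])
  qed
  moreover assume "orb_elliptic_genus L \<Delta> \<V> d \<tau> \<sigma> w \<noteq> 0"
  ultimately have "\<forall>\<^sub>F s in at 0. ?F s \<noteq> 0"
    unfolding isCont_def by (intro tendsto_imp_eventually_ne[of ?F "?F 0"]) (simp_all add: W0)
  then obtain \<delta> where \<delta>: "\<delta> > 0" "\<And>s. s \<noteq> 0 \<Longrightarrow> dist s 0 < \<delta> \<Longrightarrow> ?F s \<noteq> 0"
    unfolding eventually_at by blast
  \<comment> \<open>A nonzero value at w would persist on an interval, which is uncountable, while
    the genus vanishes off a countable set of parameters.\<close>
  have "{0<..<\<delta>} \<subseteq> bad"
  proof
    fix s assume "s \<in> {0<..<\<delta>}"
    then show "s \<in> bad" using \<delta>(2)[of s] F0[of s] by (cases "s \<in> bad") auto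
  qed
  then have "countable {0<..<\<delta>}" using \<open>countable bad\<close> by (rule countable_subset)
  then show False using uncountable_open_interval[of 0 \<delta>] \<delta>(1) by simp
qed

end
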